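(* Let $1\le k\le m\le n$ and let $\theta=\|\cdot\|_{(k)}$ be the Ky Fan $k$-norm on $\mathbb{R}^{m\times n}$. Let $\overline X,\overline S\in\mathbb{R}^{m\times n}$ satisfy $\overline S\in\partial\theta(\overline X)$, and let $X=\overline X+\overline S$ have the singular value decomposition $X=\overline U[\Sigma(X)\ \ 0]\overline V^T$ with $\overline U\in\mathcal{O}^m$, $\overline V\in\mathcal{O}^n$. Let $\mathcal{C}(X;\partial\theta(\overline X))=\{H\in\mathbb{R}^{m\times n}\mid \theta'(\overline X;H)\le\langle\overline S,H\rangle\}$. Then for $H\in\mathbb{R}^{m\times n}$, $$H\in\mathcal{C}(X;\partial\theta(\overline X))\iff \theta'(\overline X;H)=\langle\overline S,H\rangle,$$ and this is equivalent to the following conditions (with the index sets $\beta,\beta_1,\beta_2,\beta_3,b$ and the notation given in the context). (i) If $\sigma_k(\overline X)>0$, then there exists $\tau\in\mathbb{R}$ such that $$\lambda_{|\beta_1|}(\mathrm{sym}(\overline U_{\beta_1}^TH\overline V_{\beta_1}))\ \ge\ \tau\ \ge\ \lambda_1(\mathrm{sym}(\overline U_{\beta_3}^TH\overline V_{\beta_3}))$$ and $$\mathrm{sym}(\overline U_\beta^TH\overline V_\beta)=\begin{bmatrix}\mathrm{sym}(\overline U_{\beta_1}^TH\overline V_{\beta_1})&0&0\\0&\tau I_{|\beta_2|}&0\\0&0&\mathrm{sym}(\overline U_{\beta_3}^TH\overline V_{\beta_3})\end{bmatrix}.$$ (ii) If $\sigma_k(\overline X)=0$ and $\|\overline S\|_*=k$,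 then there exists $\tau\ge0$ such that $$\lambda_{|\beta_1|}(\mathrm{sym}(\overline U_{\beta_1}^TH\overline V_{\beta_1}))\ \ge\ \tau\ \ge\ \sigma_1\big([\overline U_b^TH\overline V_b\ \ \overline U_b^TH\overline V_2]\big)$$ and $$[\overline U_\beta^TH\overline V_\beta\ \ \overline U_\beta^TH\overline V_2]=\begin{bmatrix}\mathrm{sym}(\overline U_{\beta_1}^TH\overline V_{\beta_1})&0&0&0\\0&\tau I_{|\beta_2|}&0&0\\0&0&\overline U_b^TH\overline V_b&\overline U_b^TH\overline V_2\end{bmatrix}.$$ (iii) If $\sigma_k(\overline X)=0$ and $\|\overline S\|_*<k$, then $\mathrm{sym}(\overline U_{\beta_1}^TH\overline V_{\beta_1})\succeq0$ and $$[\overline U_\beta^TH\overline V_\beta\ \ \overline U_\beta^TH\overline V_2]=\begin{bmatrix}\mathrm{sym}(\overline U_{\beta_1}^TH\overline V_{\beta_1})&0&0&0\\0&0&0&0\\0&0&0&0\end{bmatrix}.$$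
   Context: Inner product: $\langle Y,Z\rangle=\mathrm{Tr}(Y^TZ)$. For $Z\in\mathbb{R}^{m\times n}$ ($m\le n$), $\sigma_1(Z)\ge\dots\ge\sigma_m(Z)$ are the singular values, $\Sigma(Z)=\mathrm{diag}(\sigma(Z))$, $\|Z\|_{(k)}=\sum_{i=1}^k\sigma_i(Z)$, and $\|Z\|_*$ is the nuclear norm. For a symmetric matrix, $\lambda_1\ge\lambda_2\ge\dots$ are its eigenvalues. $\mathcal{O}^p$ is the set of $p\times p$ orthogonal matrices. $\theta'(\overline X;H)$ is the directional derivative and $\partial\theta$ the convex subdifferential. $\mathrm{sym}(Z)=\frac12(Z+Z^T)$ for square $Z$. For an index set $J$, $Z_J$ is the submatrix of the columns of $Z$ indexed by $J$; $\overline V_2$ consists of the last $n-m$ columns of $\overline V$. Index sets: put $\overline\sigma=\sigma(\overline X)$, $\overline u=\sigma(\overline S)$. If $\overline\sigma_k>0$, let $0\le k_0\le k-1$ and $k\le k_1\le m$ be the integers with $\overline\sigma_1\ge\dots\ge\overline\sigma_{k_0}>\overline\sigma_{k_0+1}=\dots=\overline\sigma_k=\dots=\overline\sigma_{k_1}>\overline\sigma_{k_1+1}\ge\dots\ge\overline\sigma_m\ge0$, and $\alpha=\{1,\dots,k_0\}$, $\beta=\{k_0+1,\dots,k_1\}$, $\gamma=\{k_1+1,\dots,m\}$. If $\overline\sigma_k=0$, let $0\le k_0\le k-1$ be the integer with $\overline\sigma_{k_0}>\overline\sigma_{k_0+1}=\dots=\overline\sigma_m=0$, and $\alpha=\{1,\dots,k_0\}$,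 $\beta=\{k_0+1,\dots,m\}$. In both cases $\beta_1=\{i\in\beta:\overline u_i=1\}$, $\beta_2=\{i\in\beta:0<\overline u_i<1\}$, $\beta_3=\{i\in\beta:\overline u_i=0\}$. Also $b=\{i\in\{1,\dots,m\}:\sigma_i(X)=0\}$ (when $\overline\sigma_k=0$ one has $b=\beta_3$). Block matrices are partitioned according to $\beta_1,\beta_2,\beta_3$ (and, for the rightmost column block, the columns of $\overline V_2$). Blocks indexed by an empty set are void and inequalities involving them are vacuous. *)

theory Defs
  imports
    Complex_Main
    "HOL-Library.Multiset"
    "HOL-Computational_Algebra.Polynomial"
    "Jordan_Normal_Form.Matrix"
    "Jordan_Normal_Form.Char_Poly"
    "Jordan_Normal_Form.DL_Submatrix"
begin

text \<open>Real matrices of size m x n are the elements of \<^term>\<open>carrier_mat m n :: real mat set\<close>, whose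
  entries are indexed from 0. Eigenvalues, singular values and the index sets of rows and columns
  are numbered from 1 here; \<open>col_sub\<close> and \<open>singular_block\<close> do the conversion.\<close>

definition mat_trace :: "real mat \<Rightarrow> real" where
  "mat_trace A = (\<Sum>i<dim_row A. A $$ (i, i))"

definition mat_inner :: "real mat \<Rightarrow> real mat \<Rightarrow> real" where
  "mat_inner Y Z = mat_trace (transpose_mat Y * Z)"

definition sym_part :: "real mat \<Rightarrow> real mat" where
  "sym_part Z = (1/2) \<cdot>\<^sub>m (Z + transpose_mat Z)"

definition orthogonal_group :: "nat \<Rightarrow> real mat set" where
  "orthogonal_group p = {Q \<in> carrier_mat p p. transpose_mat Q * Q = 1\<^sub>m p}"

definition psd_mat :: "real mat \<Rightarrow> bool" where
  "psd_mat A \<longleftrightarrow> square_mat A \<and> transpose_mat A = A \<and>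
     (\<forall>v \<in> carrier_vec (dim_row A). 0 \<le> scalar_prod v (A *\<^sub>v v))"

text \<open>The real eigenvalues of a square matrix, in descending order, each repeated according to its
  multiplicity as a root of the characteristic polynomial. It is meant for symmetric matrices, for
  which the list has length \<^term>\<open>dim_row A\<close>; \<open>ord_eigval i A\<close> is unspecified outside
  \<open>1 \<le> i \<le> dim_row A\<close>.\<close>

definition ord_eigvals :: "real mat \<Rightarrow> real list" where
  "ord_eigvals A = rev (sorted_list_of_multiset (proots (char_poly A)))"

definition ord_eigval :: "nat \<Rightarrow> real mat \<Rightarrow> real" where
  "ord_eigval i A = ord_eigvals A ! (i - 1)"

text \<open>The i-th largest singular value, for matrices with at most as many rows as columns and
  \<open>1 \<le> i \<le> dim_row Z\<close>.\<close>

definition sing_val :: "nat \<Rightarrow> real mat \<Rightarrow> real" where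
  "sing_val i Z = sqrt (ord_eigval i (Z * transpose_mat Z))"

definition ky_fan_norm :: "nat \<Rightarrow> real mat \<Rightarrow> real" where
  "ky_fan_norm k Z = (\<Sum>i = 1..k. sing_val i Z)"

definition nuclear_norm :: "real mat \<Rightarrow> real" where
  "nuclear_norm Z = (\<Sum>i = 1..dim_row Z. sing_val i Z)"

text \<open>The matrix \<open>[\<Sigma>(Z) 0]\<close>, of the same size as \<open>Z\<close>.\<close>

definition singular_block :: "real mat \<Rightarrow> real mat" where
  "singular_block Z = mat (dim_row Z) (dim_col Z) (\<lambda>(i, j). if i = j then sing_val (i + 1) Z else 0)"

definition dir_deriv :: "(real mat \<Rightarrow> real) \<Rightarrow> real mat \<Rightarrow> real mat \<Rightarrow> real" where
  "dir_deriv f X H = Lim (at_right 0) (\<lambda>t. (f (X + t \<cdot>\<^sub>m H) - f X) / t)"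

definition subdifferential :: "nat \<Rightarrow> nat \<Rightarrow> (real mat \<Rightarrow> real) \<Rightarrow> real mat \<Rightarrow> real mat set" where
  "subdifferential m n f X =
     {S \<in> carrier_mat m n. \<forall>Z \<in> carrier_mat m n. f X + mat_inner S (Z - X) \<le> f Z}"

text \<open>The critical cone of the subdifferential of f at \<open>Xb\<close>, associated with the point
  \<open>X = Xb + Sb\<close>, where \<open>Sb\<close> is a subgradient of f at \<open>Xb\<close>.\<close>

definition critical_cone ::
  "nat \<Rightarrow> nat \<Rightarrow> (real mat \<Rightarrow> real) \<Rightarrow> real mat \<Rightarrow> real mat \<Rightarrow> real mat set" where
  "critical_cone m n f Xb Sb =
     {H \<in> carrier_mat m n. dir_deriv f Xb H \<le> mat_inner Sb H}"

text \<open>The submatrix of the columns numbered (from 1) by \<open>J\<close>, in increasing order.\<close>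

definition col_sub :: "real mat \<Rightarrow> nat set \<Rightarrow> real mat" where
  "col_sub A J = submatrix A UNIV {j. Suc j \<in> J}"

definition append_cols :: "real mat \<Rightarrow> real mat \<Rightarrow> real mat" where
  "append_cols A B = four_block_mat A B (0\<^sub>m 0 (dim_col A)) (0\<^sub>m 0 (dim_col B))"

end

theory Submission
  imports Defs
begin

text \<open>Why the theorem is true. By Ky Fan's principle \<open>\<theta>(Z)\<close> is the maximum of the linear functionals
\<open>Z \<mapsto> \<Sum>l<k. p\<^sub>l\<^sup>T Z q\<^sub>l\<close>, where \<open>p\<^sub>l\<close> and \<open>q\<^sub>l\<close> are the columns of orthogonal matrices \<open>P\<close> and \<open>Q\<close>
(\<open>ky_fan_inequality\<close>, \<open>ky_fan_attained\<close>). These functionals form a compact family, so \<open>\<theta>'(Xb; H)\<close>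
is the largest value at \<open>H\<close> of a functional that is active at \<open>Xb\<close>
(\<open>ky_fan_directional_derivative\<close>). A subgradient never exceeds it, hence \<open>\<langle>Sb, H\<rangle> \<le> \<theta>'(Xb; H)\<close>; the
defining inequality of the critical cone is therefore an equality, and it says that no active
functional is larger at \<open>H\<close> than \<open>\<langle>Sb, H\<rangle>\<close>.

The singular vectors \<open>U\<close>, \<open>V\<close> of \<open>X = Xb + Sb\<close> diagonalize \<open>Xb\<close> and \<open>Sb\<close> at the same time. As \<open>\<theta>\<close> is
orthogonally invariant, \<open>\<langle>Sb, \<cdot>\<rangle>\<close> is maximal at \<open>Xb\<close> on the orbit of \<open>Xb\<close> under orthogonal
transformations on both sides; comparing \<open>Xb\<close> with its images under sign changes and transpositions
kills the entries off the diagonal and orders those on it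
(\<open>norming_pair_simultaneously_diagonal\<close>). So everything can be read in the coordinates \<open>U\<^sup>T H V\<close>, where
\<open>Xb\<close> and \<open>Sb\<close> become diagonal matrices with descending entries \<open>\<xi>\<close> and \<open>s\<close>, with \<open>0 \<le> s \<le> 1\<close>.

Put \<open>r = k - k0\<close> and let \<open>B\<close> be the block of \<open>U\<^sup>T H V\<close> that belongs to \<open>\<beta>\<close> (and to the extra columns if
\<open>\<sigma>\<^sub>k(Xb) = 0\<close>; its symmetric part if \<open>\<sigma>\<^sub>k(Xb) > 0\<close>). For the direction from the cone to the block form
one functional suffices: the one built from the \<open>r\<close> leading singular vectors (eigenvectors) of \<open>B\<close>. It
gives \<open>\<Sum>l<r. \<mu>\<^sub>l \<le> \<Sum>i. s\<^sub>i B\<^sub>i\<^sub>i\<close>, and the right-hand side is \<open>\<Sum>l. \<mu>\<^sub>l c\<^sub>l\<close> for weights \<open>c\<^sub>l\<close> below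
some \<open>d\<^sub>l \<in> [0, 1]\<close> of total mass at most \<open>r\<close>. Such a weighted sum never exceeds \<open>\<Sum>l<r. \<mu>\<^sub>l\<close>, and equality
is rigid (\<open>threshold_weights\<close>): with \<open>\<tau>\<close> the \<open>r\<close>-th largest of the \<open>\<mu>\<^sub>l\<close>, singular vectors with value
above \<open>\<tau>\<close> live on \<open>\<beta>1\<close> and coincide on both sides, and those below \<open>\<tau>\<close> live on \<open>\<beta>3\<close>. This is exactly the block form
(\<open>block_structure_of_maximizer\<close>). The multiplier satisfies \<open>\<tau> (k - \<Sum> s) = 0\<close>, which separates the cases
\<open>\<parallel>Sb\<parallel>\<^sub>* = k\<close> and \<open>\<parallel>Sb\<parallel>\<^sub>* < k\<close>: in the latter \<open>\<tau> = 0\<close>.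

Conversely, every functional active at \<open>Xb\<close> splits into the trace over \<open>\<alpha>\<close> and a functional of \<open>B\<close> of mass
\<open>r\<close> (\<open>active_rows\<close>, \<open>leading_trace_decouple\<close>). The positive semidefinite matrix \<open>B\<^sub>1\<^sub>1 - \<tau> I\<close> contributes
at most its trace and the remaining part at most \<open>\<tau> r\<close> (\<open>certificate_bound\<close>), which adds up to
\<open>\<langle>Sb, H\<rangle>\<close>.

Rectangular and orthogonal matrices are handled as functions \<open>nat \<Rightarrow> nat \<Rightarrow> real\<close> of which only the
entries below explicit bounds matter; rows and columns are numbered from 0 there.\<close>

section \<open>Weighted sums of descending sequences, and compactness\<close>

text \<open>The slack \<open>\<Sum>i<r. y i - \<Sum>i<N. y i * c i\<close> is a sum of nonnegative terms: with \<open>\<tau> = y (r - 1)\<close> it equals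
\<open>\<Sum>i. y i * (d i - c i) + \<Sum>i. (y i - \<tau>) * ([i < r] - d i) + \<tau> * (r - \<Sum>i. d i)\<close>. Hence the
inequality, and in the case of equality each term vanishes. All extremality arguments below (Ky Fan's
inequality, the shape of subgradients, of active functionals and of critical directions) are
instances of this lemma.\<close>

lemma threshold_weights:
  fixes y c d :: "nat \<Rightarrow> real"
  assumes r: "1 \<le> r" "r \<le> N"
    and desc: "\<And>i j. i \<le> j \<Longrightarrow> j < N \<Longrightarrow> y j \<le> y i"
    and nonneg: "\<And>i. i < N \<Longrightarrow> 0 \<le> y i"
    and cd: "\<And>i. i < N \<Longrightarrow> c i \<le> d i"
    and d01: "\<And>i. i < N \<Longrightarrow> 0 \<le> d i" "\<And>i. i < N \<Longrightarrow> d i \<le> 1"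
    and dsum: "(\<Sum>i<N. d i) \<le> real r"
  shows "(\<Sum>i<N. y i * c i) \<le> (\<Sum>i<r. y i)"
    and "(\<Sum>i<r. y i) \<le> (\<Sum>i<N. y i * c i) \<Longrightarrow> i < N \<Longrightarrow> y i > y (r - 1) \<Longrightarrow> d i = 1"
    and "(\<Sum>i<r. y i) \<le> (\<Sum>i<N. y i * c i) \<Longrightarrow> i < N \<Longrightarrow> y i < y (r - 1) \<Longrightarrow> d i = 0"
    and "(\<Sum>i<r. y i) \<le> (\<Sum>i<N. y i * c i) \<Longrightarrow> i < N \<Longrightarrow> y i > 0 \<Longrightarrow> c i = d i"
    and "(\<Sum>i<r. y i) \<le> (\<Sum>i<N. y i * c i) \<Longrightarrow> y (r - 1) * (real r - (\<Sum>i<N. d i)) = 0"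
proof -
  define \<tau> where "\<tau> = y (r - 1)"
  define g where "g i = (y i - \<tau>) * ((if i < r then 1 else 0) - d i)" for i
  define a where "a = (\<Sum>i<N. y i * (d i - c i))"
  have sub: "{..<N} \<inter> {i. i < r} = {..<r}" using r by auto
  have tau0: "0 \<le> \<tau>" unfolding \<tau>_def using nonneg r by simp
  have g0: "0 \<le> g i" if "i < N" for i
  proof (cases "i < r")
    case True
    then have "y i \<ge> \<tau>" unfolding \<tau>_def using desc[of i "r - 1"] r by simp
    then show ?thesis using True d01[OF that] by (simp add: g_def)
  next
    case False
    then have "y i \<le> \<tau>" unfolding \<tau>_def using desc[of "r - 1" i] that by simp
    then show ?thesis using False d01[OF that] by (simp add: g_def mult_nonpos_nonneg)
  qed
  have yd0: "0 \<le> y i * (d i - c i)" if "i < N" for i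
    using nonneg[OF that] cd[OF that] by simp
  have a0: "0 \<le> a" unfolding a_def using yd0 by (auto intro!: sum_nonneg)
  have sg: "(\<Sum>i<N. g i) = (\<Sum>i<r. y i) - \<tau> * r - (\<Sum>i<N. y i * d i) + \<tau> * (\<Sum>i<N. d i)"
  proof -
    have "(\<Sum>i<N. g i) = (\<Sum>i<N. (if i < r then y i else 0)) - (\<Sum>i<N. (if i < r then \<tau> else 0))
       - (\<Sum>i<N. y i * d i) + (\<Sum>i<N. \<tau> * d i)"
      unfolding g_def sum_subtractf[symmetric] sum.distrib[symmetric]
      by (intro sum.cong) (auto simp: algebra_simps)
    also have "(\<Sum>i<N. (if i < r then y i else 0)) = (\<Sum>i<r. y i)"
      by (simp add: sum.If_cases sub)
    also have "(\<Sum>i<N. (if i < r then \<tau> else 0)) = \<tau> * r"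
      by (simp add: sum.If_cases sub)
    finally show ?thesis by (simp add: sum_distrib_left)
  qed
  have slack: "(\<Sum>i<r. y i) - (\<Sum>i<N. y i * c i) = a + (\<Sum>i<N. g i) + \<tau> * (r - (\<Sum>i<N. d i))"
    unfolding sg a_def by (simp add: algebra_simps sum_subtractf)
  have G0: "0 \<le> (\<Sum>i<N. g i)" using g0 by (auto intro!: sum_nonneg)
  have t0: "0 \<le> \<tau> * (r - (\<Sum>i<N. d i))" using tau0 dsum by simp
  show "(\<Sum>i<N. y i * c i) \<le> (\<Sum>i<r. y i)" using slack a0 G0 t0 by linarith
  assume eq: "(\<Sum>i<r. y i) \<le> (\<Sum>i<N. y i * c i)"
  have az: "a = 0" and Gz: "(\<Sum>i<N. g i) = 0" and tz: "\<tau> * (r - (\<Sum>i<N. d i)) = 0"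
    using slack a0 G0 t0 eq by linarith+
  show "y (r - 1) * (real r - (\<Sum>i<N. d i)) = 0" using tz by (simp add: \<tau>_def)
  have gz: "g i = 0" if "i < N" for i
    using Gz g0 that by (subst (asm) sum_nonneg_eq_0_iff) auto
  have yz: "y i * (d i - c i) = 0" if "i < N" for i
    using az yd0 that unfolding a_def by (subst (asm) sum_nonneg_eq_0_iff) auto
  { assume i: "i < N" "y i > y (r - 1)"
    have "i < r" using desc[of "r - 1" i] i by (cases "i < r") force+
    then show "d i = 1" using gz[OF i(1)] i by (auto simp: g_def \<tau>_def) }
  { assume i: "i < N" "y i < y (r - 1)"
    have "\<not> i < r" using desc[of i "r - 1"] i r by (cases "i < r") force+
    then show "d i = 0" using gz[OF i(1)] i by (auto simp: g_def \<tau>_def) }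
  { assume i: "i < N" "y i > 0"
    then show "c i = d i" using yz[OF i(1)] by auto }
qed

text \<open>Bolzano-Weierstrass in finitely many coordinates; it replaces compactness of the unit sphere and of
the orthogonal groups.\<close>

lemma bounded_coordinates_convergent_subsequence:
  fixes f :: "nat \<Rightarrow> 'a \<Rightarrow> real"
  assumes "finite I" and "\<And>n i. i \<in> I \<Longrightarrow> \<bar>f n i\<bar> \<le> C"
  shows "\<exists>\<rho> l. strict_mono \<rho> \<and> (\<forall>i\<in>I. (\<lambda>n. f (\<rho> n) i) \<longlonglongrightarrow> l i)"
  using assms
proof (induction I rule: finite_induct)
  case empty
  show ?case by (intro exI[of _ id]) (auto simp: strict_mono_def)
next
  case (insert x I)
  obtain \<rho> l where \<rho>: "strict_mono \<rho>" "\<forall>i\<in>I. (\<lambda>n. f (\<rho> n) i) \<longlonglongrightarrow> l i"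
    using insert by auto
  obtain \<sigma> where \<sigma>: "strict_mono \<sigma>" "monoseq (\<lambda>n. f (\<rho> (\<sigma> n)) x)"
    using seq_monosub[of "\<lambda>n. f (\<rho> n) x"] by auto
  have "Bseq (\<lambda>n. f (\<rho> (\<sigma> n)) x)" using insert.prems by (intro BseqI'[of _ C]) auto
  then have "convergent (\<lambda>n. f (\<rho> (\<sigma> n)) x)" using \<sigma>(2) by (rule Bseq_monoseq_convergent)
  then obtain L where L: "(\<lambda>n. f (\<rho> (\<sigma> n)) x) \<longlonglongrightarrow> L" by (auto simp: convergent_def)
  have "(\<lambda>n. f (\<rho> (\<sigma> n)) i) \<longlonglongrightarrow> (l(x := L)) i" if "i \<in> insert x I" for i
  proof (cases "i = x")
    case False
    then have "(\<lambda>n. f (\<rho> n) i) \<longlonglongrightarrow> l i" using \<rho>(2) that by auto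
    from LIMSEQ_subseq_LIMSEQ[OF this \<sigma>(1)] False show ?thesis by (simp add: o_def)
  qed (use L in simp)
  moreover have "strict_mono (\<rho> \<circ> \<sigma>)" using \<rho>(1) \<sigma>(1) by (simp add: strict_mono_o)
  ultimately show ?case
    by (intro exI[of _ "\<rho> \<circ> \<sigma>"] exI[of _ "l(x := L)"] conjI ballI) (simp_all add: o_def del: fun_upd_apply)
qed

section \<open>Orthogonal matrices\<close>

definition orth :: "nat \<Rightarrow> (nat \<Rightarrow> nat \<Rightarrow> real) \<Rightarrow> bool" where
  "orth n P \<longleftrightarrow>
     (\<forall>i<n. \<forall>j<n. (\<Sum>l<n. P i l * P j l) = (if i = j then 1 else 0)) \<and>
     (\<forall>i<n. \<forall>j<n. (\<Sum>l<n. P l i * P l j) = (if i = j then 1 else 0))"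

lemma orth_rows: "orth n P \<Longrightarrow> i < n \<Longrightarrow> j < n \<Longrightarrow> (\<Sum>l<n. P i l * P j l) = (if i = j then 1 else 0)"
  and orth_cols: "orth n P \<Longrightarrow> i < n \<Longrightarrow> j < n \<Longrightarrow> (\<Sum>l<n. P l i * P l j) = (if i = j then 1 else 0)"
  by (auto simp: orth_def)

lemma orth_transpose: "orth n P \<Longrightarrow> orth n (\<lambda>i j. P j i)"
  by (auto simp: orth_def)

text \<open>A left inverse of a square matrix is a right inverse.\<close>

lemma orthI_cols:
  assumes c: "\<And>i j. i < n \<Longrightarrow> j < n \<Longrightarrow> (\<Sum>l<n. P l i * P l j) = (if i = j then 1 else 0)"
  shows "orth n P"
proof -
  define A where "A = mat n n (\<lambda>(i, j). P i j)"
  have A: "A \<in> carrier_mat n n" "transpose_mat A \<in> carrier_mat n n" by (auto simp: A_def)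
  have "transpose_mat A * A = 1\<^sub>m n"
    by (rule eq_matI) (auto simp: A_def scalar_prod_def c atLeast0LessThan)
  then have "A * transpose_mat A = 1\<^sub>m n"
    using mat_mult_left_right_inverse[OF A(2) A(1)] by simp
  moreover have "(\<Sum>l<n. P i l * P j l) = (A * transpose_mat A) $$ (i, j)" if "i < n" "j < n" for i j
    using that by (auto simp: A_def scalar_prod_def atLeast0LessThan)
  ultimately show ?thesis using c by (auto simp: orth_def)
qed

lemma orthogonal_group_orth:
  assumes "Q \<in> orthogonal_group n"
  shows "orth n (\<lambda>i j. Q $$ (i, j))"
proof (rule orthI_cols)
  fix i j assume ij: "i < n" "j < n"
  have Q: "Q \<in> carrier_mat n n" "transpose_mat Q * Q = 1\<^sub>m n"
    using assms by (auto simp: orthogonal_group_def)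
  have "(\<Sum>l<n. Q $$ (l, i) * Q $$ (l, j)) = (transpose_mat Q * Q) $$ (i, j)"
    using Q(1) ij by (auto simp: scalar_prod_def atLeast0LessThan)
  then show "(\<Sum>l<n. Q $$ (l, i) * Q $$ (l, j)) = (if i = j then 1 else 0)"
    using Q(2) ij by simp
qed

lemma orth_parseval:
  assumes "orth n A"
  shows "(\<Sum>i<n. (\<Sum>a<n. A a i * x a) * (\<Sum>b<n. A b i * y b)) = (\<Sum>a<n. x a * y a)"
proof -
  have "(\<Sum>i<n. (\<Sum>a<n. A a i * x a) * (\<Sum>b<n. A b i * y b))
      = (\<Sum>i<n. \<Sum>a<n. \<Sum>b<n. x a * y b * (A a i * A b i))"
    by (simp add: sum_product mult_ac)
  also have "\<dots> = (\<Sum>a<n. \<Sum>i<n. \<Sum>b<n. x a * y b * (A a i * A b i))" by (rule sum.swap)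
  also have "\<dots> = (\<Sum>a<n. \<Sum>b<n. \<Sum>i<n. x a * y b * (A a i * A b i))"
    by (intro sum.cong sum.swap refl)
  also have "\<dots> = (\<Sum>a<n. \<Sum>b<n. x a * y b * (if a = b then 1 else 0))"
    using orth_rows[OF assms] by (intro sum.cong refl) (simp add: sum_distrib_left[symmetric])
  also have "\<dots> = (\<Sum>a<n. x a * y a)"
    by (intro sum.cong refl) (simp add: if_distrib cong: if_cong)
  finally show ?thesis .
qed

lemma orth_mult:
  assumes A: "orth n A" and P: "orth n P"
  shows "orth n (\<lambda>i l. \<Sum>a<n. A a i * P a l)"
  by (rule orthI_cols) (simp add: orth_parseval[OF A] orth_cols[OF P])

text \<open>Fewer than \<open>n\<close> vectors, padded with a zero row, form a singular \<open>n \<times> n\<close> matrix; normalize a vector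
of its kernel.\<close>

lemma ex_unit_vector_orthogonal_to:
  assumes I: "I \<subseteq> {..<n}" "I \<noteq> {..<n}"
  shows "\<exists>u :: nat \<Rightarrow> real. (\<Sum>j<n. u j * u j) = 1 \<and> (\<forall>l\<in>I. (\<Sum>j<n. f l j * u j) = 0)"
proof -
  obtain k where k: "k < n" "k \<notin> I" using I by auto
  define M where "M = mat n n (\<lambda>(l, j). if l \<in> I then f l j else 0)"
  have M: "M \<in> carrier_mat n n" by (simp add: M_def)
  have "M = mat\<^sub>r n n (\<lambda>l. if l = k then 0\<^sub>v n else vec n (\<lambda>j. if l \<in> I then f l j else 0))"
    using k by (intro eq_matI) (auto simp: M_def)
  then have "det M = 0"
    using det_row_0[OF k(1), of "\<lambda>l. vec n (\<lambda>j. if l \<in> I then f l j else 0)"] by simp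
  then obtain v where v: "v \<in> carrier_vec n" "v \<noteq> 0\<^sub>v n" "M *\<^sub>v v = 0\<^sub>v n"
    using det_0_iff_vec_prod_zero[OF M] by auto
  define s where "s = (\<Sum>j<n. v $ j * v $ j)"
  obtain i where i: "i < n" "v $ i \<noteq> 0" using v by (metis carrier_vecD eq_vecI index_zero_vec)
  have "0 < v $ i * v $ i" using i by (simp add: zero_less_mult_iff) linarith
  also have "\<dots> \<le> s" unfolding s_def using i by (intro member_le_sum) auto
  finally have s: "s > 0" .
  have ort: "(\<Sum>j<n. f l j * v $ j) = 0" if "l \<in> I" for l
  proof -
    have l: "l < n" using that I by auto
    have "(\<Sum>j<n. f l j * v $ j) = (M *\<^sub>v v) $ l"
      using v(1) l that by (auto simp: M_def scalar_prod_def atLeast0LessThan)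
    then show ?thesis using v(3) l by simp
  qed
  have "(\<Sum>j<n. (v $ j / sqrt s) * (v $ j / sqrt s)) = 1"
  proof -
    have "(\<Sum>j<n. (v $ j / sqrt s) * (v $ j / sqrt s)) = (\<Sum>j<n. v $ j * v $ j) / s"
      unfolding sum_divide_distrib using s by (intro sum.cong) auto
    then show ?thesis using s by (simp add: s_def[symmetric])
  qed
  moreover have "(\<Sum>j<n. f l j * (v $ j / sqrt s)) = 0" if "l \<in> I" for l
    using ort[OF that] by (simp add: sum_divide_distrib[symmetric])
  ultimately show ?thesis by (intro exI[of _ "\<lambda>j. v $ j / sqrt s"]) simp
qed

lemma orthonormal_family_completion:
  fixes f :: "nat \<Rightarrow> nat \<Rightarrow> real"
  assumes "I \<subseteq> {..<n}"
    and "\<And>l l'. l \<in> I \<Longrightarrow> l' \<in> I \<Longrightarrow> (\<Sum>j<n. f l j * f l' j) = (if l = l' then 1 else 0)"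
  shows "\<exists>V. orth n V \<and> (\<forall>l\<in>I. \<forall>j<n. V j l = f l j)"
  using assms
proof (induction "n - card I" arbitrary: I f)
  case 0
  have fin: "finite I" using 0(2) finite_subset by blast
  have "I = {..<n}" using 0(1,2) fin by (intro card_subset_eq) (auto intro: antisym dest: card_mono[rotated])
  then have "orth n (\<lambda>j l. f l j)" using 0(3) by (intro orthI_cols) auto
  then show ?case by (intro exI[of _ "\<lambda>j l. f l j"]) auto
next
  case (Suc d)
  have fin: "finite I" using Suc(3) finite_subset by blast
  have ne: "I \<noteq> {..<n}" using Suc(2) by auto
  obtain k where k: "k < n" "k \<notin> I" using ne Suc(3) by auto
  obtain u where u: "(\<Sum>j<n. u j * u j) = 1" "\<forall>l\<in>I. (\<Sum>j<n. f l j * u j) = 0"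
    using ex_unit_vector_orthogonal_to[OF Suc(3) ne] by blast
  have u2: "\<forall>l\<in>I. (\<Sum>j<n. u j * f l j) = 0" using u(2) by (simp add: mult.commute)
  have "\<exists>V. orth n V \<and> (\<forall>l\<in>insert k I. \<forall>j<n. V j l = (f(k := u)) l j)"
  proof (rule Suc.hyps(1))
    show "d = n - card (insert k I)" using Suc(2) k fin by simp
    show "insert k I \<subseteq> {..<n}" using Suc(3) k by auto
    show "(\<Sum>j<n. (f(k := u)) l j * (f(k := u)) l' j) = (if l = l' then 1 else 0)"
      if "l \<in> insert k I" "l' \<in> insert k I" for l l'
      using that u u2 k Suc(4) by (cases "l = k"; cases "l' = k") auto
  qed
  then obtain V where V: "orth n V" "\<forall>l\<in>insert k I. \<forall>j<n. V j l = (f(k := u)) l j" by blast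
  have "V j l = f l j" if "l \<in> I" "j < n" for l j using V(2) that k by (metis fun_upd_other insertI2)
  then show ?case using V(1) by blast
qed

section \<open>Spectral theorem and singular value decomposition\<close>

definition bilinear_form :: "nat \<Rightarrow> (nat \<Rightarrow> nat \<Rightarrow> real) \<Rightarrow> (nat \<Rightarrow> real) \<Rightarrow> (nat \<Rightarrow> real) \<Rightarrow> real" where
  "bilinear_form n A x y = (\<Sum>i<n. \<Sum>j<n. x i * A i j * y j)"

lemma bilinear_form_add_left:
  "bilinear_form n A (\<lambda>i. x i + x' i) y = bilinear_form n A x y + bilinear_form n A x' y"
  and bilinear_form_add_right:
  "bilinear_form n A x (\<lambda>i. y i + y' i) = bilinear_form n A x y + bilinear_form n A x y'"
  and bilinear_form_scale_left: "bilinear_form n A (\<lambda>i. c * x i) y = c * bilinear_form n A x y"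
  and bilinear_form_scale_right: "bilinear_form n A x (\<lambda>i. c * y i) = c * bilinear_form n A x y"
  unfolding bilinear_form_def by (simp_all add: algebra_simps sum.distrib sum_distrib_left)

lemma bilinear_form_swap:
  assumes "\<And>i j. i < n \<Longrightarrow> j < n \<Longrightarrow> A i j = A j i"
  shows "bilinear_form n A x y = bilinear_form n A y x"
proof -
  have "bilinear_form n A x y = (\<Sum>j<n. \<Sum>i<n. x i * A i j * y j)" unfolding bilinear_form_def by (rule sum.swap)
  also have "\<dots> = bilinear_form n A y x" unfolding bilinear_form_def using assms
    by (intro sum.cong refl) (simp add: mult_ac)
  finally show ?thesis .
qed

text \<open>Compactness of the unit sphere of a subspace, by a maximizing sequence of Rayleigh quotients.\<close>

lemma bilinear_form_rayleigh_attained: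
  fixes A :: "nat \<Rightarrow> nat \<Rightarrow> real"
  assumes I: "I \<subseteq> {..<n}" "I \<noteq> {..<n}"
  shows "\<exists>u. (\<Sum>j<n. u j * u j) = 1 \<and> (\<forall>l\<in>I. (\<Sum>j<n. f l j * u j) = 0) \<and>
    (\<forall>v. (\<Sum>j<n. v j * v j) = 1 \<longrightarrow> (\<forall>l\<in>I. (\<Sum>j<n. f l j * v j) = 0) \<longrightarrow>
       bilinear_form n A v v \<le> bilinear_form n A u u)"
proof -
  define S where "S = {u :: nat \<Rightarrow> real. (\<Sum>j<n. u j * u j) = 1 \<and> (\<forall>l\<in>I. (\<Sum>j<n. f l j * u j) = 0)}"
  have ne: "S \<noteq> {}" using ex_unit_vector_orthogonal_to[OF I, of f] by (auto simp: S_def)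
  have coord: "\<bar>u i\<bar> \<le> 1" if "u \<in> S" "i < n" for u i
  proof -
    have "u i * u i \<le> (\<Sum>j<n. u j * u j)" using that(2) by (intro member_le_sum) auto
    then have "(u i)\<^sup>2 \<le> 1" using that(1) by (simp add: S_def power2_eq_square)
    then show ?thesis by (simp add: abs_square_le_1)
  qed
  have bd: "bilinear_form n A u u \<le> (\<Sum>i<n. \<Sum>j<n. \<bar>A i j\<bar>)" if "u \<in> S" for u
    unfolding bilinear_form_def
  proof (intro sum_mono)
    fix i j assume "i \<in> {..<n}" "j \<in> {..<n}"
    then have "\<bar>u i\<bar> * \<bar>A i j\<bar> * \<bar>u j\<bar> \<le> 1 * \<bar>A i j\<bar> * 1"
      using coord[OF that] by (intro mult_mono) auto
    then show "u i * A i j * u j \<le> \<bar>A i j\<bar>" by (simp add: abs_mult[symmetric])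
  qed
  define q where "q = (\<lambda>u. bilinear_form n A u u)"
  have bdd: "bdd_above (q ` S)" using bd by (auto simp: bdd_above_def q_def)
  define M where "M = Sup (q ` S)"
  have "\<exists>u\<in>S. M - 1 / real (Suc p) < q u" for p
  proof -
    have "M - 1 / real (Suc p) < M" by simp
    then show ?thesis unfolding M_def using less_cSup_iff[OF _ bdd] ne by auto
  qed
  then obtain s where s: "\<And>p. s p \<in> S" "\<And>p. M - 1 / real (Suc p) < q (s p)" by metis
  obtain \<rho> l where \<rho>: "strict_mono \<rho>" and l: "\<forall>i\<in>{..<n}. (\<lambda>p. s (\<rho> p) i) \<longlonglongrightarrow> l i"
    using bounded_coordinates_convergent_subsequence[of "{..<n}" s 1] coord[OF s(1)] by auto
  have lS: "l \<in> S"
  proof -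
    have "(\<lambda>p. \<Sum>j<n. s (\<rho> p) j * s (\<rho> p) j) \<longlonglongrightarrow> (\<Sum>j<n. l j * l j)"
      using l by (intro tendsto_intros) auto
    moreover have "(\<lambda>p. \<Sum>j<n. s (\<rho> p) j * s (\<rho> p) j) = (\<lambda>p. 1)"
      using s(1) by (auto simp: S_def)
    ultimately have 1: "(\<Sum>j<n. l j * l j) = 1"
      using LIMSEQ_unique[OF tendsto_const[of 1 sequentially]] by metis
    have "(\<Sum>j<n. f k j * l j) = 0" if k: "k \<in> I" for k
    proof -
      have "(\<lambda>p. \<Sum>j<n. f k j * s (\<rho> p) j) \<longlonglongrightarrow> (\<Sum>j<n. f k j * l j)"
        using l by (intro tendsto_intros) auto
      moreover have "(\<lambda>p. \<Sum>j<n. f k j * s (\<rho> p) j) = (\<lambda>p. 0)"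
        using s(1) k by (auto simp: S_def)
      ultimately show ?thesis using LIMSEQ_unique[OF tendsto_const[of 0 sequentially]] by metis
    qed
    with 1 show ?thesis by (simp add: S_def)
  qed
  have "(\<lambda>p. q (s (\<rho> p))) \<longlonglongrightarrow> q l"
    unfolding q_def bilinear_form_def using l by (intro tendsto_intros) auto
  moreover have "(\<lambda>p. M - 1 / real (Suc (\<rho> p))) \<longlonglongrightarrow> M - 0"
    using LIMSEQ_subseq_LIMSEQ[OF LIMSEQ_inverse_real_of_nat \<rho>]
    by (intro tendsto_intros) (simp add: o_def inverse_eq_divide)
  ultimately have "M - 0 \<le> q l"
    using s(2)[THEN less_imp_le]
      by (intro LIMSEQ_le[of "\<lambda>p. M - 1 / real (Suc (\<rho> p))" _ "\<lambda>p. q (s (\<rho> p))"]) auto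
  moreover have "q v \<le> M" if "v \<in> S" for v
    unfolding M_def using that bdd by (intro cSup_upper) auto
  ultimately have "q v \<le> q l" if "v \<in> S" for v using that by fastforce
  then show ?thesis using lS by (intro exI[of _ l]) (simp add: S_def q_def)
qed

lemma bilinear_form_scaled_bound:
  assumes max: "\<And>v. (\<Sum>j<n. v j * v j) = 1 \<Longrightarrow> (\<forall>l\<in>I. (\<Sum>j<n. f l j * v j) = 0) \<Longrightarrow> bilinear_form n A v v \<le> \<mu>"
    and w: "\<forall>l\<in>I. (\<Sum>j<n. f l j * w j) = 0"
  shows "bilinear_form n A w w \<le> \<mu> * (\<Sum>j<n. w j * w j)"
proof (cases "(\<Sum>j<n. w j * w j) = 0")
  case True
  then have "w j = 0" if "j < n" for j
    using that by (subst (asm) sum_nonneg_eq_0_iff) auto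
  then show ?thesis by (simp add: bilinear_form_def)
next
  case False
  define s where "s = (\<Sum>j<n. w j * w j)"
  have "0 \<le> s" unfolding s_def by (auto intro!: sum_nonneg)
  with False have s: "s > 0" by (simp add: s_def)
  define v where "v = (\<lambda>j. 1 / sqrt s * w j)"
  have "(\<Sum>j<n. v j * v j) = (\<Sum>j<n. w j * w j) / s"
    unfolding sum_divide_distrib v_def using s by (intro sum.cong) auto
  then have 1: "(\<Sum>j<n. v j * v j) = 1" using s by (simp add: s_def[symmetric])
  have 2: "\<forall>l\<in>I. (\<Sum>j<n. f l j * v j) = 0"
  proof
    fix l assume "l \<in> I"
    have "(\<Sum>j<n. f l j * v j) = 1 / sqrt s * (\<Sum>j<n. f l j * w j)"
      unfolding v_def sum_distrib_left by (intro sum.cong) auto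
    then show "(\<Sum>j<n. f l j * v j) = 0" using w \<open>l \<in> I\<close> by simp
  qed
  have "bilinear_form n A v v = bilinear_form n A w w / s"
    unfolding v_def bilinear_form_scale_left bilinear_form_scale_right using s by simp
  then show ?thesis using max[OF 1 2] s by (simp add: s_def[symmetric] divide_le_eq)
qed

text \<open>First-order optimality: a quadratic polynomial that vanishes at 0 and is nowhere negative has no
linear term.\<close>

lemma linear_coefficient_zero_if_nonneg:
  fixes a b :: real
  assumes "\<And>t. 0 \<le> 2 * t * a + t\<^sup>2 * b"
  shows "a = 0"
proof (rule ccontr)
  assume a: "a \<noteq> 0"
  have a2: "a * a > 0" using a by (simp add: zero_less_mult_iff) linarith
  show False
  proof (cases "b \<le> 0")
    case True
    have "2 * (- a) * a + (- a)\<^sup>2 * b \<le> - 2 * (a * a)" using True by (simp add: mult_nonneg_nonpos)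
    then show ?thesis using assms[of "- a"] a2 by linarith
  next
    case False
    \<comment> \<open>The minimum of the parabola is attained at \<open>t = - a / b\<close>.\<close>
    have "2 * (- a / b) * a + (- a / b)\<^sup>2 * b = - (a * a) / b"
      using False by (simp add: power2_eq_square field_simps)
    moreover have "- (a * a) / b < 0" using False a2 by (simp add: divide_neg_pos)
    ultimately show ?thesis using assms[of "- a / b"] by linarith
  qed
qed

text \<open>Orthonormal eigenvectors \<open>f 0, \<dots>, f (r - 1)\<close> that were chosen greedily: the eigenvalues descend, and
the last one bounds the Rayleigh quotient on the orthogonal complement of all of them.\<close>

definition leading_eigenvectors ::
  "nat \<Rightarrow> (nat \<Rightarrow> nat \<Rightarrow> real) \<Rightarrow> nat \<Rightarrow> (nat \<Rightarrow> nat \<Rightarrow> real) \<Rightarrow> (nat \<Rightarrow> real) \<Rightarrow> bool" where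
  "leading_eigenvectors n A r f \<nu> \<longleftrightarrow>
     (\<forall>l<r. \<forall>l'<r. (\<Sum>j<n. f l j * f l' j) = (if l = l' then 1 else 0)) \<and>
     (\<forall>l<r. \<forall>i<n. (\<Sum>j<n. A i j * f l j) = \<nu> l * f l i) \<and>
     (\<forall>i j. i \<le> j \<longrightarrow> j < r \<longrightarrow> \<nu> j \<le> \<nu> i) \<and>
     (0 < r \<longrightarrow> (\<forall>w. (\<forall>l<r. (\<Sum>j<n. f l j * w j) = 0) \<longrightarrow>
        bilinear_form n A w w \<le> \<nu> (r - 1) * (\<Sum>j<n. w j * w j)))"

text \<open>Greedy step: \<open>u\<close> maximizes the Rayleigh quotient on the orthogonal complement of the eigenvectors
already found, with value \<open>\<mu>\<close>. The residual \<open>g = A u - \<mu> u\<close> lies in that complement again, and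
first-order optimality of \<open>u\<close> in the direction \<open>g\<close> yields \<open>\<parallel>g\<parallel> = 0\<close>. Choosing the eigenvectors in this
way makes the eigenvalues come out in descending order.\<close>

lemma leading_eigenvectors_exist:
  fixes A :: "nat \<Rightarrow> nat \<Rightarrow> real"
  assumes sym: "\<And>i j. i < n \<Longrightarrow> j < n \<Longrightarrow> A i j = A j i" and "r \<le> n"
  shows "\<exists>f \<nu>. leading_eigenvectors n A r f \<nu>"
  using \<open>r \<le> n\<close>
proof (induction r)
  case 0
  then show ?case by (simp add: leading_eigenvectors_def)
next
  case (Suc r)
  then obtain f \<nu> where E: "leading_eigenvectors n A r f \<nu>" by auto
  have on: "\<And>l l'. l < r \<Longrightarrow> l' < r \<Longrightarrow> (\<Sum>j<n. f l j * f l' j) = (if l = l' then 1 else 0)"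
    and eig: "\<And>l i. l < r \<Longrightarrow> i < n \<Longrightarrow> (\<Sum>j<n. A i j * f l j) = \<nu> l * f l i"
    and desc: "\<And>i j. i \<le> j \<Longrightarrow> j < r \<Longrightarrow> \<nu> j \<le> \<nu> i"
    and top: "\<And>w. 0 < r \<Longrightarrow> (\<forall>l<r. (\<Sum>j<n. f l j * w j) = 0) \<Longrightarrow>
        bilinear_form n A w w \<le> \<nu> (r - 1) * (\<Sum>j<n. w j * w j)"
    using E unfolding leading_eigenvectors_def by simp_all
  have I: "{..<r} \<subseteq> {..<n}" "{..<r} \<noteq> {..<n}" using Suc.prems by auto
  obtain u where u1: "(\<Sum>j<n. u j * u j) = 1" and uo: "\<And>l. l < r \<Longrightarrow> (\<Sum>j<n. f l j * u j) = 0"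
    and um: "\<And>v. (\<Sum>j<n. v j * v j) = 1 \<Longrightarrow> (\<forall>l\<in>{..<r}. (\<Sum>j<n. f l j * v j) = 0) \<Longrightarrow>
       bilinear_form n A v v \<le> bilinear_form n A u u"
    using bilinear_form_rayleigh_attained[OF I, of f A] by auto
  define \<mu> where "\<mu> = bilinear_form n A u u"
  have bound: "bilinear_form n A w w \<le> \<mu> * (\<Sum>j<n. w j * w j)" if "\<forall>l<r. (\<Sum>j<n. f l j * w j) = 0" for w
    using bilinear_form_scaled_bound[OF um[folded \<mu>_def]] that by auto
  \<comment> \<open>The residual of \<open>u\<close> as an eigenvector; it is orthogonal to the eigenvectors found before.\<close>
  define g where "g = (\<lambda>i. (\<Sum>j<n. A i j * u j) - \<mu> * u i)"
  have qg: "bilinear_form n A x u = (\<Sum>i<n. x i * g i) + \<mu> * (\<Sum>i<n. x i * u i)" for x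
    unfolding bilinear_form_def g_def
    by (simp add: sum_distrib_left sum.distrib[symmetric] algebra_simps)
  have go: "(\<Sum>j<n. f l j * g j) = 0" if l: "l < r" for l
  proof -
    have "bilinear_form n A (f l) u = bilinear_form n A u (f l)" by (rule bilinear_form_swap[OF sym])
    also have "\<dots> = (\<Sum>i<n. u i * (\<Sum>j<n. A i j * f l j))"
      by (simp add: bilinear_form_def sum_distrib_left mult_ac)
    also have "\<dots> = (\<Sum>i<n. u i * (\<nu> l * f l i))" using eig[OF l] by (intro sum.cong) auto
    also have "\<dots> = \<nu> l * (\<Sum>i<n. f l i * u i)" by (simp add: sum_distrib_left mult_ac)
    finally show ?thesis using qg[of "f l"] uo[OF l] by simp
  qed
  have key: "(\<Sum>i<n. g i * g i) = 0"
  proof -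
    define a where "a = (\<Sum>i<n. g i * g i)"
    define b where "b = \<mu> * a - bilinear_form n A g g"
    have gu: "bilinear_form n A g u = a + \<mu> * (\<Sum>i<n. g i * u i)" using qg[of g] by (simp add: a_def)
    have ug: "bilinear_form n A u g = a + \<mu> * (\<Sum>i<n. g i * u i)"
      using gu bilinear_form_swap[where A = A and x = u and y = g, OF sym] by simp
    have "0 \<le> 2 * t * (- a) + t\<^sup>2 * b" for t
    proof -
      define w where "w = (\<lambda>i. u i + t * g i)"
      have "\<forall>l<r. (\<Sum>j<n. f l j * w j) = 0"
      proof (intro allI impI)
        fix l assume l: "l < r"
        have "(\<Sum>j<n. f l j * w j) = (\<Sum>j<n. f l j * u j) + t * (\<Sum>j<n. f l j * g j)"
          unfolding w_def by (simp add: sum.distrib[symmetric] sum_distrib_left algebra_simps)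
        then show "(\<Sum>j<n. f l j * w j) = 0" using uo[OF l] go[OF l] by simp
      qed
      then have "bilinear_form n A w w \<le> \<mu> * (\<Sum>j<n. w j * w j)" by (rule bound)
      moreover have "bilinear_form n A w w
          = \<mu> + 2 * t * (a + \<mu> * (\<Sum>i<n. g i * u i)) + t\<^sup>2 * bilinear_form n A g g"
        unfolding w_def bilinear_form_add_left bilinear_form_add_right bilinear_form_scale_left bilinear_form_scale_right gu ug \<mu>_def[symmetric]
        by (simp add: algebra_simps power2_eq_square)
      moreover have "(\<Sum>j<n. w j * w j) = 1 + 2 * t * (\<Sum>i<n. g i * u i) + t\<^sup>2 * a"
        unfolding u1[symmetric] w_def a_def sum_distrib_left sum.distrib[symmetric]
        by (intro sum.cong) (simp_all add: algebra_simps power2_eq_square)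
      ultimately show ?thesis by (simp add: b_def algebra_simps)
    qed
    then have "- a = 0" by (rule linear_coefficient_zero_if_nonneg)
    then show ?thesis by (simp add: a_def)
  qed
  have gz: "g i = 0" if "i < n" for i
    using key that by (subst (asm) sum_nonneg_eq_0_iff) auto
  define f' where "f' = f(r := u)"
  define \<nu>' where "\<nu>' = \<nu>(r := \<mu>)"
  have uo': "(\<Sum>j<n. u j * f l j) = 0" if "l < r" for l using uo[OF that] by (simp add: mult.commute)
  have "(\<Sum>j<n. f' l j * f' l' j) = (if l = l' then 1 else 0)" if "l < Suc r" "l' < Suc r" for l l'
    using that on u1 uo uo' by (cases "l = r"; cases "l' = r") (auto simp: f'_def less_Suc_eq)
  moreover have "(\<Sum>j<n. A i j * f' l j) = \<nu>' l * f' l i" if "l < Suc r" "i < n" for l i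
    using that eig gz[OF that(2)] by (cases "l = r") (auto simp: f'_def \<nu>'_def g_def less_Suc_eq)
  moreover have "\<nu>' j \<le> \<nu>' i" if "i \<le> j" "j < Suc r" for i j
  proof (cases "j = r")
    case False
    then show ?thesis using that desc by (auto simp: \<nu>'_def)
  next
    case j: True
    show ?thesis
    proof (cases "i = r")
      case False
      then have i: "i < r" using that j by simp
      have "\<mu> \<le> \<nu> (r - 1)" using top[of u] uo u1 i by (simp add: \<mu>_def)
      also have "\<dots> \<le> \<nu> i" using desc[of i "r - 1"] i by simp
      finally show ?thesis using i j by (simp add: \<nu>'_def)
    qed (use j in simp)
  qed
  moreover have "bilinear_form n A w w \<le> \<nu>' (Suc r - 1) * (\<Sum>j<n. w j * w j)"
    if "\<forall>l<Suc r. (\<Sum>j<n. f' l j * w j) = 0" for w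
  proof -
    have "(\<Sum>j<n. f l j * w j) = 0" if "l < r" for l
      using \<open>\<forall>l<Suc r. _\<close>[rule_format, of l] that by (simp add: f'_def)
    then show ?thesis using bound[of w] by (simp add: \<nu>'_def)
  qed
  ultimately have "leading_eigenvectors n A (Suc r) f' \<nu>'"
    unfolding leading_eigenvectors_def by simp
  then show ?case by blast
qed

text \<open>The greedily chosen eigenvectors form an orthonormal basis once there are \<open>n\<close> of them.\<close>

theorem spectral_decomposition:
  fixes A :: "nat \<Rightarrow> nat \<Rightarrow> real"
  assumes sym: "\<And>i j. i < n \<Longrightarrow> j < n \<Longrightarrow> A i j = A j i"
  obtains Q \<nu> where "orth n Q" "\<And>i j. i \<le> j \<Longrightarrow> j < n \<Longrightarrow> \<nu> j \<le> \<nu> i"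
    "\<And>i j. i < n \<Longrightarrow> j < n \<Longrightarrow> A i j = (\<Sum>l<n. \<nu> l * Q i l * Q j l)"
proof -
  obtain f \<nu> where E: "leading_eigenvectors n A n f \<nu>"
    using leading_eigenvectors_exist[where A = A, OF sym order_refl] by blast
  have on: "\<And>l l'. l < n \<Longrightarrow> l' < n \<Longrightarrow> (\<Sum>j<n. f l j * f l' j) = (if l = l' then 1 else 0)"
    and eig: "\<And>l i. l < n \<Longrightarrow> i < n \<Longrightarrow> (\<Sum>j<n. A i j * f l j) = \<nu> l * f l i"
    and desc: "\<And>i j. i \<le> j \<Longrightarrow> j < n \<Longrightarrow> \<nu> j \<le> \<nu> i"
    using E unfolding leading_eigenvectors_def by simp_all
  define Q where "Q = (\<lambda>i l. f l i)"
  have Q: "orth n Q" using on by (intro orthI_cols) (auto simp: Q_def)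
  have "A i j = (\<Sum>l<n. \<nu> l * Q i l * Q j l)" if "i < n" "j < n" for i j
  proof -
    have "(\<Sum>l<n. \<nu> l * Q i l * Q j l) = (\<Sum>l<n. \<Sum>a<n. A i a * (Q a l * Q j l))"
      using eig that by (intro sum.cong refl) (simp add: Q_def sum_distrib_right[symmetric] mult.assoc[symmetric])
    also have "\<dots> = (\<Sum>a<n. A i a * (\<Sum>l<n. Q a l * Q j l))"
      by (subst sum.swap) (simp add: sum_distrib_left)
    also have "\<dots> = (\<Sum>a<n. A i a * (if a = j then 1 else 0))"
      using orth_rows[OF Q] that by (intro sum.cong) auto
    also have "\<dots> = A i j" using that by (simp add: if_distrib cong: if_cong)
    finally show ?thesis by simp
  qed
  then show thesis using that[OF Q] desc by blast
qed

text \<open>\<open>z = P [diag y 0] Q\<^sup>T\<close> with orthogonal \<open>P\<close>, \<open>Q\<close> and singular values \<open>y\<close> in descending order.\<close>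

definition is_svd ::
  "nat \<Rightarrow> nat \<Rightarrow> (nat \<Rightarrow> nat \<Rightarrow> real) \<Rightarrow> (nat \<Rightarrow> real) \<Rightarrow> (nat \<Rightarrow> nat \<Rightarrow> real) \<Rightarrow> (nat \<Rightarrow> nat \<Rightarrow> real) \<Rightarrow> bool"
  where "is_svd m n z y P Q \<longleftrightarrow> orth m P \<and> orth n Q \<and>
     (\<forall>i<m. \<forall>j<n. z i j = (\<Sum>l<m. y l * P i l * Q j l)) \<and>
     (\<forall>l<m. 0 \<le> y l) \<and> (\<forall>i j. i \<le> j \<longrightarrow> j < m \<longrightarrow> y j \<le> y i)"

lemma bilinear_svd_expand:
  "(\<Sum>i<N. \<Sum>j<N'. p i * (\<Sum>l<L. t l * P i l * Q j l) * q j) =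
   (\<Sum>l<L. t l * (\<Sum>i<N. P i l * p i) * (\<Sum>j<N'. Q j l * q j))" for t :: "nat \<Rightarrow> real"
proof -
  have "(\<Sum>i<N. \<Sum>j<N'. p i * (\<Sum>l<L. t l * P i l * Q j l) * q j)
      = (\<Sum>i<N. \<Sum>j<N'. \<Sum>l<L. t l * (P i l * p i) * (Q j l * q j))"
    by (simp add: sum_distrib_left sum_distrib_right mult_ac)
  also have "\<dots> = (\<Sum>i<N. \<Sum>l<L. \<Sum>j<N'. t l * (P i l * p i) * (Q j l * q j))"
    by (intro sum.cong sum.swap refl)
  also have "\<dots> = (\<Sum>l<L. \<Sum>i<N. \<Sum>j<N'. t l * (P i l * p i) * (Q j l * q j))" by (rule sum.swap)
  also have "\<dots> = (\<Sum>l<L. t l * (\<Sum>i<N. P i l * p i) * (\<Sum>j<N'. Q j l * q j))"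
    by (simp add: sum_distrib_left sum_distrib_right mult_ac)
  finally show ?thesis .
qed

text \<open>Diagonalize \<open>z z\<^sup>T\<close> by \<open>P\<close>. The rows of \<open>P\<^sup>T z\<close> are then pairwise orthogonal with squared lengths the
eigenvalues; the normalized nonzero rows are completed to an orthonormal basis \<open>Q\<close>.\<close>

theorem svd_exists:
  assumes "m \<le> n"
  obtains y P Q where "is_svd m n z y P Q"
proof -
  obtain P \<nu> where P: "orth m P" and desc: "\<And>i j. i \<le> j \<Longrightarrow> j < m \<Longrightarrow> \<nu> j \<le> \<nu> i"
    and M: "\<And>i j. i < m \<Longrightarrow> j < m \<Longrightarrow> (\<Sum>a<n. z i a * z j a) = (\<Sum>l<m. \<nu> l * P i l * P j l)"
    using spectral_decomposition[of m "\<lambda>i j. \<Sum>a<n. z i a * z j a"] by (auto simp: mult.commute)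
  define a where "a = (\<lambda>l j. \<Sum>i<m. P i l * z i j)"
  have za: "z i j = (\<Sum>l<m. P i l * a l j)" if "i < m" for i j
  proof -
    have "(\<Sum>l<m. P i l * a l j) = (\<Sum>l<m. \<Sum>i'<m. z i' j * (P i l * P i' l))"
      by (simp add: a_def sum_distrib_left mult_ac)
    also have "\<dots> = (\<Sum>i'<m. z i' j * (\<Sum>l<m. P i l * P i' l))"
      by (subst sum.swap) (simp add: sum_distrib_left)
    also have "\<dots> = (\<Sum>i'<m. z i' j * (if i = i' then 1 else 0))"
      using orth_rows[OF P that] by (intro sum.cong refl) simp
    also have "\<dots> = z i j" using that by (simp add: if_distrib cong: if_cong)
    finally show ?thesis by simp
  qed
  have aa: "(\<Sum>j<n. a l j * a l' j) = (if l = l' then \<nu> l else 0)" if l: "l < m" "l' < m" for l l'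
  proof -
    have "(\<Sum>j<n. a l j * a l' j) = (\<Sum>j<n. \<Sum>i<m. \<Sum>i'<m. P i l * P i' l' * (z i j * z i' j))"
      unfolding a_def sum_product by (simp add: mult_ac)
    also have "\<dots> = (\<Sum>i<m. \<Sum>j<n. \<Sum>i'<m. P i l * P i' l' * (z i j * z i' j))" by (rule sum.swap)
    also have "\<dots> = (\<Sum>i<m. \<Sum>i'<m. \<Sum>j<n. P i l * P i' l' * (z i j * z i' j))"
      by (intro sum.cong sum.swap refl)
    also have "\<dots> = (\<Sum>i<m. \<Sum>i'<m. P i l * (\<Sum>e<m. \<nu> e * P i e * P i' e) * P i' l')"
      unfolding sum_distrib_left[symmetric] by (intro sum.cong refl) (simp add: M)
    also have "\<dots> = (\<Sum>e<m. \<nu> e * (\<Sum>i<m. P i e * P i l) * (\<Sum>i<m. P i e * P i l'))"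
      by (rule bilinear_svd_expand)
    also have "\<dots> = (\<Sum>e<m. if e = l then (if l = l' then \<nu> l else 0) else 0)"
      using orth_cols[OF P _ l(1)] orth_cols[OF P _ l(2)] by (intro sum.cong) auto
    finally show ?thesis using l by simp
  qed
  have l0: "0 \<le> \<nu> l" if "l < m" for l
  proof -
    have "0 \<le> (\<Sum>j<n. a l j * a l j)" by (auto intro: sum_nonneg)
    then show ?thesis using aa[OF that that] by simp
  qed
  define y where "y = (\<lambda>l. sqrt (\<nu> l))"
  define I where "I = {l. l < m \<and> 0 < \<nu> l}"
  have "\<exists>V. orth n V \<and> (\<forall>l\<in>I. \<forall>j<n. V j l = a l j / y l)"
  proof (rule orthonormal_family_completion)
    show "I \<subseteq> {..<n}" using assms by (auto simp: I_def)
    fix l l' assume "l \<in> I" "l' \<in> I"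
    then have "l < m" "l' < m" "\<nu> l > 0" by (auto simp: I_def)
    then show "(\<Sum>j<n. a l j / y l * (a l' j / y l')) = (if l = l' then 1 else 0)"
      using aa[of l l'] by (auto simp: sum_divide_distrib[symmetric] y_def)
  qed
  then obtain Q where Q: "orth n Q" "\<And>l j. l \<in> I \<Longrightarrow> j < n \<Longrightarrow> Q j l = a l j / y l" by blast
  have ay: "a l j = y l * Q j l" if "l < m" "j < n" for l j
  proof (cases "\<nu> l > 0")
    case True
    then show ?thesis using Q(2)[of l j] that by (simp add: I_def y_def)
  next
    case False
    then have z: "\<nu> l = 0" using l0[OF that(1)] by simp
    have "(\<Sum>j<n. a l j * a l j) = 0" using aa[of l l] that z by simp
    then have "a l j = 0" using that by (subst (asm) sum_nonneg_eq_0_iff) auto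
    then show ?thesis by (simp add: y_def z)
  qed
  have "z i j = (\<Sum>l<m. y l * P i l * Q j l)" if "i < m" "j < n" for i j
    using za[OF that(1)] ay[OF _ that(2)] by (simp add: mult_ac)
  then have "is_svd m n z y P Q"
    using P Q(1) l0 desc by (auto simp: is_svd_def y_def)
  then show thesis by (rule that)
qed

section \<open>Eigenvalues and singular values from decompositions\<close>

text \<open>Similar matrices have the same characteristic polynomial, and that of a diagonal matrix is a product
of linear factors. So \<open>ord_eigval\<close> reads off any ordered diagonalization.\<close>

lemma ord_eigval_eqI:
  assumes A: "A \<in> carrier_mat n n" and Q: "orth n Q"
    and desc: "\<And>i j. i \<le> j \<Longrightarrow> j < n \<Longrightarrow> \<nu> j \<le> \<nu> i"
    and dec: "\<And>i j. i < n \<Longrightarrow> j < n \<Longrightarrow> A $$ (i, j) = (\<Sum>l<n. \<nu> l * Q i l * Q j l)"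
    and l: "l < n"
  shows "ord_eigval (Suc l) A = \<nu> l"
proof -
  define D where "D = mat n n (\<lambda>(i, j). if i = j then \<nu> i else 0)"
  define M where "M = mat n n (\<lambda>(i, j). Q i j)"
  define N where "N = mat n n (\<lambda>(i, j). Q j i)"
  have c: "D \<in> carrier_mat n n" "M \<in> carrier_mat n n" "N \<in> carrier_mat n n"
    by (auto simp: D_def M_def N_def)
  have MN: "M * N = 1\<^sub>m n"
    by (rule eq_matI) (auto simp: M_def N_def scalar_prod_def atLeast0LessThan orth_rows[OF Q])
  have NM: "N * M = 1\<^sub>m n"
    by (rule eq_matI) (auto simp: M_def N_def scalar_prod_def atLeast0LessThan orth_cols[OF Q])
  have MD: "M * D = mat n n (\<lambda>(i, j). \<nu> j * Q i j)"
    by (rule eq_matI)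
      (auto simp: M_def D_def scalar_prod_def atLeast0LessThan if_distrib cong: if_cong)
  have "A = M * D * N"
    unfolding MD using A
    by (intro eq_matI) (auto simp: N_def scalar_prod_def atLeast0LessThan dec)
  then have "similar_mat A D" using similar_matI[of A D M N n] A c MN NM by simp
  then have "char_poly A = char_poly D" by (rule char_poly_similar)
  also have "\<dots> = (\<Prod>a\<leftarrow>diag_mat D. [:- a, 1:])"
    by (rule char_poly_upper_triangular[OF c(1)]) (auto simp: D_def)
  also have "diag_mat D = map \<nu> [0..<n]" by (simp add: diag_mat_def D_def)
  finally have cp: "char_poly A = (\<Prod>a\<leftarrow>map \<nu> [0..<n]. [:- a, 1:])" .
  have roots: "proots (\<Prod>a\<leftarrow>as. [:- a, 1:]) = mset as" for as :: "real list"
  proof (induction as)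
    case (Cons a as)
    have "(\<Prod>a\<leftarrow>as. [:- a, 1:]) \<noteq> 0" by (auto simp: prod_list_zero_iff)
    then have "proots ([:- a, 1:] * (\<Prod>a\<leftarrow>as. [:- a, 1:])) = proots [:- a, 1:] + mset as"
      using Cons by (subst proots_mult) auto
    moreover have "proots [:- a, 1:] = {#a#}" by simp
    ultimately show ?case by simp
  qed simp
  have "sorted_wrt (\<ge>) (map \<nu> [0..<n])" using desc by (auto simp: sorted_wrt_iff_nth_less)
  then have "sorted (rev (map \<nu> [0..<n]))" by (simp add: sorted_wrt_rev)
  then have "sort (map \<nu> [0..<n]) = rev (map \<nu> [0..<n])"
    by (metis mset_rev properties_for_sort)
  then have "ord_eigvals A = map \<nu> [0..<n]"
    unfolding ord_eigvals_def cp roots sorted_list_of_multiset_mset by simp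
  then show ?thesis using l by (simp add: ord_eigval_def)
qed

lemma orth_sum_expand:
  assumes "orth n Q"
  shows "(\<Sum>a<n. (\<Sum>l<n. x l * Q a l) * (\<Sum>l<n. y l * Q a l)) = (\<Sum>l<n. x l * y l)"
  using orth_parseval[OF orth_transpose[OF assms], of x y] by (simp add: mult.commute)

lemma is_svdD:
  assumes "is_svd m n z y P Q"
  shows "orth m P" "orth n Q" "\<And>i j. i < m \<Longrightarrow> j < n \<Longrightarrow> z i j = (\<Sum>l<m. y l * P i l * Q j l)"
    "\<And>l. l < m \<Longrightarrow> 0 \<le> y l" "\<And>i j. i \<le> j \<Longrightarrow> j < m \<Longrightarrow> y j \<le> y i"
  using assms by (auto simp: is_svd_def)

lemma sum_lessThan_if_less:
  fixes f :: "nat \<Rightarrow> 'a::comm_monoid_add"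
  assumes "m \<le> n"
  shows "(\<Sum>l<n. if l < m then f l else 0) = (\<Sum>l<m. f l)"
proof -
  have "{..<n} \<inter> {l. l < m} = {..<m}" using assms by auto
  then show ?thesis by (simp add: sum.If_cases)
qed

abbreviation entries :: "real mat \<Rightarrow> nat \<Rightarrow> nat \<Rightarrow> real" where
  "entries A \<equiv> \<lambda>i j. A $$ (i, j)"

lemma sing_val_eqI:
  assumes Z: "Z \<in> carrier_mat m n" and mn: "m \<le> n"
    and svd: "is_svd m n (entries Z) y P Q" and l: "l < m"
  shows "sing_val (Suc l) Z = y l"
proof -
  note S = is_svdD[OF svd]
  have "(Z * transpose_mat Z) $$ (i, j) = (\<Sum>l<m. (y l)\<^sup>2 * P i l * P j l)" if "i < m" "j < m" for i j
  proof -
    have row: "Z $$ (i, a) = (\<Sum>l<n. (if l < m then y l * P i l else 0) * Q a l)"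
      if "i < m" "a < n" for i a
      using S(3)[OF that] sum_lessThan_if_less[OF mn, of "\<lambda>l. y l * P i l * Q a l"]
      by (simp add: if_distrib[of "\<lambda>x. x * _"] cong: if_cong)
    have "(Z * transpose_mat Z) $$ (i, j) = (\<Sum>a<n. Z $$ (i, a) * Z $$ (j, a))"
      using Z that by (auto simp: scalar_prod_def atLeast0LessThan)
    also have "\<dots> = (\<Sum>a<n. (\<Sum>l<n. (if l < m then y l * P i l else 0) * Q a l) *
        (\<Sum>l<n. (if l < m then y l * P j l else 0) * Q a l))"
      using row that by (intro sum.cong refl) auto
    also have "\<dots> = (\<Sum>l<n. if l < m then (y l)\<^sup>2 * P i l * P j l else 0)"
      unfolding orth_sum_expand[OF S(2)]
      by (intro sum.cong refl) (auto simp: power2_eq_square)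
    also have "\<dots> = (\<Sum>l<m. (y l)\<^sup>2 * P i l * P j l)" by (rule sum_lessThan_if_less[OF mn])
    finally show ?thesis .
  qed
  then have "ord_eigval (Suc l) (Z * transpose_mat Z) = (y l)\<^sup>2"
    using Z S(4,5) l
    by (intro ord_eigval_eqI[OF _ S(1)]) (auto intro!: power_mono)
  then show ?thesis using S(4)[OF l] by (simp add: sing_val_def)
qed

section \<open>Ky Fan norms as maxima of linear functionals\<close>

definition ky_fan :: "nat \<Rightarrow> nat \<Rightarrow> nat \<Rightarrow> (nat \<Rightarrow> nat \<Rightarrow> real) \<Rightarrow> real" where
  "ky_fan k m n z = ky_fan_norm k (mat m n (\<lambda>(i, j). z i j))"

lemma is_svd_cong:
  assumes "\<And>i j. i < m \<Longrightarrow> j < n \<Longrightarrow> z i j = z' i j"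
  shows "is_svd m n z y P Q \<longleftrightarrow> is_svd m n z' y P Q"
  using assms by (auto simp: is_svd_def)

lemma ky_fan_cong:
  assumes "\<And>i j. i < m \<Longrightarrow> j < n \<Longrightarrow> z i j = z' i j"
  shows "ky_fan k m n z = ky_fan k m n z'"
proof -
  have "mat m n (\<lambda>(i, j). z i j) = mat m n (\<lambda>(i, j). z' i j)" using assms by (intro eq_matI) auto
  then show ?thesis by (simp add: ky_fan_def)
qed

text \<open>All estimates of Ky Fan norms below go through this formula and \<open>svd_exists\<close>.\<close>

lemma ky_fan_svd:
  assumes "k \<le> m" "m \<le> n" and svd: "is_svd m n z y P Q"
  shows "ky_fan k m n z = (\<Sum>l<k. y l)"
proof -
  define Z where "Z = mat m n (\<lambda>(i, j). z i j)"
  have "is_svd m n (entries Z) y P Q"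
    using svd by (subst is_svd_cong[where z' = z]) (auto simp: Z_def)
  then have "sing_val (Suc l) Z = y l" if "l < m" for l
    using sing_val_eqI[OF _ assms(2)] that by (simp add: Z_def)
  then have "(\<Sum>l<k. sing_val (Suc l) Z) = (\<Sum>l<k. y l)" using assms(1) by (intro sum.cong) auto
  moreover have "(\<Sum>l<k. sing_val (Suc l) Z) = (\<Sum>i = 1..k. sing_val i Z)"
    by (rule sum.reindex_bij_witness[of _ "\<lambda>i. i - 1" Suc]) auto
  ultimately show ?thesis by (simp add: ky_fan_def ky_fan_norm_def Z_def[symmetric])
qed

text \<open>The matrix \<open>A\<^sup>T z B\<close>, that is \<open>z\<close> in the orthonormal bases given by the columns of \<open>A\<close> and \<open>B\<close>.\<close>

definition change_basis ::
  "nat \<Rightarrow> nat \<Rightarrow> (nat \<Rightarrow> nat \<Rightarrow> real) \<Rightarrow> (nat \<Rightarrow> nat \<Rightarrow> real) \<Rightarrow> (nat \<Rightarrow> nat \<Rightarrow> real) \<Rightarrow> nat \<Rightarrow> nat \<Rightarrow> real"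
  where "change_basis m n A B z i j = (\<Sum>a<m. A a i * (\<Sum>b<n. z a b * B b j))"

text \<open>The trace inner product \<open>\<langle>s, z\<rangle>\<close>.\<close>

definition frobenius :: "nat \<Rightarrow> nat \<Rightarrow> (nat \<Rightarrow> nat \<Rightarrow> real) \<Rightarrow> (nat \<Rightarrow> nat \<Rightarrow> real) \<Rightarrow> real" where
  "frobenius m n s z = (\<Sum>i<m. \<Sum>j<n. s i j * z i j)"

lemma frobenius_change_basis:
  assumes A: "orth m A" and B: "orth n B"
  shows "frobenius m n (change_basis m n A B s) (change_basis m n A B z) = frobenius m n s z"
proof -
  have "frobenius m n (change_basis m n A B s) (change_basis m n A B z)
      = (\<Sum>j<n. \<Sum>i<m. change_basis m n A B s i j * change_basis m n A B z i j)"
    unfolding frobenius_def by (rule sum.swap)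
  also have "\<dots> = (\<Sum>j<n. \<Sum>a<m. (\<Sum>b<n. s a b * B b j) * (\<Sum>b<n. z a b * B b j))"
    unfolding change_basis_def by (simp add: orth_parseval[OF A])
  also have "\<dots> = (\<Sum>a<m. \<Sum>j<n. (\<Sum>b<n. B b j * s a b) * (\<Sum>b<n. B b j * z a b))"
    by (subst sum.swap) (simp add: mult.commute)
  also have "\<dots> = frobenius m n s z" unfolding frobenius_def by (simp add: orth_parseval[OF B])
  finally show ?thesis .
qed

lemma is_svd_change_basis:
  assumes A: "orth m A" and B: "orth n B" and svd: "is_svd m n z y P Q"
  shows "is_svd m n (change_basis m n A B z) y (\<lambda>i l. \<Sum>a<m. A a i * P a l) (\<lambda>j l. \<Sum>b<n. B b j * Q b l)"
proof -
  note S = is_svdD[OF svd]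
  have "change_basis m n A B z i j = (\<Sum>l<m. y l * (\<Sum>a<m. A a i * P a l) * (\<Sum>b<n. B b j * Q b l))"
    if "i < m" "j < n" for i j
  proof -
    have "change_basis m n A B z i j = (\<Sum>a<m. \<Sum>b<n. A a i * z a b * B b j)"
      by (simp add: change_basis_def sum_distrib_left mult.assoc)
    also have "\<dots> = (\<Sum>a<m. \<Sum>b<n. A a i * (\<Sum>l<m. y l * P a l * Q b l) * B b j)"
      using S(3) by (intro sum.cong refl) simp
    also have "\<dots> = (\<Sum>l<m. y l * (\<Sum>a<m. P a l * A a i) * (\<Sum>b<n. Q b l * B b j))"
      by (rule bilinear_svd_expand)
    finally show ?thesis by (simp add: mult.commute)
  qed
  then show ?thesis using S(4,5) orth_mult[OF A S(1)] orth_mult[OF B S(2)] by (simp add: is_svd_def)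
qed

lemma ky_fan_change_basis:
  assumes "k \<le> m" "m \<le> n" "orth m A" "orth n B"
  shows "ky_fan k m n (change_basis m n A B z) = ky_fan k m n z"
proof -
  obtain y P Q where svd: "is_svd m n z y P Q" using svd_exists[OF assms(2)] by blast
  show ?thesis
    using ky_fan_svd[OF assms(1,2) svd] ky_fan_svd[OF assms(1,2) is_svd_change_basis[OF assms(3,4) svd]] by simp
qed

text \<open>The trace of the leading \<open>k \<times> k\<close> block of \<open>P\<^sup>T z Q\<close>. For orthogonal \<open>P\<close>, \<open>Q\<close> these are the linear
functionals whose pointwise maximum is the Ky Fan norm.\<close>

definition leading_trace ::
  "nat \<Rightarrow> nat \<Rightarrow> nat \<Rightarrow> (nat \<Rightarrow> nat \<Rightarrow> real) \<Rightarrow> (nat \<Rightarrow> nat \<Rightarrow> real) \<Rightarrow> (nat \<Rightarrow> nat \<Rightarrow> real) \<Rightarrow> real"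
  where "leading_trace k m n P Q z = (\<Sum>l<k. \<Sum>i<m. \<Sum>j<n. P i l * z i j * Q j l)"

lemma leading_trace_frobenius: "leading_trace k m n P Q z = frobenius m n (\<lambda>i j. \<Sum>l<k. P i l * Q j l) z"
proof -
  have "leading_trace k m n P Q z = (\<Sum>i<m. \<Sum>l<k. \<Sum>j<n. P i l * z i j * Q j l)"
    unfolding leading_trace_def by (rule sum.swap)
  also have "\<dots> = (\<Sum>i<m. \<Sum>j<n. \<Sum>l<k. P i l * z i j * Q j l)"
    by (intro sum.cong sum.swap refl)
  also have "\<dots> = frobenius m n (\<lambda>i j. \<Sum>l<k. P i l * Q j l) z"
    by (simp add: frobenius_def sum_distrib_left sum_distrib_right mult_ac)
  finally show ?thesis .
qed

text \<open>In terms of a singular value decomposition of \<open>z\<close> the functional is a weighted sum of the singular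
values, which is what \<open>threshold_weights\<close> applies to.\<close>

lemma leading_trace_svd:
  assumes "is_svd m n z y A B"
  shows "leading_trace k m n P Q z = (\<Sum>e<m. y e * (\<Sum>l<k. (\<Sum>i<m. A i e * P i l) * (\<Sum>j<n. B j e * Q j l)))"
proof -
  note S = is_svdD[OF assms]
  have "leading_trace k m n P Q z = (\<Sum>l<k. \<Sum>i<m. \<Sum>j<n. P i l * (\<Sum>e<m. y e * A i e * B j e) * Q j l)"
    unfolding leading_trace_def using S(3) by simp
  also have "\<dots> = (\<Sum>e<m. \<Sum>l<k. y e * (\<Sum>i<m. A i e * P i l) * (\<Sum>j<n. B j e * Q j l))"
    unfolding bilinear_svd_expand by (rule sum.swap)
  finally show ?thesis by (simp only: mult.assoc sum_distrib_left[symmetric])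
qed

lemma orth_partial_row_le:
  assumes "orth n P" "e < n" "k \<le> n"
  shows "(\<Sum>l<k. P e l * P e l) \<le> 1"
proof -
  have "(\<Sum>l<k. P e l * P e l) \<le> (\<Sum>l<n. P e l * P e l)"
    using assms(3) by (intro sum_mono2) auto
  then show ?thesis using orth_rows[OF assms(1,2,2)] by simp
qed

lemma orth_partial_col_le:
  assumes "orth n P" "l < n" "k \<le> n"
  shows "(\<Sum>e<k. P e l * P e l) \<le> 1"
  using orth_partial_row_le[OF orth_transpose[OF assms(1)] assms(2,3)] .

text \<open>The weights \<open>c e\<close> of \<open>leading_trace_svd\<close> may be negative. By \<open>2 a b \<le> a\<^sup>2 + b\<^sup>2\<close> they are dominated by
\<open>d e\<close>, which lies in \<open>[0, 1]\<close> because the rows have length at most 1 and has total at most \<open>k\<close> because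
\<open>k\<close> columns are involved. Equality of both weights forces the two rows to agree.\<close>

lemma diagonal_weights:
  assumes R: "orth m R" and T: "orth n T" and k: "k \<le> m" and mn: "m \<le> n"
  defines "c \<equiv> \<lambda>e. \<Sum>l<k. R e l * T e l"
    and "d \<equiv> \<lambda>e. (\<Sum>l<k. R e l * R e l + T e l * T e l) / 2"
  shows "\<And>e. c e \<le> d e" "\<And>e. 0 \<le> d e" "\<And>e. e < m \<Longrightarrow> d e \<le> 1" "(\<Sum>e<m. d e) \<le> real k"
    and "\<And>e. c e = d e \<Longrightarrow> l < k \<Longrightarrow> R e l = T e l"
proof -
  have diff: "d e - c e = (\<Sum>l<k. (R e l - T e l) * (R e l - T e l)) / 2" for e
    unfolding c_def d_def
    by (simp add: sum_subtractf[symmetric] sum_divide_distrib algebra_simps add_divide_distrib diff_divide_distrib)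
  show "c e \<le> d e" for e
  proof -
    have "0 \<le> (\<Sum>l<k. (R e l - T e l) * (R e l - T e l))" by (auto intro: sum_nonneg)
    then show ?thesis using diff[of e] by simp
  qed
  show "0 \<le> d e" for e unfolding d_def by (auto intro!: sum_nonneg)
  show "d e \<le> 1" if "e < m" for e
    using orth_partial_row_le[OF R that k] orth_partial_row_le[OF T, of e k] that k mn
    by (simp add: d_def sum.distrib)
  have "(\<Sum>e<m. d e) = (\<Sum>l<k. ((\<Sum>e<m. R e l * R e l) + (\<Sum>e<m. T e l * T e l)) / 2)"
    unfolding d_def sum_divide_distrib by (subst sum.swap) (simp add: sum_divide_distrib sum.distrib add_divide_distrib)
  also have "\<dots> \<le> (\<Sum>l<k. 1)"
  proof (rule sum_mono)
    fix l assume "l \<in> {..<k}"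
    then have "(\<Sum>e<m. R e l * R e l) \<le> 1" "(\<Sum>e<m. T e l * T e l) \<le> 1"
      using orth_partial_col_le[OF R] orth_partial_col_le[OF T] k mn by auto
    then show "((\<Sum>e<m. R e l * R e l) + (\<Sum>e<m. T e l * T e l)) / 2 \<le> 1" by simp
  qed
  finally show "(\<Sum>e<m. d e) \<le> real k" by simp
  show "R e l = T e l" if "c e = d e" "l < k" for e l
  proof -
    have "(\<Sum>l<k. (R e l - T e l) * (R e l - T e l)) = 0" using diff[of e] that by simp
    then have "(R e l - T e l) * (R e l - T e l) = 0"
      using that by (subst (asm) sum_nonneg_eq_0_iff) auto
    then show ?thesis by simp
  qed
qed

theorem ky_fan_inequality:
  assumes k: "1 \<le> k" "k \<le> m" and mn: "m \<le> n" and P: "orth m P" and Q: "orth n Q"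
  shows "leading_trace k m n P Q z \<le> ky_fan k m n z"
proof -
  obtain y A B where svd: "is_svd m n z y A B" using svd_exists[OF mn] by blast
  note S = is_svdD[OF svd]
  define R where "R = (\<lambda>e l. \<Sum>i<m. A i e * P i l)"
  define T where "T = (\<lambda>e l. \<Sum>j<n. B j e * Q j l)"
  have R: "orth m R" and T: "orth n T"
    unfolding R_def T_def using orth_mult[OF S(1) P] orth_mult[OF S(2) Q] by simp_all
  note W = diagonal_weights[OF R T k(2) mn]
  have "(\<Sum>e<m. y e * (\<Sum>l<k. R e l * T e l)) \<le> (\<Sum>e<k. y e)"
    by (rule threshold_weights(1)[OF k S(5) S(4) W(1-4)])
  then show ?thesis
    unfolding leading_trace_svd[OF svd] ky_fan_svd[OF k(2) mn svd] R_def T_def .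
qed

lemma leading_trace_singular_vectors:
  assumes k: "k \<le> m" and mn: "m \<le> n" and svd: "is_svd m n z y A B"
  shows "leading_trace k m n A B z = (\<Sum>l<k. y l)"
proof -
  note S = is_svdD[OF svd]
  have "leading_trace k m n A B z = (\<Sum>e<m. if e < k then y e else 0)"
    unfolding leading_trace_svd[OF svd]
  proof (intro sum.cong refl)
    fix e assume e: "e \<in> {..<m}"
    have "(\<Sum>l<k. (\<Sum>i<m. A i e * A i l) * (\<Sum>j<n. B j e * B j l))
       = (\<Sum>l<k. if e = l then 1 else 0)"
      using orth_cols[OF S(1)] orth_cols[OF S(2)] e k mn by (intro sum.cong) auto
    then show "y e * (\<Sum>l<k. (\<Sum>i<m. A i e * A i l) * (\<Sum>j<n. B j e * B j l)) = (if e < k then y e else 0)"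
      by simp
  qed
  then show ?thesis by (simp only: sum_lessThan_if_less[OF k])
qed

lemma ky_fan_attained:
  assumes k: "k \<le> m" and mn: "m \<le> n"
  obtains P Q where "orth m P" "orth n Q" "leading_trace k m n P Q z = ky_fan k m n z"
proof -
  obtain y A B where svd: "is_svd m n z y A B" using svd_exists[OF mn] by blast
  have "leading_trace k m n A B z = ky_fan k m n z"
    unfolding leading_trace_singular_vectors[OF k mn svd] ky_fan_svd[OF k mn svd] ..
  then show thesis using that is_svdD(1,2)[OF svd] by blast
qed

section \<open>Subgradients of Ky Fan norms\<close>

lemma frobenius_add_right:
  "frobenius m n s (\<lambda>i j. x i j + t * h i j) = frobenius m n s x + t * frobenius m n s h"
  by (simp add: frobenius_def sum.distrib sum_distrib_left algebra_simps)

lemma frobenius_cong: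
  assumes "\<And>i j. i < m \<Longrightarrow> j < n \<Longrightarrow> s i j = s' i j" "\<And>i j. i < m \<Longrightarrow> j < n \<Longrightarrow> z i j = z' i j"
  shows "frobenius m n s z = frobenius m n s' z'"
  using assms by (simp add: frobenius_def)

lemma leading_trace_add_right:
  "leading_trace k m n P Q (\<lambda>i j. x i j + t * h i j) = leading_trace k m n P Q x + t * leading_trace k m n P Q h"
  unfolding leading_trace_frobenius by (rule frobenius_add_right)

lemma frobenius_change_basis_adjoint:
  "frobenius m n (change_basis m n A B s) z = frobenius m n s (change_basis m n (\<lambda>a b. A b a) (\<lambda>a b. B b a) z)"
proof -
  have "frobenius m n (change_basis m n A B s) z = (\<Sum>i<m. \<Sum>j<n. \<Sum>a<m. \<Sum>b<n. A a i * s a b * B b j * z i j)"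
    by (simp add: frobenius_def change_basis_def sum_distrib_left sum_distrib_right mult_ac)
  also have "\<dots> = (\<Sum>i<m. \<Sum>a<m. \<Sum>j<n. \<Sum>b<n. A a i * s a b * B b j * z i j)"
    by (intro sum.cong sum.swap refl)
  also have "\<dots> = (\<Sum>i<m. \<Sum>a<m. \<Sum>b<n. \<Sum>j<n. A a i * s a b * B b j * z i j)"
    by (intro sum.cong sum.swap refl)
  also have "\<dots> = (\<Sum>a<m. \<Sum>i<m. \<Sum>b<n. \<Sum>j<n. A a i * s a b * B b j * z i j)"
    by (rule sum.swap)
  also have "\<dots> = (\<Sum>a<m. \<Sum>b<n. \<Sum>i<m. \<Sum>j<n. A a i * s a b * B b j * z i j)"
    by (intro sum.cong sum.swap refl)
  also have "\<dots> = frobenius m n s (change_basis m n (\<lambda>a b. A b a) (\<lambda>a b. B b a) z)"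
    by (simp add: frobenius_def change_basis_def sum_distrib_left sum_distrib_right mult_ac)
  finally show ?thesis .
qed

text \<open>For a norm, \<open>S\<close> is a subgradient at \<open>x\<close> iff \<open>S\<close> lies in the dual unit ball and attains the norm at \<open>x\<close>.\<close>

definition norming ::
  "nat \<Rightarrow> nat \<Rightarrow> nat \<Rightarrow> (nat \<Rightarrow> nat \<Rightarrow> real) \<Rightarrow> (nat \<Rightarrow> nat \<Rightarrow> real) \<Rightarrow> bool" where
  "norming k m n s x \<longleftrightarrow> (\<forall>z. frobenius m n s z \<le> ky_fan k m n z) \<and> frobenius m n s x = ky_fan k m n x"

lemma ky_fan_scale:
  assumes "k \<le> m" "m \<le> n" "0 \<le> c"
  shows "ky_fan k m n (\<lambda>i j. c * z i j) = c * ky_fan k m n z"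
proof -
  obtain y P Q where svd: "is_svd m n z y P Q" using svd_exists[OF assms(2)] by blast
  have "is_svd m n (\<lambda>i j. c * z i j) (\<lambda>l. c * y l) P Q"
    using svd assms(3) by (auto simp: is_svd_def sum_distrib_left mult.assoc intro: mult_left_mono)
  from ky_fan_svd[OF assms(1,2) this] ky_fan_svd[OF assms(1,2) svd] show ?thesis
    by (simp add: sum_distrib_left)
qed

text \<open>Test the subgradient inequality at 0 and at \<open>2 x\<close>.\<close>

lemma norming_if_subgradient:
  assumes "k \<le> m" "m \<le> n"
    and sub: "\<And>z. ky_fan k m n x + frobenius m n s (\<lambda>i j. z i j - x i j) \<le> ky_fan k m n z"
  shows "norming k m n s x"
proof -
  have lin: "frobenius m n s (\<lambda>i j. z i j - x i j) = frobenius m n s z - frobenius m n s x" for z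
    using frobenius_add_right[of m n s z "- 1" x] by simp
  have sc: "frobenius m n s (\<lambda>i j. c * x i j) = c * frobenius m n s x" for c
    by (simp add: frobenius_def sum_distrib_left mult_ac)
  have "frobenius m n s x = ky_fan k m n x"
    using sub[of "\<lambda>i j. 0 * x i j"] sub[of "\<lambda>i j. 2 * x i j"]
      ky_fan_scale[OF assms(1,2), of 0 x] ky_fan_scale[OF assms(1,2), of 2 x]
    unfolding lin sc by simp
  then show ?thesis using sub lin by (auto simp: norming_def)
qed

lemma norming_change_basis:
  assumes "k \<le> m" "m \<le> n" "norming k m n s x" "orth m A" "orth n B"
  shows "norming k m n (change_basis m n A B s) (change_basis m n A B x)"
proof -
  have "frobenius m n (change_basis m n A B s) z \<le> ky_fan k m n z" for z
    using assms(3) ky_fan_change_basis[OF assms(1,2) orth_transpose[OF assms(4)] orth_transpose[OF assms(5)], of z]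
    unfolding frobenius_change_basis_adjoint[of m n A B s] norming_def by metis
  then show ?thesis
    using assms(3)
      by (simp add: norming_def frobenius_change_basis[OF assms(4,5)] ky_fan_change_basis[OF assms(1,2,4,5)])
qed

text \<open>Orthogonal invariance: \<open>\<langle>s, A\<^sup>T x B\<rangle> \<le> \<theta>(A\<^sup>T x B) = \<theta>(x) = \<langle>s, x\<rangle>\<close>.\<close>

lemma norming_max_over_rotations:
  assumes "k \<le> m" "m \<le> n" "norming k m n s x" "orth m A" "orth n B"
  shows "frobenius m n s (change_basis m n A B x) \<le> frobenius m n s x"
  using assms(3) ky_fan_change_basis[OF assms(1,2,4,5), of x] by (metis norming_def)

definition sign_mat :: "(nat \<Rightarrow> real) \<Rightarrow> nat \<Rightarrow> nat \<Rightarrow> real" where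
  "sign_mat d a b = (if a = b then d a else 0)"

lemma orth_sign_mat: "(\<And>i. d i * d i = 1) \<Longrightarrow> orth n (sign_mat d)"
proof (rule orthI_cols)
  fix i j assume d: "\<And>i. d i * d i = 1" and ij: "i < n" "j < n"
  have "(\<Sum>l<n. sign_mat d l i * sign_mat d l j) = (\<Sum>l<n. if l = i then (if i = j then 1 else 0) else 0)"
    using d by (intro sum.cong) (auto simp: sign_mat_def)
  then show "(\<Sum>l<n. sign_mat d l i * sign_mat d l j) = (if i = j then 1 else 0)" using ij by simp
qed

lemma change_basis_sign_mat:
  assumes "i < m" "j < n"
  shows "change_basis m n (sign_mat d) (sign_mat e) z i j = d i * e j * z i j"
proof -
  have "change_basis m n (sign_mat d) (sign_mat e) z i j
      = (\<Sum>a<m. if a = i then d i * (\<Sum>b<n. if b = j then z a b * e j else 0) else 0)"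
    unfolding change_basis_def sign_mat_def by (intro sum.cong refl) (auto simp: if_distrib cong: if_cong)
  then show ?thesis using assms by simp
qed

definition transposition_mat :: "nat \<Rightarrow> nat \<Rightarrow> nat \<Rightarrow> nat \<Rightarrow> real" where
  "transposition_mat p q a b = (if a = (if b = p then q else if b = q then p else b) then 1 else 0)"

lemma orth_transposition_mat: "p < n \<Longrightarrow> q < n \<Longrightarrow> orth n (transposition_mat p q)"
proof (rule orthI_cols)
  fix i j assume pq: "p < n" "q < n" and ij: "i < n" "j < n"
  define \<sigma> where "\<sigma> = (\<lambda>b. if b = p then q else if b = q then p else b)"
  have sw: "transposition_mat p q a b = (if a = \<sigma> b then 1 else 0)" for a b
    by (simp add: transposition_mat_def \<sigma>_def)
  have "(\<Sum>l<n. transposition_mat p q l i * transposition_mat p q l j)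
      = (\<Sum>l<n. if l = \<sigma> i then (if \<sigma> i = \<sigma> j then 1 else 0) else 0)"
    unfolding sw by (intro sum.cong) auto
  moreover have "\<sigma> i = \<sigma> j \<longleftrightarrow> i = j" "\<sigma> i < n" using pq ij by (auto simp: \<sigma>_def)
  ultimately show "(\<Sum>l<n. transposition_mat p q l i * transposition_mat p q l j) = (if i = j then 1 else 0)"
    by simp
qed

lemma change_basis_transposition_mat:
  assumes "i < m" "p < m" "q < m" "m \<le> n"
  shows "change_basis m n (transposition_mat p q) (transposition_mat p q) z i i =
    (if i = p then z q q else if i = q then z p p else z i i)"
proof -
  define \<sigma> where "\<sigma> = (if i = p then q else if i = q then p else i)"
  have sw: "transposition_mat p q a i
      = (if a = \<sigma> then 1 else 0)" for a by (simp add: transposition_mat_def \<sigma>_def)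
  have "change_basis m n (transposition_mat p q) (transposition_mat p q) z i i
      = (\<Sum>a<m. if a = \<sigma> then (\<Sum>b<n. if b = \<sigma> then z a b else 0) else 0)"
    unfolding change_basis_def sw by (intro sum.cong refl) (auto simp: if_distrib cong: if_cong)
  moreover have "\<sigma> < m" using assms by (auto simp: \<sigma>_def)
  ultimately show ?thesis using assms by (auto simp: \<sigma>_def)
qed

lemma frobenius_diagonal:
  assumes mn: "m \<le> n" and s: "\<And>i j. i < m \<Longrightarrow> j < n \<Longrightarrow> i \<noteq> j \<Longrightarrow> s i j = 0"
  shows "frobenius m n s z = (\<Sum>i<m. s i i * z i i)"
  unfolding frobenius_def
proof (intro sum.cong refl)
  fix i assume i: "i \<in> {..<m}"
  have "(\<Sum>j<n. s i j * z i j) = (\<Sum>j<n. if j = i then s i i * z i i else 0)"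
    using s i by (intro sum.cong) auto
  then show "(\<Sum>j<n. s i j * z i j) = s i i * z i i" using i mn by simp
qed

lemma nonneg_if_product_and_sum_nonneg: "0 \<le> a * b \<Longrightarrow> 0 \<le> a + b \<Longrightarrow> 0 \<le> a \<and> 0 \<le> b"
  for a b :: real
  by (auto simp: zero_le_mult_iff)

text \<open>If \<open>x + s\<close> is diagonal with descending nonnegative entries and \<open>s\<close> is a subgradient at \<open>x\<close>, then \<open>x\<close>
and \<open>s\<close> have the same form. Each claim compares \<open>x\<close> with one of its images in
\<open>norming_max_over_rotations\<close>. Changing the sign of row and column \<open>i\<close> fixes the diagonal, and off the
diagonal \<open>s = - x\<close>, so the loss is a negative sum of squares over row and column \<open>i\<close>: these
entries vanish. Changing the sign of row \<open>i\<close> alone gives \<open>s\<^sub>i x\<^sub>i \<ge> 0\<close>, and exchanging two indices gives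
\<open>(s\<^sub>i - s\<^sub>j) (x\<^sub>i - x\<^sub>j) \<ge> 0\<close>.\<close>

lemma norming_pair_simultaneously_diagonal:
  assumes km: "k \<le> m" and mn: "m \<le> n" and nm: "norming k m n s x"
    and sum: "\<And>i j. i < m \<Longrightarrow> j < n \<Longrightarrow> x i j + s i j = (if i = j then y i else 0)"
    and y0: "\<And>i. i < m \<Longrightarrow> 0 \<le> y i" and desc: "\<And>i j. i \<le> j \<Longrightarrow> j < m \<Longrightarrow> y j \<le> y i"
  shows "\<And>i j. i < m \<Longrightarrow> j < n \<Longrightarrow> i \<noteq> j \<Longrightarrow> x i j = 0"
    and "\<And>i j. i < m \<Longrightarrow> j < n \<Longrightarrow> i \<noteq> j \<Longrightarrow> s i j = 0"
    and "\<And>i. i < m \<Longrightarrow> 0 \<le> x i i" "\<And>i. i < m \<Longrightarrow> 0 \<le> s i i"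
    and "\<And>i j. i \<le> j \<Longrightarrow> j < m \<Longrightarrow> x j j \<le> x i i" "\<And>i j. i \<le> j \<Longrightarrow> j < m \<Longrightarrow> s j j \<le> s i i"
proof -
  note max = norming_max_over_rotations[OF km mn nm]
  have x0: "x i j = 0" if ij: "i < m" "j < n" "i \<noteq> j" for i j
  proof -
    \<comment> \<open>The sign change of row and column \<open>i\<close>.\<close>
    define d :: "nat \<Rightarrow> real" where "d a = (if a = i then -1 else 1)" for a
    have d: "orth p (sign_mat d)" for p by (rule orth_sign_mat) (simp add: d_def)
    have dd: "d a * d b \<le> 1" for a b by (simp add: d_def)
    have "0 \<le> frobenius m n s x - frobenius m n s (change_basis m n (sign_mat d) (sign_mat d) x)"
      using max[OF d d] by simp
    also have "\<dots> = (\<Sum>a<m. \<Sum>b<n. s a b * x a b * (1 - d a * d b))"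
      unfolding frobenius_def sum_subtractf[symmetric]
      by (intro sum.cong refl) (simp add: change_basis_sign_mat algebra_simps)
    also have "\<dots> = - (\<Sum>a<m. \<Sum>b<n. x a b * x a b * (1 - d a * d b))"
      unfolding sum_negf[symmetric]
    proof (intro sum.cong refl)
      fix a b assume "a \<in> {..<m}" "b \<in> {..<n}"
      then have "x a b + s a b = (if a = b then y a else 0)" using sum by simp
      then have "a = b \<or> s a b = - x a b" by (cases "a = b") simp_all
      then show "s a b * x a b * (1 - d a * d b) = - (x a b * x a b * (1 - d a * d b))"
      proof
        assume "s a b = - x a b"
        then show ?thesis by simp
      qed (simp add: d_def)
    qed
    finally have le: "(\<Sum>a<m. \<Sum>b<n. x a b * x a b * (1 - d a * d b)) \<le> 0" by simp
    have nn: "0 \<le> x a b * x a b * (1 - d a * d b)" for a b using dd[of a b] by simp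
    have "x i j * x i j * (1 - d i * d j) \<le> (\<Sum>b<n. x i b * x i b * (1 - d i * d b))"
      using nn ij by (intro member_le_sum) auto
    also have "\<dots> \<le> (\<Sum>a<m. \<Sum>b<n. x a b * x a b * (1 - d a * d b))"
      using nn ij by (intro member_le_sum) (auto intro!: sum_nonneg)
    finally have "x i j * x i j * (1 - d i * d j) \<le> 0" using le by simp
    then have "x i j * x i j \<le> 0" using ij by (simp add: d_def)
    then show ?thesis by (simp add: mult_le_0_iff) (meson antisym)
  qed
  then show "\<And>i j. i < m \<Longrightarrow> j < n \<Longrightarrow> i \<noteq> j \<Longrightarrow> x i j = 0" .
  show s0: "s i j = 0" if ij: "i < m" "j < n" "i \<noteq> j" for i j
    using sum[OF ij(1,2)] x0[OF ij] ij by simp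
  have fd: "frobenius m n s z = (\<Sum>i<m. s i i * z i i)" for z
    by (rule frobenius_diagonal[OF mn s0])
  have diag: "x i i + s i i = y i" if "i < m" for i using sum[of i i] that mn by simp
  have flip: "0 \<le> s i i * x i i" if i: "i < m" for i
  proof -
    define d :: "nat \<Rightarrow> real" where "d a = (if a = i then -1 else 1)" for a
    have d: "orth p (sign_mat d)" for p by (rule orth_sign_mat) (simp add: d_def)
    have one: "orth p (sign_mat (\<lambda>_. 1))" for p by (rule orth_sign_mat) simp
    have "0 \<le> frobenius m n s x - frobenius m n s (change_basis m n (sign_mat d) (sign_mat (\<lambda>_. 1)) x)"
      using max[OF d one] by simp
    also have "\<dots> = (\<Sum>a<m. s a a * x a a * (1 - d a))"
      unfolding fd sum_subtractf[symmetric]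
      using mn by (intro sum.cong refl) (simp add: change_basis_sign_mat algebra_simps)
    also have "\<dots> = (\<Sum>a<m. if a = i then 2 * (s i i * x i i) else 0)"
      by (intro sum.cong) (auto simp: d_def)
    finally show ?thesis using i by simp
  qed
  have both0: "0 \<le> x i i \<and> 0 \<le> s i i" if i: "i < m" for i
    using nonneg_if_product_and_sum_nonneg[of "x i i" "s i i"] flip[OF i] diag[OF i] y0[OF i]
    by (simp add: mult.commute)
  then show "\<And>i. i < m \<Longrightarrow> 0 \<le> x i i" "\<And>i. i < m \<Longrightarrow> 0 \<le> s i i" by auto
  have exch: "0 \<le> (s p p - s q q) * (x p p - x q q)" if pq: "p < m" "q < m" "p \<noteq> q" for p q
  proof -
    have o: "orth m (transposition_mat p q)" "orth n (transposition_mat p q)"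
      using pq mn by (auto intro: orth_transposition_mat)
    have "0
        \<le> frobenius m n s x - frobenius m n s (change_basis m n (transposition_mat p q) (transposition_mat p q) x)"
      using max[OF o] by simp
    also have "\<dots> = (\<Sum>a<m. s a a * (x a a - (if a = p then x q q else if a = q then x p p else x a a)))"
      unfolding fd sum_subtractf[symmetric]
      using mn pq by (intro sum.cong refl) (simp add: change_basis_transposition_mat algebra_simps)
    also have "\<dots> = (\<Sum>a<m. (if a = p then s p p * (x p p - x q q) else 0) +
        (if a = q then s q q * (x q q - x p p) else 0))"
      using pq by (intro sum.cong) auto
    also have "\<dots> = (s p p - s q q) * (x p p - x q q)"
      using pq by (simp add: sum.distrib algebra_simps)
    finally show ?thesis .
  qed
  have desc2: "x j j \<le> x i i \<and> s j j \<le> s i i" if ij: "i \<le> j" "j < m" for i j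
  proof (cases "i = j")
    case False
    have "0 \<le> (s i i - s j j) * (x i i - x j j)" using exch[of i j] ij False by simp
    moreover have "0 \<le> (x i i - x j j) + (s i i - s j j)" using diag[of i] diag[of j] desc[OF ij] ij by simp
    ultimately have "0 \<le> x i i - x j j \<and> 0 \<le> s i i - s j j"
      by (intro nonneg_if_product_and_sum_nonneg) (simp_all add: mult.commute)
    then show ?thesis by simp
  qed simp
  then show "\<And>i j. i \<le> j \<Longrightarrow> j < m \<Longrightarrow> x j j \<le> x i i" "\<And>i j. i \<le> j \<Longrightarrow> j < m \<Longrightarrow> s j j \<le> s i i" by auto
qed

lemma orth_id: "orth n (\<lambda>a b. if a = b then 1 else 0)"
  using orth_sign_mat[of "\<lambda>_. 1" n] by (simp add: sign_mat_def[abs_def])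

lemma is_svd_diagonal:
  assumes mn: "m \<le> n" and x: "\<And>i j. i < m \<Longrightarrow> j < n \<Longrightarrow> x i j = (if i = j then y i else 0)"
    and y: "\<And>i. i < m \<Longrightarrow> 0 \<le> y i" "\<And>i j. i \<le> j \<Longrightarrow> j < m \<Longrightarrow> y j \<le> y i"
  shows "is_svd m n x y (\<lambda>a b. if a = b then 1 else 0) (\<lambda>a b. if a = b then 1 else 0)"
proof -
  have eq: "x i j = (\<Sum>l<m. y l * (if i = l then 1 else 0) * (if j = l then 1 else 0))"
    if "i < m" "j < n" for i j
  proof -
    have "(\<Sum>l<m. y l * (if i = l then 1 else 0) * (if j = l then 1 else 0))
        = (\<Sum>l<m. if l = i then (if i = j then y i else 0) else 0)" by (intro sum.cong) auto
    also have "\<dots> = x i j" unfolding x[OF that] using that by simp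
    finally show ?thesis by simp
  qed
  show ?thesis
    unfolding is_svd_def
  proof (intro conjI allI impI)
    show "x i j = (\<Sum>l<m. y l * (if i = l then 1 else 0) * (if j = l then 1 else 0))"
      if "i < m" "j < n" for i j using that by (rule eq)
    show "0 \<le> y l" if "l < m" for l using that by (rule y(1))
    show "y j \<le> y i" if "i \<le> j" "j < m" for i j using that by (rule y(2))
  qed (rule orth_id)+
qed

text \<open>The dual ball of the Ky Fan norm, tested at the matrix unit of the first entry and at
\<open>[I 0]\<close>, where the norm is 1 and \<open>k\<close>.\<close>

lemma norming_diagonal_bounds:
  assumes k: "1 \<le> k" "k \<le> m" and mn: "m \<le> n" and nm: "norming k m n s x"
    and s: "\<And>i j. i < m \<Longrightarrow> j < n \<Longrightarrow> i \<noteq> j \<Longrightarrow> s i j = 0" "\<And>i j. i \<le> j \<Longrightarrow> j < m \<Longrightarrow> s j j \<le> s i i"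
  shows "\<And>i. i < m \<Longrightarrow> s i i \<le> 1" and "(\<Sum>i<m. s i i) \<le> real k"
proof -
  have fd: "frobenius m n s z = (\<Sum>i<m. s i i * z i i)" for z
    by (rule frobenius_diagonal[OF mn s(1)])
  have le: "(\<Sum>i<m. s i i * y i) \<le> (\<Sum>l<k. y l)"
    if y: "\<And>i. i < m \<Longrightarrow> 0 \<le> y i" "\<And>i j. i \<le> j \<Longrightarrow> j < m \<Longrightarrow> y j \<le> y i" for y
  proof -
    define z where "z = (\<lambda>i j. if i = j then y i else (0::real))"
    have "is_svd m n z y (\<lambda>a b. if a = b then 1 else 0) (\<lambda>a b. if a = b then 1 else 0)"
      by (rule is_svd_diagonal[OF mn _ y]) (auto simp: z_def)
    from ky_fan_svd[OF k(2) mn this] nm have "frobenius m n s z \<le> (\<Sum>l<k. y l)" by (metis norming_def)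
    then show ?thesis by (simp add: fd z_def)
  qed
  have "(\<Sum>i<m. s i i * (if i = 0 then 1 else 0)) \<le> (\<Sum>l<k. if l = 0 then 1 else 0)"
    by (rule le) auto
  then have "s 0 0 \<le> 1" using k by (simp add: if_distrib cong: if_cong)
  then show "\<And>i. i < m \<Longrightarrow> s i i \<le> 1" using s(2)[of 0] by (meson le0 order_trans)
  have "(\<Sum>i<m. s i i * 1) \<le> (\<Sum>l<k. 1)" by (rule le) auto
  then show "(\<Sum>i<m. s i i) \<le> real k" by simp
qed

section \<open>Directional derivatives of Ky Fan norms\<close>

lemma orth_entry_bound:
  assumes "orth n P" "i < n" "j < n"
  shows "\<bar>P i j\<bar> \<le> 1"
proof -
  have "P i j * P i j \<le> (\<Sum>l<n. P i l * P i l)" using assms by (intro member_le_sum) auto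
  then have "(P i j)\<^sup>2 \<le> 1" using orth_rows[OF assms(1,2,2)] by (simp add: power2_eq_square)
  then show ?thesis by (simp add: abs_square_le_1)
qed

lemma orth_limit:
  assumes "\<And>p. orth n (P p)" "\<And>i j. i < n \<Longrightarrow> j < n \<Longrightarrow> (\<lambda>p. P p i j) \<longlonglongrightarrow> L i j"
  shows "orth n L"
proof (rule orthI_cols)
  fix i j assume ij: "i < n" "j < n"
  have "(\<lambda>p. \<Sum>l<n. P p l i * P p l j) \<longlonglongrightarrow> (\<Sum>l<n. L l i * L l j)"
    using assms(2) ij by (intro tendsto_intros) auto
  moreover have "(\<lambda>p. \<Sum>l<n. P p l i * P p l j) = (\<lambda>p. if i = j then 1 else 0)"
    using orth_cols[OF assms(1) ij] by (intro ext) simp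
  ultimately have "(\<lambda>p. if i = j then 1 else 0) \<longlonglongrightarrow> (\<Sum>l<n. L l i * L l j)" by (simp only:)
  then show "(\<Sum>l<n. L l i * L l j) = (if i = j then 1 else 0)" unfolding LIMSEQ_const_iff by simp
qed

lemma norming_leading_trace:
  assumes "1 \<le> k" "k \<le> m" "m \<le> n" "orth m P" "orth n Q" "leading_trace k m n P Q x = ky_fan k m n x"
  shows "norming k m n (\<lambda>i j. \<Sum>l<k. P i l * Q j l) x"
  using ky_fan_inequality[OF assms(1-5)] assms(6) by (simp add: norming_def leading_trace_frobenius)

text \<open>Danskin's theorem for the family of functionals of \<open>ky_fan_inequality\<close>. Maximizers at \<open>x + t h\<close> for
\<open>t \<down> 0\<close> have a limit point \<open>(P, Q)\<close>, which is active at \<open>x\<close>. Every subgradient is below the difference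
quotients \<open>q t\<close>, the maximizer at \<open>x + t h\<close> is above \<open>q t\<close>, and \<open>q\<close> is monotone by convexity; so \<open>q t\<close>
tends to the value of the functional of \<open>(P, Q)\<close> at \<open>h\<close>.\<close>

theorem ky_fan_directional_derivative:
  assumes k: "1 \<le> k" "k \<le> m" and mn: "m \<le> n"
  obtains P Q where "orth m P" "orth n Q" "leading_trace k m n P Q x = ky_fan k m n x"
    "((\<lambda>t. (ky_fan k m n (\<lambda>i j. x i j + t * h i j) - ky_fan k m n x) / t) \<longlongrightarrow> leading_trace k m n P Q h) (at_right 0)"
    "\<And>s. norming k m n s x \<Longrightarrow> frobenius m n s h \<le> leading_trace k m n P Q h"
proof -
  define \<phi> where "\<phi> = (\<lambda>t. ky_fan k m n (\<lambda>i j. x i j + t * h i j))"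
  define q where "q = (\<lambda>t. (\<phi> t - ky_fan k m n x) / t)"
  have lower: "frobenius m n s h \<le> q t" if "norming k m n s x" "t > 0" for s t
  proof -
    have "frobenius m n s x + t * frobenius m n s h \<le> \<phi> t"
      using that(1) unfolding frobenius_add_right[symmetric] \<phi>_def norming_def by blast
    then show ?thesis using that by (simp add: q_def norming_def field_simps)
  qed
  have mono: "q t \<le> q t'" if "0 < t" "t \<le> t'" for t t'
  proof -
    obtain P Q where P: "orth m P" and Q: "orth n Q" and
      a: "leading_trace k m n P Q (\<lambda>i j. x i j + t * h i j) = \<phi> t"
      unfolding \<phi>_def by (rule ky_fan_attained[OF k(2) mn])
    define g where "g = leading_trace k m n P Q h"
    have a': "\<phi> t = leading_trace k m n P Q x + t * g" using a by (simp add: leading_trace_add_right g_def)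
    have "leading_trace k m n P Q x \<le> ky_fan k m n x" by (rule ky_fan_inequality[OF k mn P Q])
    then have qg: "q t \<le> g" using a' that by (simp add: q_def field_simps)
    have "leading_trace k m n P Q x + t' * g \<le> \<phi> t'"
      using ky_fan_inequality[OF k mn P Q, of "\<lambda>i j. x i j + t' * h i j"]
      by (simp add: leading_trace_add_right g_def \<phi>_def)
    then have "\<phi> t + (t' - t) * g \<le> \<phi> t'" using a' by (simp add: algebra_simps)
    moreover have "(t' - t) * q t \<le> (t' - t) * g" using qg that by (intro mult_left_mono) auto
    moreover have "\<phi> t = ky_fan k m n x + t * q t" using that by (simp add: q_def)
    ultimately have "t' * q t \<le> \<phi> t' - ky_fan k m n x" by (simp add: algebra_simps)
    then show ?thesis using that by (simp add: q_def[of ] le_divide_eq mult.commute)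
  qed
  define \<tau> where "\<tau> = (\<lambda>p. inverse (real (Suc p)))"
  have "\<exists>P Q. orth m P \<and> orth n Q \<and> leading_trace k m n P Q (\<lambda>i j. x i j + \<tau> p * h i j) = \<phi> (\<tau> p)" for p
    unfolding \<phi>_def by (rule ky_fan_attained[OF k(2) mn, of "\<lambda>i j. x i j + \<tau> p * h i j"]) blast
  then obtain P Q where P: "\<And>p. orth m (P p)" and Q: "\<And>p. orth n (Q p)"
    and PQ: "\<And>p. leading_trace k m n (P p) (Q p) (\<lambda>i j. x i j + \<tau> p * h i j) = \<phi> (\<tau> p)" by metis
  define f where "f = (\<lambda>p (b, i, j). if b then P p i j else Q p i j)"
  define I where "I = {True} \<times> {..<m} \<times> {..<m} \<union> {False} \<times> {..<n} \<times> {..<n}"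
  have "\<exists>\<rho> l. strict_mono \<rho> \<and> (\<forall>i\<in>I. (\<lambda>p. f (\<rho> p) i) \<longlonglongrightarrow> l i)"
  proof (rule bounded_coordinates_convergent_subsequence[where C = 1])
    show "finite I" by (simp add: I_def)
    show "\<bar>f p i\<bar> \<le> 1" if "i \<in> I" for p i
      using that orth_entry_bound[OF P] orth_entry_bound[OF Q] by (auto simp: I_def f_def)
  qed
  then obtain \<rho> l where \<rho>: "strict_mono \<rho>" and l: "\<And>i. i \<in> I \<Longrightarrow> (\<lambda>p. f (\<rho> p) i) \<longlonglongrightarrow> l i"
    by auto
  define P' where "P' = (\<lambda>i j. l (True, i, j))"
  define Q' where "Q' = (\<lambda>i j. l (False, i, j))"
  have Pl: "(\<lambda>p. P (\<rho> p) i j) \<longlonglongrightarrow> P' i j" if "i < m" "j < m" for i j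
    using l[of "(True, i, j)"] that by (simp add: I_def f_def P'_def)
  have Ql: "(\<lambda>p. Q (\<rho> p) i j) \<longlonglongrightarrow> Q' i j" if "i < n" "j < n" for i j
    using l[of "(False, i, j)"] that by (simp add: I_def f_def Q'_def)
  have P': "orth m P'" using P Pl by (rule orth_limit)
  have Q': "orth n Q'" using Q Ql by (rule orth_limit)
  have gl: "(\<lambda>p. leading_trace k m n (P (\<rho> p)) (Q (\<rho> p)) z) \<longlonglongrightarrow> leading_trace k m n P' Q' z" for z
    unfolding leading_trace_def using Pl Ql k mn by (intro tendsto_intros) auto
  have \<tau>l: "(\<lambda>p. \<tau> (\<rho> p)) \<longlonglongrightarrow> 0"
    using LIMSEQ_subseq_LIMSEQ[OF LIMSEQ_inverse_real_of_nat \<rho>] by (simp add: \<tau>_def o_def)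
  have \<tau>0: "\<tau> p > 0" for p by (simp add: \<tau>_def)
  have act: "leading_trace k m n P' Q' x = ky_fan k m n x"
  proof (rule antisym)
    show "leading_trace k m n P' Q' x \<le> ky_fan k m n x" by (rule ky_fan_inequality[OF k mn P' Q'])
    obtain P0 Q0 where P0: "orth m P0" "orth n Q0" "leading_trace k m n P0 Q0 x = ky_fan k m n x"
      by (rule ky_fan_attained[OF k(2) mn])
    have "ky_fan k m n x + \<tau> (\<rho> p) * leading_trace k m n P0 Q0 h \<le>
        leading_trace k m n (P (\<rho> p)) (Q (\<rho> p)) x + \<tau> (\<rho> p) * leading_trace k m n (P (\<rho> p)) (Q (\<rho> p)) h" for p
      using ky_fan_inequality[OF k mn P0(1,2), of "\<lambda>i j. x i j + \<tau> (\<rho> p) * h i j"] PQ[of "\<rho> p"] P0(3)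
      by (simp add: leading_trace_add_right \<phi>_def)
    moreover have "(\<lambda>p. ky_fan k m n x + \<tau> (\<rho> p) * leading_trace k m n P0 Q0 h)
      \<longlonglongrightarrow> ky_fan k m n x + 0 * leading_trace k m n P0 Q0 h"
      using \<tau>l by (intro tendsto_intros)
    moreover have "(\<lambda>p. leading_trace k m n (P (\<rho> p)) (Q (\<rho> p)) x + \<tau> (\<rho> p) * leading_trace k m n (P (\<rho> p)) (Q (\<rho> p)) h)
        \<longlonglongrightarrow> leading_trace k m n P' Q' x + 0 * leading_trace k m n P' Q' h"
      using \<tau>l gl by (intro tendsto_intros)
    ultimately have "ky_fan k m n x + 0 * leading_trace k m n P0 Q0 h
        \<le> leading_trace k m n P' Q' x + 0 * leading_trace k m n P' Q' h"
      by (intro LIMSEQ_le) auto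
    then show "ky_fan k m n x \<le> leading_trace k m n P' Q' x" by simp
  qed
  define D where "D = leading_trace k m n P' Q' h"
  have qD: "D \<le> q t" if "t > 0" for t
    using lower[OF norming_leading_trace[OF k mn P' Q' act] that] by (simp add: D_def leading_trace_frobenius)
  have qu: "q (\<tau> p) \<le> leading_trace k m n (P p) (Q p) h" for p
    using PQ[of p] ky_fan_inequality[OF k mn P[of p] Q[of p], of x] \<tau>0[of p]
    by (simp add: q_def leading_trace_add_right field_simps)
  have lim: "(q \<longlongrightarrow> D) (at_right 0)"
  proof (rule tendstoI)
    fix e :: real assume e: "e > 0"
    have "eventually (\<lambda>p. leading_trace k m n (P (\<rho> p)) (Q (\<rho> p)) h < D + e) sequentially"
      using order_tendstoD(2)[OF gl[of h], of "D + e"] e by (simp add: D_def)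
    then obtain p where p: "leading_trace k m n (P (\<rho> p)) (Q (\<rho> p)) h < D + e"
      by (meson eventually_happens' sequentially_bot)
    have "dist (q t) D < e" if "0 < t" "t < \<tau> (\<rho> p)" for t
      using mono[of t "\<tau> (\<rho> p)"] qu[of "\<rho> p"] p qD[of t] that by (simp add: dist_real_def)
    then show "eventually (\<lambda>t. dist (q t) D < e) (at_right 0)"
      using \<tau>0[of "\<rho> p"] unfolding eventually_at_right_field by blast
  qed
  have "frobenius m n s h \<le> D" if "norming k m n s x" for s
  proof (rule tendsto_lowerbound[OF lim])
    show "eventually (\<lambda>t. frobenius m n s h \<le> q t) (at_right 0)"
      using lower[OF that] by (auto simp: eventually_at_right_field intro: exI[of _ 1])
  qed simp
  then show thesis
    using that[OF P' Q' act] lim by (simp add: q_def \<phi>_def D_def)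
qed

section \<open>Rigidity of maximizing blocks\<close>

lemma sum_zero_imp_term_zero:
  fixes f :: "'a \<Rightarrow> real"
  assumes "sum f A = 0" "finite A" "\<And>i. i \<in> A \<Longrightarrow> 0 \<le> f i" "i \<in> A"
  shows "f i = 0"
  using assms by (simp add: sum_nonneg_eq_0_iff)

lemma bessel:
  assumes "orth n Q" "N \<le> n"
  shows "(\<Sum>l<N. (\<Sum>j<n. Q j l * q j)\<^sup>2) \<le> (\<Sum>j<n. (q j)\<^sup>2)"
proof -
  have "(\<Sum>l<N. (\<Sum>j<n. Q j l * q j)\<^sup>2) \<le> (\<Sum>l<n. (\<Sum>j<n. Q j l * q j)\<^sup>2)"
    using assms(2) by (intro sum_mono2) auto
  also have "\<dots> = (\<Sum>j<n. (q j)\<^sup>2)"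
    using orth_parseval[OF assms(1), of q q] by (simp add: power2_eq_square)
  finally show ?thesis .
qed

lemma mult_le_half_squares: "a * b \<le> (a\<^sup>2 + b\<^sup>2) / 2" for a b :: real
  using zero_le_power2[of "a - b"] by (simp add: power2_diff)

text \<open>A matrix with singular values at most \<open>\<tau>\<close>, by \<open>2 a b \<le> a\<^sup>2 + b\<^sup>2\<close> and Bessel's inequality.\<close>

lemma bilinear_form_bound:
  fixes t :: "nat \<Rightarrow> real"
  assumes P: "orth N P" and Q: "orth N' Q" and NN: "N \<le> N'"
    and t: "\<And>l. l < N \<Longrightarrow> 0 \<le> t l" "\<And>l. l < N \<Longrightarrow> t l \<le> \<tau>" and tau: "0 \<le> \<tau>"
  shows "(\<Sum>i<N. \<Sum>j<N'. p i * (\<Sum>l<N. t l * P i l * Q j l) * q j)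
    \<le> \<tau> * ((\<Sum>i<N. (p i)\<^sup>2) + (\<Sum>j<N'. (q j)\<^sup>2)) / 2"
proof -
  define a where "a = (\<lambda>l. \<Sum>i<N. P i l * p i)"
  define b where "b = (\<lambda>l. \<Sum>j<N'. Q j l * q j)"
  have "(\<Sum>l<N. t l * a l * b l) \<le> (\<Sum>l<N. \<tau> * (((a l)\<^sup>2 + (b l)\<^sup>2) / 2))"
  proof (rule sum_mono)
    fix l assume l: "l \<in> {..<N}"
    have "t l * (a l * b l) \<le> t l * (((a l)\<^sup>2 + (b l)\<^sup>2) / 2)"
      using t l mult_le_half_squares by (intro mult_left_mono) auto
    also have "\<dots> \<le> \<tau> * (((a l)\<^sup>2 + (b l)\<^sup>2) / 2)"
      using t l by (intro mult_right_mono) auto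
    finally show "t l * a l * b l \<le> \<tau> * (((a l)\<^sup>2 + (b l)\<^sup>2) / 2)" by (simp add: mult.assoc)
  qed
  also have "\<dots> = \<tau> * ((\<Sum>l<N. (a l)\<^sup>2) + (\<Sum>l<N. (b l)\<^sup>2)) / 2"
    by (simp add: sum_distrib_left sum.distrib[symmetric] sum_divide_distrib)
  also have "\<dots> \<le> \<tau> * ((\<Sum>i<N. (p i)\<^sup>2) + (\<Sum>j<N'. (q j)\<^sup>2)) / 2"
    unfolding a_def b_def
    using bessel[OF P order_refl, of p] bessel[OF Q NN, of q] tau
    by (intro divide_right_mono mult_left_mono add_mono) auto
  finally show ?thesis unfolding bilinear_svd_expand a_def b_def .
qed

text \<open>The weights \<open>c l = \<Sum>i. s i * P i l * Q i l\<close> in \<open>\<Sum>i. s i * B i i = \<Sum>l. \<mu> l * c l\<close> are dominated by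
\<open>d l\<close>, the average of the \<open>s\<close>-weighted squared lengths of the \<open>l\<close>-th singular vectors. The hypothesis is
equality in \<open>threshold_weights\<close>, so with \<open>\<tau> = \<mu> (r - 1)\<close>: where \<open>\<mu> l > \<tau>\<close>, \<open>d l = 1\<close> confines both singular
vectors to \<open>s = 1\<close>; where \<open>\<mu> l < \<tau>\<close>, \<open>d l = 0\<close> confines them to \<open>s = 0\<close>; where \<open>\<mu> l > 0\<close>, \<open>c l = d l\<close>
makes them agree on \<open>s > 0\<close>. Cutting the singular values off at \<open>\<tau>\<close> splits \<open>B\<close> into \<open>E + C\<close>: \<open>E\<close> is
positive semidefinite and supported on \<open>s = 1\<close>, and \<open>C\<close> has singular values at most \<open>\<tau>\<close> and
coincides with \<open>\<tau> I\<close> in all rows and columns with \<open>s > 0\<close>.\<close>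

theorem block_structure_of_maximizer:
  assumes NN: "N \<le> N'" and r: "1 \<le> r" "r \<le> N" and svd: "is_svd N N' B \<mu> P Q"
    and s01: "\<forall>i<N. 0 \<le> s i \<and> s i \<le> 1"
    and ssum: "(\<Sum>i<N. s i) \<le> real r"
    and opt: "(\<Sum>l<r. \<mu> l) \<le> (\<Sum>i<N. s i * B i i)"
  defines "\<tau> \<equiv> \<mu> (r - 1)"
  shows "0 \<le> \<tau>" and "\<tau> * (real r - (\<Sum>i<N. s i)) = 0"
    and "\<And>i j. i < N \<Longrightarrow> j < N' \<Longrightarrow> 0 < s i \<Longrightarrow> \<not> (s i = 1 \<and> j < N \<and> s j = 1) \<Longrightarrow>
       B i j = (if i = j then \<tau> else 0)"
    and "\<And>i j. i < N \<Longrightarrow> j < N \<Longrightarrow> 0 < s j \<Longrightarrow> \<not> (s i = 1 \<and> s j = 1) \<Longrightarrow>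
       B i j = (if i = j then \<tau> else 0)"
    and "\<And>i j. i < N \<Longrightarrow> j < N \<Longrightarrow> s i = 1 \<Longrightarrow> s j = 1 \<Longrightarrow> B i j = B j i"
    and "\<And>v. (\<And>i. i < N \<Longrightarrow> s i \<noteq> 1 \<Longrightarrow> v i = 0) \<Longrightarrow>
       \<tau> * (\<Sum>i<N. (v i)\<^sup>2) \<le> (\<Sum>i<N. \<Sum>j<N. v i * B i j * v j)"
    and "\<And>p q. (\<And>i. i < N \<Longrightarrow> s i \<noteq> 0 \<Longrightarrow> p i = 0) \<Longrightarrow> (\<And>j. j < N \<Longrightarrow> s j \<noteq> 0 \<Longrightarrow> q j = 0) \<Longrightarrow>
       (\<Sum>i<N. \<Sum>j<N'. p i * B i j * q j) \<le> \<tau> * ((\<Sum>i<N. (p i)\<^sup>2) + (\<Sum>j<N'. (q j)\<^sup>2)) / 2"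
proof -
  have s0: "\<And>i. i < N \<Longrightarrow> 0 \<le> s i" and s1: "\<And>i. i < N \<Longrightarrow> s i \<le> 1" using s01 by auto
  note S = is_svdD[OF svd]
  define c where "c = (\<lambda>l. \<Sum>i<N. s i * (P i l * Q i l))"
  define d where "d = (\<lambda>l. \<Sum>i<N. s i * (((P i l)\<^sup>2 + (Q i l)\<^sup>2) / 2))"
  have colP: "(\<Sum>i<N. (P i l)\<^sup>2) = 1" if "l < N" for l
    using orth_cols[OF S(1) that that] by (simp add: power2_eq_square)
  have colQ: "(\<Sum>i<N'. (Q i l)\<^sup>2) = 1" if "l < N'" for l
    using orth_cols[OF S(2) that that] by (simp add: power2_eq_square)
  have rowP: "(\<Sum>l<N. (P i l)\<^sup>2) = 1" if "i < N" for i
    using orth_rows[OF S(1) that that] by (simp add: power2_eq_square)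
  have rowQ: "(\<Sum>l<N'. (Q i l)\<^sup>2) = 1" if "i < N'" for i
    using orth_rows[OF S(2) that that] by (simp add: power2_eq_square)
  have colQ': "(\<Sum>i<N. (Q i l)\<^sup>2) \<le> 1" if "l < N'" for l
    unfolding colQ[OF that, symmetric] using NN by (intro sum_mono2) auto
  have rowQ': "(\<Sum>l<N. (Q i l)\<^sup>2) \<le> 1" if "i < N'" for i
    unfolding rowQ[OF that, symmetric] using NN by (intro sum_mono2) auto
  have cd: "c l \<le> d l" for l
    unfolding c_def d_def using s0 mult_le_half_squares by (intro sum_mono mult_left_mono) auto
  have d0: "0 \<le> d l" for l unfolding d_def using s0 by (intro sum_nonneg) auto
  have d1: "d l \<le> 1" if "l < N" for l
  proof -
    have "d l \<le> (\<Sum>i<N. 1 * (((P i l)\<^sup>2 + (Q i l)\<^sup>2) / 2))"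
      unfolding d_def using s1 by (intro sum_mono mult_right_mono) auto
    also have "\<dots> = ((\<Sum>i<N. (P i l)\<^sup>2) + (\<Sum>i<N. (Q i l)\<^sup>2)) / 2"
      by (simp add: sum_divide_distrib sum.distrib[symmetric])
    also have "\<dots> \<le> 1" using colP[OF that] colQ'[of l] that NN by simp
    finally show ?thesis .
  qed
  have dsum: "(\<Sum>l<N. d l) \<le> (\<Sum>i<N. s i)"
  proof -
    have "(\<Sum>l<N. d l) = (\<Sum>i<N. s i * (((\<Sum>l<N. (P i l)\<^sup>2) + (\<Sum>l<N. (Q i l)\<^sup>2)) / 2))"
      unfolding d_def by (subst sum.swap) (simp add: sum_distrib_left sum_divide_distrib sum.distrib[symmetric])
    also have "\<dots> \<le> (\<Sum>i<N. s i * 1)"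
    proof (intro sum_mono mult_left_mono)
      fix i assume "i \<in> {..<N}"
      then show "((\<Sum>l<N. (P i l)\<^sup>2) + (\<Sum>l<N. (Q i l)\<^sup>2)) / 2 \<le> 1" "0 \<le> s i"
        using rowP[of i] rowQ'[of i] NN s0 by auto
    qed
    finally show ?thesis by simp
  qed
  have dsum': "(\<Sum>l<N. d l) \<le> real r" using dsum ssum by linarith
  have "(\<Sum>i<N. s i * B i i) = (\<Sum>i<N. \<Sum>l<N. \<mu> l * (s i * (P i l * Q i l)))"
    using S(3) NN by (intro sum.cong) (auto simp: sum_distrib_left mult_ac)
  also have "\<dots> = (\<Sum>l<N. \<mu> l * c l)"
    by (subst sum.swap) (simp add: c_def sum_distrib_left)
  finally have opt': "(\<Sum>l<r. \<mu> l) \<le> (\<Sum>l<N. \<mu> l * c l)" using opt by simp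
  note T = threshold_weights[where y = \<mu> and c = c and d = d and r = r and N = N, OF r _ _ _ _ _ dsum']
  have top: "d l = 1" if "l < N" "\<mu> l > \<tau>" for l
    by (rule T(2)[OF _ _ _ _ _ opt']) (use S(4,5) cd d0 d1 that in \<open>auto simp: \<tau>_def\<close>)
  have bot: "d l = 0" if "l < N" "\<mu> l < \<tau>" for l
    by (rule T(3)[OF _ _ _ _ _ opt']) (use S(4,5) cd d0 d1 that in \<open>auto simp: \<tau>_def\<close>)
  have pos: "c l = d l" if "l < N" "\<mu> l > 0" for l
    by (rule T(4)[OF _ _ _ _ _ opt']) (use S(4,5) cd d0 d1 that in auto)
  have slack: "\<tau> * (real r - (\<Sum>l<N. d l)) = 0"
    unfolding \<tau>_def by (rule T(5)[OF _ _ _ _ _ opt']) (use S(4,5) cd d0 d1 in auto)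
  show tau0: "0 \<le> \<tau>" unfolding \<tau>_def using S(4) r by simp
  show "\<tau> * (real r - (\<Sum>i<N. s i)) = 0"
  proof (rule antisym)
    show "\<tau> * (real r - (\<Sum>i<N. s i)) \<le> 0"
      unfolding slack[symmetric] using dsum tau0 by (intro mult_left_mono) auto
    show "0 \<le> \<tau> * (real r - (\<Sum>i<N. s i))" using ssum tau0 by simp
  qed
  have eqPQ: "P i l = Q i l" if "l < N" "\<mu> l > 0" "i < N" "s i > 0" for i l
  proof -
    have nn: "0 \<le> s i * (P i l - Q i l)\<^sup>2 / 2" if "i < N" for i using s0[OF that] by simp
    have "(\<Sum>i<N. s i * (P i l - Q i l)\<^sup>2 / 2) = d l - c l"
      unfolding d_def c_def sum_subtractf[symmetric]
      by (intro sum.cong) (auto simp: power2_diff field_simps)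
    then have "(\<Sum>i<N. s i * (P i l - Q i l)\<^sup>2 / 2) = 0" using pos that by simp
    then have "s i * (P i l - Q i l)\<^sup>2 / 2 = 0"
      by (rule sum_zero_imp_term_zero) (use nn that in auto)
    then show ?thesis using that by simp
  qed
  have botPQ: "P i l = 0 \<and> Q i l = 0" if "l < N" "\<mu> l < \<tau>" "i < N" "s i > 0" for i l
  proof -
    have nn: "0 \<le> s i * (((P i l)\<^sup>2 + (Q i l)\<^sup>2) / 2)" if "i < N" for i using s0[OF that] by simp
    have "s i * (((P i l)\<^sup>2 + (Q i l)\<^sup>2) / 2) = 0"
      by (rule sum_zero_imp_term_zero[OF bot[OF that(1,2), unfolded d_def]]) (use nn that in auto)
    then show ?thesis using that(4) by (simp add: add_nonneg_eq_0_iff)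
  qed
  have main: "(\<Sum>i<N. (1 - s i) * ((P i l)\<^sup>2 + (Q i l)\<^sup>2)) + (\<Sum>j\<in>{N..<N'}. (Q j l)\<^sup>2) = 0"
    if l: "l < N" "\<mu> l > \<tau>" for l
  proof -
    have "(\<Sum>i<N. (1 - s i) * ((P i l)\<^sup>2 + (Q i l)\<^sup>2)) =
        (\<Sum>i<N. (P i l)\<^sup>2) + (\<Sum>i<N. (Q i l)\<^sup>2) - 2 * d l"
      unfolding d_def sum_distrib_left sum.distrib[symmetric] sum_subtractf[symmetric]
      by (intro sum.cong) (auto simp: algebra_simps)
    moreover have "(\<Sum>i<N. (Q i l)\<^sup>2) + (\<Sum>j\<in>{N..<N'}. (Q j l)\<^sup>2) = (\<Sum>i<N'. (Q i l)\<^sup>2)"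
      using sum.atLeastLessThan_concat[of 0 N N' "\<lambda>i. (Q i l)\<^sup>2"] NN
      by (simp add: atLeast0LessThan)
    ultimately show ?thesis using top[OF l] colP[OF l(1)] colQ[of l] l NN by simp
  qed
  have nn: "0 \<le> (1 - s i) * ((P i l)\<^sup>2 + (Q i l)\<^sup>2)" if "i < N" for i l
    using s1[OF that] by simp
  have Az: "(\<Sum>i<N. (1 - s i) * ((P i l)\<^sup>2 + (Q i l)\<^sup>2)) = 0" and Bz: "(\<Sum>j\<in>{N..<N'}. (Q j l)\<^sup>2) = 0"
    if l: "l < N" "\<mu> l > \<tau>" for l
  proof -
    have "0 \<le> (\<Sum>i<N. (1 - s i) * ((P i l)\<^sup>2 + (Q i l)\<^sup>2))" using nn by (intro sum_nonneg) auto
    moreover have "0 \<le> (\<Sum>j\<in>{N..<N'}. (Q j l)\<^sup>2)" by (intro sum_nonneg) auto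
    ultimately show "(\<Sum>i<N. (1 - s i) * ((P i l)\<^sup>2 + (Q i l)\<^sup>2)) = 0" "(\<Sum>j\<in>{N..<N'}. (Q j l)\<^sup>2) = 0"
      using main[OF l] by linarith+
  qed
  have PQ: "P i l = 0 \<and> Q i l = 0" if l: "l < N" "\<mu> l > \<tau>" and i: "i < N" "s i \<noteq> 1" for i l
  proof -
    have "(1 - s i) * ((P i l)\<^sup>2 + (Q i l)\<^sup>2) = 0"
      by (rule sum_zero_imp_term_zero[OF Az[OF l]]) (use nn i in auto)
    then show ?thesis using i by (simp add: add_nonneg_eq_0_iff)
  qed
  have topP: "P i l = 0" if "l < N" "\<mu> l > \<tau>" "i < N" "s i \<noteq> 1" for i l using PQ that by blast
  have topQ: "Q j l = 0" if l: "l < N" "\<mu> l > \<tau>" and j: "j < N'" "\<not> (j < N \<and> s j = 1)" for j l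
  proof (cases "j < N")
    case False
    have "(Q j l)\<^sup>2 = 0" by (rule sum_zero_imp_term_zero[OF Bz[OF l]]) (use False j in auto)
    then show ?thesis by simp
  qed (use PQ l j in blast)
  \<comment> \<open>The singular values, cut off at \<open>\<tau>\<close>; \<open>E\<close> collects the excess.\<close>
  define t where "t = (\<lambda>l. min (\<mu> l) \<tau>)"
  define C where "C = (\<lambda>i j. \<Sum>l<N. t l * P i l * Q j l)"
  define E where "E = (\<lambda>i j. \<Sum>l<N. (\<mu> l - t l) * P i l * Q j l)"
  have BE: "B i j = E i j + C i j" if "i < N" "j < N'" for i j
    unfolding S(3)[OF that] E_def C_def sum.distrib[symmetric]
    by (intro sum.cong) (auto simp: algebra_simps)
  have E0: "E i j = 0" if "i < N" "j < N'" "\<not> (s i = 1 \<and> j < N \<and> s j = 1)" for i j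
    unfolding E_def
  proof (intro sum.neutral ballI)
    fix l assume "l \<in> {..<N}"
    then show "(\<mu> l - t l) * P i l * Q j l = 0"
      using topP[of l i] topQ[of l j] that by (cases "\<mu> l > \<tau>") (auto simp: t_def)
  qed
  have EP: "E i j = (\<Sum>l<N. (\<mu> l - t l) * P i l * P j l)" if "i < N" "j < N" for i j
    unfolding E_def
  proof (intro sum.cong refl)
    fix l assume l: "l \<in> {..<N}"
    show "(\<mu> l - t l) * P i l * Q j l = (\<mu> l - t l) * P i l * P j l"
    proof (cases "\<mu> l > \<tau>")
      case True
      then have "P j l = Q j l"
        using topP[of l j] topQ[of l j] eqPQ[of l j] l that tau0 NN by (cases "s j = 1") auto
      then show ?thesis by simp
    qed (simp add: t_def)
  qed
  have tQ: "t l * P i l = \<tau> * Q i l \<and> t l * Q i l = \<tau> * P i l" if "0 < \<tau>" "l < N" "i < N" "s i > 0" for i l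
  proof (cases "\<mu> l < \<tau>")
    case True
    then show ?thesis using botPQ[OF that(2) True that(3,4)] by simp
  next
    case False
    then show ?thesis using eqPQ[OF that(2) _ that(3,4)] that(1) by (simp add: t_def)
  qed
  have Cz: "C i j = 0" if "\<tau> = 0" for i j
  proof -
    have "t l = 0" if "l < N" for l using S(4)[OF that] \<open>\<tau> = 0\<close> by (simp add: t_def)
    then show ?thesis by (simp add: C_def)
  qed
  have Crow: "C i j = (if i = j then \<tau> else 0)" if ij: "i < N" "j < N'" "s i > 0" for i j
  proof (cases "\<tau> = 0")
    case False
    then have tp: "\<tau> > 0" using tau0 by simp
    have eq: "Q i l = P i l" if "l < N" for l
      using tQ[OF tp that ij(1,3)] eqPQ[OF that _ ij(1,3)] botPQ[OF that _ ij(1,3)] tp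
      by (cases "\<mu> l < \<tau>") auto
    have "(\<Sum>l\<in>{N..<N'}. (Q i l)\<^sup>2) = 0"
    proof -
      have "(\<Sum>l<N. (Q i l)\<^sup>2) = 1" using eq rowP[OF ij(1)] by simp
      moreover have "(\<Sum>l<N. (Q i l)\<^sup>2) + (\<Sum>l\<in>{N..<N'}. (Q i l)\<^sup>2) = (\<Sum>l<N'. (Q i l)\<^sup>2)"
        using sum.atLeastLessThan_concat[of 0 N N' "\<lambda>l. (Q i l)\<^sup>2"] NN by (simp add: atLeast0LessThan)
      ultimately show ?thesis using rowQ[of i] ij(1) NN by simp
    qed
    then have "(Q i l)\<^sup>2 = 0" if "N \<le> l" "l < N'" for l
      by (rule sum_zero_imp_term_zero) (use that in auto)
    then have far: "Q i l = 0" if "N \<le> l" "l < N'" for l using that by simp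
    have "C i j = \<tau> * (\<Sum>l<N. Q i l * Q j l)"
      unfolding C_def sum_distrib_left using tQ[OF tp _ ij(1,3)] by (intro sum.cong) auto
    also have "(\<Sum>l<N. Q i l * Q j l) = (\<Sum>l<N'. Q i l * Q j l)"
      using far NN by (intro sum.mono_neutral_left) auto
    also have "\<dots> = (if i = j then 1 else 0)" using orth_rows[OF S(2)] ij NN by simp
    finally show ?thesis by simp
  qed (simp add: Cz)
  have Ccol: "C i j = (if i = j then \<tau> else 0)" if ij: "i < N" "j < N" "s j > 0" for i j
  proof (cases "\<tau> = 0")
    case False
    then have tp: "\<tau> > 0" using tau0 by simp
    have "C i j = (\<Sum>l<N. P i l * (t l * Q j l))" unfolding C_def by (simp add: mult_ac)
    also have "\<dots> = (\<Sum>l<N. P i l * (\<tau> * P j l))" using tQ[OF tp _ ij(2,3)] by (intro sum.cong) auto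
    also have "\<dots> = \<tau> * (\<Sum>l<N. P i l * P j l)" by (simp add: sum_distrib_left mult_ac)
    also have "\<dots> = (if i = j then \<tau> else 0)" using orth_rows[OF S(1)] ij by simp
    finally show ?thesis .
  qed (simp add: Cz)
  show "B i j = (if i = j then \<tau> else 0)"
    if "i < N" "j < N'" "0 < s i" "\<not> (s i = 1 \<and> j < N \<and> s j = 1)" for i j
    using BE[OF that(1,2)] E0[OF that(1,2,4)] Crow[OF that(1,2,3)] by simp
  show "B i j = (if i = j then \<tau> else 0)"
    if "i < N" "j < N" "0 < s j" "\<not> (s i = 1 \<and> s j = 1)" for i j
    using BE[of i j] E0[of i j] Ccol[OF that(1,2,3)] that NN by simp
  show "B i j = B j i" if "i < N" "j < N" "s i = 1" "s j = 1" for i j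
    using BE[of i j] BE[of j i] EP[of i j] EP[of j i] Crow[of i j] Crow[of j i] that NN by (simp add: mult_ac)
  show "\<tau> * (\<Sum>i<N. (v i)\<^sup>2) \<le> (\<Sum>i<N. \<Sum>j<N. v i * B i j * v j)"
    if v: "\<And>i. i < N \<Longrightarrow> s i \<noteq> 1 \<Longrightarrow> v i = 0" for v
  proof -
    have "(\<Sum>i<N. \<Sum>j<N. v i * B i j * v j) =
      (\<Sum>i<N. \<Sum>j<N. v i * (\<Sum>l<N. (\<mu> l - t l) * P i l * P j l) * v j) + (\<Sum>i<N. \<Sum>j<N. if j = i then \<tau> * (v i)\<^sup>2 else 0)"
      unfolding sum.distrib[symmetric]
    proof (intro sum.cong refl)
      fix i j assume "i \<in> {..<N}" "j \<in> {..<N}"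
      then have ij: "i < N" "j < N" "j < N'" using NN by auto
      show "v i * B i j * v j
          = v i * (\<Sum>l<N. (\<mu> l - t l) * P i l * P j l) * v j + (if j = i then \<tau> * (v i)\<^sup>2 else 0)"
        using v[OF ij(1)] BE[OF ij(1,3)] Crow[OF ij(1,3)] EP[OF ij(1,2)]
        by (cases "s i = 1") (auto simp: algebra_simps power2_eq_square)
    qed
    also have "(\<Sum>i<N. \<Sum>j<N. v i * (\<Sum>l<N. (\<mu> l - t l) * P i l * P j l) * v j)
       = (\<Sum>l<N. (\<mu> l - t l) * (\<Sum>i<N. P i l * v i) * (\<Sum>i<N. P i l * v i))"
      by (rule bilinear_svd_expand)
    also have "(\<Sum>i<N. \<Sum>j<N. if j = i then \<tau> * (v i)\<^sup>2 else 0) = \<tau> * (\<Sum>i<N. (v i)\<^sup>2)"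
      by (simp add: sum_distrib_left)
    finally have "(\<Sum>i<N. \<Sum>j<N. v i * B i j * v j) =
      (\<Sum>l<N. (\<mu> l - t l) * (\<Sum>i<N. P i l * v i) * (\<Sum>i<N. P i l * v i)) + \<tau> * (\<Sum>i<N. (v i)\<^sup>2)" .
    moreover have "0 \<le> (\<mu> l - t l) * (\<Sum>i<N. P i l * v i) * (\<Sum>i<N. P i l * v i)" for l
      by (simp add: mult.assoc t_def)
    then have "0 \<le> (\<Sum>l<N. (\<mu> l - t l) * (\<Sum>i<N. P i l * v i) * (\<Sum>i<N. P i l * v i))"
      by (intro sum_nonneg)
    ultimately show ?thesis by linarith
  qed
  show "(\<Sum>i<N. \<Sum>j<N'. p i * B i j * q j) \<le> \<tau> * ((\<Sum>i<N. (p i)\<^sup>2) + (\<Sum>j<N'. (q j)\<^sup>2)) / 2"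
    if p: "\<And>i. i < N \<Longrightarrow> s i \<noteq> 0 \<Longrightarrow> p i = 0" and q: "\<And>j. j < N \<Longrightarrow> s j \<noteq> 0 \<Longrightarrow> q j = 0" for p q
  proof -
    have "(\<Sum>i<N. \<Sum>j<N'. p i * B i j * q j) = (\<Sum>i<N. \<Sum>j<N'. p i * C i j * q j)"
    proof (intro sum.cong refl)
      fix i j assume "i \<in> {..<N}" "j \<in> {..<N'}"
      then show "p i * B i j * q j = p i * C i j * q j"
        using BE[of i j] E0[of i j] p[of i] by (cases "s i = 1") auto
    qed
    also have "\<dots> \<le> \<tau> * ((\<Sum>i<N. (p i)\<^sup>2) + (\<Sum>j<N'. (q j)\<^sup>2)) / 2"
      unfolding C_def using S(4) tau0
      by (intro bilinear_form_bound[OF S(1,2) NN]) (auto simp: t_def)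
    finally show ?thesis .
  qed
qed

section \<open>Active functionals and their values\<close>

text \<open>\<open>k\<close> columns of an orthogonal matrix contribute at most what all of them contribute, namely the
trace.\<close>

lemma psd_trace_bound:
  assumes P: "orth m P" and k: "k \<le> m" and off: "k0 + n1 \<le> m"
    and psd: "\<And>v. 0 \<le> (\<Sum>i<n1. \<Sum>j<n1. v i * A i j * v j)"
  shows "(\<Sum>l<k. \<Sum>i<n1. \<Sum>j<n1. P (k0 + i) l * A i j * P (k0 + j) l) \<le> (\<Sum>i<n1. A i i)"
proof -
  have "(\<Sum>l<k. \<Sum>i<n1. \<Sum>j<n1. P (k0 + i) l * A i j * P (k0 + j) l)
      \<le> (\<Sum>l<m. \<Sum>i<n1. \<Sum>j<n1. P (k0 + i) l * A i j * P (k0 + j) l)"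
    using k psd[of "\<lambda>i. P (k0 + i) _"] by (intro sum_mono2) auto
  also have "\<dots> = (\<Sum>i<n1. \<Sum>l<m. \<Sum>j<n1. P (k0 + i) l * A i j * P (k0 + j) l)" by (rule sum.swap)
  also have "\<dots> = (\<Sum>i<n1. \<Sum>j<n1. \<Sum>l<m. P (k0 + i) l * A i j * P (k0 + j) l)"
    by (intro sum.cong sum.swap refl)
  also have "\<dots> = (\<Sum>i<n1. \<Sum>j<n1. A i j * (\<Sum>l<m. P (k0 + i) l * P (k0 + j) l))"
    by (simp add: sum_distrib_left mult_ac)
  also have "\<dots> = (\<Sum>i<n1. \<Sum>j<n1. if j = i then A i i else 0)"
    using orth_rows[OF P] off by (intro sum.cong refl) auto
  finally show ?thesis by simp
qed

text \<open>For a positive semidefinite form, \<open>2 a(p, q) \<le> a(p, p) + a(q, q)\<close>.\<close>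

lemma psd_mixed_trace_bound:
  assumes P: "orth m P" and Q: "orth n Q" and k: "k \<le> m" and mn: "m \<le> n" and off: "k0 + n1 \<le> m"
    and sym: "\<And>i j. i < n1 \<Longrightarrow> j < n1 \<Longrightarrow> A i j = A j i"
    and psd: "\<And>v. 0 \<le> (\<Sum>i<n1. \<Sum>j<n1. v i * A i j * v j)"
  shows "(\<Sum>l<k. \<Sum>i<n1. \<Sum>j<n1. P (k0 + i) l * A i j * Q (k0 + j) l) \<le> (\<Sum>i<n1. A i i)"
proof -
  have mix: "bilinear_form n1 A p q \<le> (bilinear_form n1 A p p + bilinear_form n1 A q q) / 2" for p q
  proof -
    have "0 \<le> bilinear_form n1 A (\<lambda>i. p i + - 1 * q i) (\<lambda>i. p i + - 1 * q i)"
      unfolding bilinear_form_def by (rule psd)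
    then show ?thesis
      unfolding bilinear_form_add_left bilinear_form_add_right bilinear_form_scale_left bilinear_form_scale_right
      using bilinear_form_swap[where A = A and x = p and y = q, OF sym] by simp
  qed
  have "(\<Sum>l<k. \<Sum>i<n1. \<Sum>j<n1. P (k0 + i) l * A i j * Q (k0 + j) l)
     \<le> (\<Sum>l<k. ((\<Sum>i<n1. \<Sum>j<n1. P (k0 + i) l * A i j * P (k0 + j) l) +
        (\<Sum>i<n1. \<Sum>j<n1. Q (k0 + i) l * A i j * Q (k0 + j) l)) / 2)"
    by (intro sum_mono) (rule mix[unfolded bilinear_form_def])
  also have "\<dots> = ((\<Sum>l<k. \<Sum>i<n1. \<Sum>j<n1. P (k0 + i) l * A i j * P (k0 + j) l) +
        (\<Sum>l<k. \<Sum>i<n1. \<Sum>j<n1. Q (k0 + i) l * A i j * Q (k0 + j) l)) / 2"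
    by (simp add: sum.distrib sum_divide_distrib add_divide_distrib)
  also have "\<dots> \<le> (\<Sum>i<n1. A i i)"
    using psd_trace_bound[OF P k off, of A] psd_trace_bound[OF Q, of k k0 n1 A] psd k mn off by simp
  finally show ?thesis .
qed

lemma sum_lessThan_split:
  fixes f :: "nat \<Rightarrow> 'a::comm_monoid_add"
  assumes "a \<le> n"
  shows "(\<Sum>i<n. f i) = (\<Sum>i<a. f i) + (\<Sum>i<n - a. f (a + i))"
proof -
  have "(\<Sum>i<n. f i) = (\<Sum>i<a. f i) + (\<Sum>i\<in>{a..<n}. f i)"
    using sum.atLeastLessThan_concat[of 0 a n f] assms by (simp add: atLeast0LessThan)
  also have "(\<Sum>i\<in>{a..<n}. f i) = (\<Sum>i<n - a. f (a + i))"
    by (rule sum.reindex_bij_witness[of _ "\<lambda>i. a + i" "\<lambda>i. i - a"]) (use assms in auto)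
  finally show ?thesis .
qed

text \<open>At a diagonal matrix with entries \<open>\<xi>\<close> an active functional attains equality in \<open>threshold_weights\<close> with
the weights of \<open>diagonal_weights\<close>. Rows with \<open>\<xi> e\<close> above the \<open>k\<close>-th entry have full mass and agree, rows
below it have no mass, and if the \<open>k\<close>-th entry is positive the whole mass \<open>k\<close> sits in the first \<open>m\<close>
rows, so that nothing is left for the extra columns.\<close>

lemma active_rows:
  assumes k: "1 \<le> k" "k \<le> m" and mn: "m \<le> n" and P: "orth m P" and Q: "orth n Q"
    and x: "\<And>i j. i < m \<Longrightarrow> j < n \<Longrightarrow> x i j = (if i = j then \<xi> i else 0)"
    and \<xi>: "\<And>i. i < m \<Longrightarrow> 0 \<le> \<xi> i" "\<And>i j. i \<le> j \<Longrightarrow> j < m \<Longrightarrow> \<xi> j \<le> \<xi> i"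
    and act: "leading_trace k m n P Q x = ky_fan k m n x"
  shows "\<And>e l. e < m \<Longrightarrow> l < k \<Longrightarrow> \<xi> e > \<xi> (k - 1) \<Longrightarrow> P e l = Q e l"
    and "\<And>e. e < m \<Longrightarrow> \<xi> e > \<xi> (k - 1) \<Longrightarrow> (\<Sum>l<k. (P e l)\<^sup>2) = 1"
    and "\<And>e l. e < m \<Longrightarrow> l < k \<Longrightarrow> \<xi> e < \<xi> (k - 1) \<Longrightarrow> P e l = 0 \<and> Q e l = 0"
    and "\<And>e l. e < m \<Longrightarrow> l < k \<Longrightarrow> \<xi> (k - 1) > 0 \<Longrightarrow> P e l = Q e l"
    and "\<And>j l. m \<le> j \<Longrightarrow> j < n \<Longrightarrow> l < k \<Longrightarrow> \<xi> (k - 1) > 0 \<Longrightarrow> Q j l = 0"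
proof -
  note svd = is_svd_diagonal[OF mn x \<xi>]
  define c where "c = (\<lambda>e. \<Sum>l<k. P e l * Q e l)"
  define d where "d = (\<lambda>e. (\<Sum>l<k. P e l * P e l + Q e l * Q e l) / 2)"
  note DW = diagonal_weights[OF P Q k(2) mn]
  have W: "\<And>e. c e \<le> d e" "\<And>e. 0 \<le> d e" "\<And>e. e < m \<Longrightarrow> d e \<le> 1" "(\<Sum>e<m. d e) \<le> real k"
    unfolding c_def d_def by (fact DW)+
  have Weq: "P e l = Q e l" if "c e = d e" "l < k" for e l
    using that unfolding c_def d_def by (rule DW(5))
  have gkx: "leading_trace k m n P Q x = (\<Sum>e<m. \<xi> e * c e)"
  proof -
    have "leading_trace k m n P Q x
        = frobenius m n (\<lambda>i j. if i = j then \<xi> i else 0) (\<lambda>i j. \<Sum>l<k. P i l * Q j l)"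
      unfolding leading_trace_frobenius frobenius_def using x by (intro sum.cong refl) (auto simp: mult.commute)
    also have "\<dots> = (\<Sum>e<m. \<xi> e * c e)"
      by (subst frobenius_diagonal[OF mn]) (auto simp: c_def)
    finally show ?thesis .
  qed
  have kfx: "ky_fan k m n x = (\<Sum>l<k. \<xi> l)" using svd by (rule ky_fan_svd[OF k(2) mn])
  have opt: "(\<Sum>l<k. \<xi> l) \<le> (\<Sum>e<m. \<xi> e * c e)" using act gkx kfx by simp
  note T = threshold_weights[where y = \<xi> and c = c and d = d and r = k and N = m, OF k _ _ _ _ _ W(4)]
  have top: "d e = 1" if "e < m" "\<xi> e > \<xi> (k - 1)" for e
    by (rule T(2)[OF _ _ _ _ _ opt]) (use \<xi> W that in auto)
  have bot: "d e = 0" if "e < m" "\<xi> e < \<xi> (k - 1)" for e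
    by (rule T(3)[OF _ _ _ _ _ opt]) (use \<xi> W that in auto)
  have pos: "c e = d e" if "e < m" "\<xi> e > 0" for e
    by (rule T(4)[OF _ _ _ _ _ opt]) (use \<xi> W that in auto)
  have slack: "\<xi> (k - 1) * (real k - (\<Sum>e<m. d e)) = 0"
    by (rule T(5)[OF _ _ _ _ _ opt]) (use \<xi> W in auto)
  have km0: "0 \<le> \<xi> (k - 1)" using \<xi>(1) k by simp
  show PQ: "P e l = Q e l" if "e < m" "l < k" "\<xi> e > \<xi> (k - 1)" for e l
    using Weq[OF pos] that km0 by simp
  show "(\<Sum>l<k. (P e l)\<^sup>2) = 1" if "e < m" "\<xi> e > \<xi> (k - 1)" for e
  proof -
    have "d e = (\<Sum>l<k. (P e l)\<^sup>2)"
      unfolding d_def using PQ[OF that(1) _ that(2)]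
      by (simp add: power2_eq_square sum_divide_distrib)
    then show ?thesis using top[OF that] by simp
  qed
  show bot0: "P e l = 0 \<and> Q e l = 0" if "e < m" "l < k" "\<xi> e < \<xi> (k - 1)" for e l
  proof -
    have "(\<Sum>l<k. P e l * P e l + Q e l * Q e l) = 0" using bot[OF that(1,3)] by (simp add: d_def)
    then have "P e l * P e l + Q e l * Q e l = 0"
      by (rule sum_zero_imp_term_zero) (use that in auto)
    then show ?thesis by (simp add: sum_squares_eq_zero_iff)
  qed
  show "P e l = Q e l" if "e < m" "l < k" "\<xi> (k - 1) > 0" for e l
    using Weq[OF pos] bot0[of e l] that by (cases "\<xi> e < \<xi> (k - 1)") auto
  show "Q j l = 0" if j: "m \<le> j" "j < n" and l: "l < k" and p: "\<xi> (k - 1) > 0" for j l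
  proof -
    have "real k = (\<Sum>e<m. d e)" using slack p by simp
    also have "\<dots> = (\<Sum>l<k. ((\<Sum>e<m. P e l * P e l) + (\<Sum>e<m. Q e l * Q e l)) / 2)"
      unfolding d_def sum_divide_distrib[symmetric] by (subst sum.swap) (simp add: sum.distrib)
    also have "\<dots> = (\<Sum>l<k. (1 + (\<Sum>e<m. Q e l * Q e l)) / 2)"
      using orth_cols[OF P] k by (intro sum.cong) auto
    finally have "(\<Sum>l<k. 1 - (1 + (\<Sum>e<m. Q e l * Q e l)) / 2) = 0"
      unfolding sum_subtractf by simp
    then have "1 - (1 + (\<Sum>e<m. Q e l * Q e l)) / 2 = 0"
      by (rule sum_zero_imp_term_zero) (use orth_partial_col_le[OF Q _ mn] k mn l in auto)
    then have "(\<Sum>e<m. Q e l * Q e l) = 1" by simp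
    moreover have "(\<Sum>e<n. Q e l * Q e l) = 1" using orth_cols[OF Q] l k mn by simp
    ultimately have z: "(\<Sum>i<n - m. Q (m + i) l * Q (m + i) l) = 0"
      using sum_lessThan_split[OF mn, of "\<lambda>e. Q e l * Q e l"] by simp
    have "Q (m + (j - m)) l * Q (m + (j - m)) l = 0"
      by (rule sum_zero_imp_term_zero[OF z, where i = "j - m"]) (use j in auto)
    then show ?thesis using j by simp
  qed
qed

text \<open>A row of length 1 on its first \<open>k\<close> entries vanishes beyond them, so the truncated product with any
other row equals the full one.\<close>

lemma orth_row_concentrated:
  assumes P: "orth n P" and "e < n" "k \<le> n" and one: "(\<Sum>l<k. (P e l)\<^sup>2) = 1" and i: "i < n"
  shows "(\<Sum>l<k. P i l * P e l) = (if i = e then 1 else 0)"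
proof -
  have "(\<Sum>l<n. (P e l)\<^sup>2) = 1" using orth_rows[OF P] assms(2) by (simp add: power2_eq_square)
  then have z: "(\<Sum>l<n - k. (P e (k + l))\<^sup>2) = 0"
    using sum_lessThan_split[OF assms(3), of "\<lambda>l. (P e l)\<^sup>2"] one by simp
  have far: "P e (k + l) = 0" if "l < n - k" for l
  proof -
    have "(P e (k + l))\<^sup>2 = 0" by (rule sum_zero_imp_term_zero[OF z, where i = l]) (use that in auto)
    then show ?thesis by simp
  qed
  have "(\<Sum>l<k. P i l * P e l) = (\<Sum>l<n. P i l * P e l)"
    unfolding sum_lessThan_split[OF assms(3)] using far by simp
  then show ?thesis using orth_rows[OF P i assms(2)] by simp
qed

text \<open>The first \<open>k0\<close> rows and columns of the coefficient matrix \<open>W = \<Sum>l<k. p\<^sub>l q\<^sub>l\<^sup>T\<close> are those of the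
identity.\<close>

lemma leading_trace_decouple:
  assumes k: "k0 \<le> k" "k \<le> m" and mn: "m \<le> n" and P: "orth m P" and Q: "orth n Q"
    and eq: "\<And>e l. e < k0 \<Longrightarrow> l < k \<Longrightarrow> P e l = Q e l"
    and one: "\<And>e. e < k0 \<Longrightarrow> (\<Sum>l<k. (P e l)\<^sup>2) = 1"
  shows "leading_trace k m n P Q h = (\<Sum>e<k0. h e e) +
    (\<Sum>l<k. \<Sum>i<m - k0. \<Sum>j<n - k0. P (k0 + i) l * h (k0 + i) (k0 + j) * Q (k0 + j) l)"
proof -
  define W where "W = (\<lambda>i j. \<Sum>l<k. P i l * Q j l)"
  have k0m: "k0 \<le> m" and k0n: "k0 \<le> n" using k mn by auto
  have oneQ: "(\<Sum>l<k. (Q e l)\<^sup>2) = 1" if "e < k0" for e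
    using one[OF that] eq[OF that] by simp
  have We: "W e j = (if j = e then 1 else 0)" if "e < k0" "j < n" for e j
  proof -
    have "W e j = (\<Sum>l<k. Q j l * Q e l)" unfolding W_def using eq[OF that(1)] by (simp add: mult.commute)
    then show ?thesis using orth_row_concentrated[OF Q _ _ oneQ[OF that(1)] that(2)] that k mn by simp
  qed
  have Wi: "W i e = (if i = e then 1 else 0)" if "e < k0" "i < m" for e i
  proof -
    have "W i e = (\<Sum>l<k. P i l * P e l)" unfolding W_def using eq[OF that(1)] by simp
    then show ?thesis using orth_row_concentrated[OF P _ _ one[OF that(1)] that(2)] that k by simp
  qed
  have "leading_trace k m n P Q h = (\<Sum>i<m. \<Sum>j<n. W i j * h i j)"
    unfolding leading_trace_frobenius frobenius_def W_def ..
  also have "\<dots> = (\<Sum>e<k0. \<Sum>j<n. W e j * h e j) + (\<Sum>i<m - k0. \<Sum>j<n. W (k0 + i) j * h (k0 + i) j)"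
    by (rule sum_lessThan_split[OF k0m])
  also have "(\<Sum>e<k0. \<Sum>j<n. W e j * h e j) = (\<Sum>e<k0. h e e)"
  proof (intro sum.cong refl)
    fix e assume e: "e \<in> {..<k0}"
    have "(\<Sum>j<n. W e j * h e j) = (\<Sum>j<n. if j = e then h e e else 0)"
      using We e by (intro sum.cong) auto
    then show "(\<Sum>j<n. W e j * h e j) = h e e" using e k0n by simp
  qed
  also have "(\<Sum>i<m - k0. \<Sum>j<n. W (k0 + i) j * h (k0 + i) j)
      = (\<Sum>i<m - k0. \<Sum>j<n - k0. W (k0 + i) (k0 + j) * h (k0 + i) (k0 + j))"
    unfolding sum_lessThan_split[OF k0n] using Wi by (intro sum.cong refl) auto
  also have "\<dots> = (\<Sum>i<m - k0. \<Sum>j<n - k0. \<Sum>l<k. P (k0 + i) l * h (k0 + i) (k0 + j) * Q (k0 + j) l)"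
    unfolding W_def sum_distrib_right by (intro sum.cong refl) (simp add: mult_ac)
  also have "\<dots> = (\<Sum>i<m - k0. \<Sum>l<k. \<Sum>j<n - k0. P (k0 + i) l * h (k0 + i) (k0 + j) * Q (k0 + j) l)"
    by (intro sum.cong sum.swap refl)
  also have "\<dots> = (\<Sum>l<k. \<Sum>i<m - k0. \<Sum>j<n - k0. P (k0 + i) l * h (k0 + i) (k0 + j) * Q (k0 + j) l)"
    by (rule sum.swap)
  finally show ?thesis .
qed

text \<open>The first \<open>k\<close> columns have total mass \<open>k\<close>, of which the first \<open>k0\<close> rows take one unit each.\<close>

lemma remaining_mass:
  assumes P: "orth n P" and k: "k0 \<le> k" "k \<le> n" and one: "\<And>e. e < k0 \<Longrightarrow> (\<Sum>l<k. (P e l)\<^sup>2) = 1"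
  shows "(\<Sum>l<k. \<Sum>i<n - k0. (P (k0 + i) l)\<^sup>2) = real k - real k0"
proof -
  have k0n: "k0 \<le> n" using k by simp
  have "real k = (\<Sum>l<k. \<Sum>i<n. (P i l)\<^sup>2)"
    using orth_cols[OF P] k by (simp add: power2_eq_square)
  also have "\<dots> = (\<Sum>l<k. \<Sum>e<k0. (P e l)\<^sup>2) + (\<Sum>l<k. \<Sum>i<n - k0. (P (k0 + i) l)\<^sup>2)"
    unfolding sum_lessThan_split[OF k0n] by (rule sum.distrib)
  also have "(\<Sum>l<k. \<Sum>e<k0. (P e l)\<^sup>2) = (\<Sum>e<k0. \<Sum>l<k. (P e l)\<^sup>2)" by (rule sum.swap)
  also have "\<dots> = real k0" using one by simp
  finally show ?thesis by simp
qed

text \<open>On the leading \<open>n1 \<times> n1\<close> block the matrix is \<open>\<tau> I\<close> plus a positive semidefinite \<open>A\<close>. The part \<open>A\<close>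
contributes at most its trace by \<open>psd_mixed_trace_bound\<close>; what remains is bounded, column by column, by
\<open>\<tau>\<close> times the mass, and the total mass beyond the first \<open>k0\<close> rows is \<open>k - k0\<close>.\<close>

lemma certificate_bound:
  assumes k: "k0 \<le> k" "k \<le> m" and mn: "m \<le> n" and P: "orth m P" and Q: "orth n Q"
    and eq: "\<And>e l. e < k0 \<Longrightarrow> l < k \<Longrightarrow> P e l = Q e l"
    and one: "\<And>e. e < k0 \<Longrightarrow> (\<Sum>l<k. (P e l)\<^sup>2) = 1"
    and n1: "k0 + n1 \<le> m"
    and sym: "\<And>i j. i < n1 \<Longrightarrow> j < n1 \<Longrightarrow> h (k0 + i) (k0 + j) = h (k0 + j) (k0 + i)"
    and ge: "\<And>v. \<tau> * (\<Sum>i<n1. (v i)\<^sup>2) \<le> (\<Sum>i<n1. \<Sum>j<n1. v i * h (k0 + i) (k0 + j) * v j)"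
    and rest: "\<And>l. l < k \<Longrightarrow> (\<Sum>i<m - k0. \<Sum>j<n - k0. P (k0 + i) l *
        (if i < n1 \<and> j < n1 then (if i = j then \<tau> else 0) else h (k0 + i) (k0 + j)) * Q (k0 + j) l)
      \<le> \<tau> * ((\<Sum>i<m - k0. (P (k0 + i) l)\<^sup>2) + (\<Sum>j<n - k0. (Q (k0 + j) l)\<^sup>2)) / 2"
  shows "leading_trace k m n P Q h
      \<le> (\<Sum>e<k0. h e e) + (\<Sum>i<n1. h (k0 + i) (k0 + i)) + \<tau> * (real k - real k0 - real n1)"
proof -
  define A where "A = (\<lambda>i j. h (k0 + i) (k0 + j) - (if i = j then \<tau> else 0))"
  \<comment> \<open>What is left of \<open>h\<close> after subtracting \<open>A\<close> from its leading block.\<close>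
  define R where "R = (\<lambda>i j. if i < n1 \<and> j < n1 then (if i = j then \<tau> else 0) else h (k0 + i) (k0 + j))"
  have dm: "n1 \<le> m - k0" "n1 \<le> n - k0" using n1 mn by auto
  have psd: "0 \<le> (\<Sum>i<n1. \<Sum>j<n1. v i * A i j * v j)" for v
  proof -
    have "(\<Sum>i<n1. \<Sum>j<n1. v i * A i j * v j) =
        (\<Sum>i<n1. \<Sum>j<n1. v i * h (k0 + i) (k0 + j) * v j) - (\<Sum>i<n1. \<Sum>j<n1. if j = i then \<tau> * (v i)\<^sup>2 else 0)"
      unfolding A_def sum_subtractf[symmetric]
      by (intro sum.cong refl) (auto simp: algebra_simps power2_eq_square)
    then show ?thesis using ge[of v] by (simp add: sum_distrib_left)
  qed
  have symA: "A i j = A j i" if "i < n1" "j < n1" for i j using sym[OF that] by (simp add: A_def)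
  have split: "(\<Sum>i<m - k0. \<Sum>j<n - k0. P (k0 + i) l * h (k0 + i) (k0 + j) * Q (k0 + j) l)
    = (\<Sum>i<n1. \<Sum>j<n1. P (k0 + i) l * A i j * Q (k0 + j) l)
      + (\<Sum>i<m - k0. \<Sum>j<n - k0. P (k0 + i) l * R i j * Q (k0 + j) l)" for l
  proof -
    have e1: "(\<Sum>i<n1. \<Sum>j<n1. P (k0 + i) l * A i j * Q (k0 + j) l)
       = (\<Sum>i<m - k0. if i < n1 then (\<Sum>j<n - k0. if j < n1 then P (k0 + i) l * A i j * Q (k0 + j) l else 0) else 0)"
      unfolding sum_lessThan_if_less[OF dm(1)] sum_lessThan_if_less[OF dm(2)] ..
    have e2: "(\<Sum>i<m - k0. if i < n1 then (\<Sum>j<n - k0. if j < n1 then P (k0 + i) l * A i j * Q (k0 + j) l else 0) else 0)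
       + (\<Sum>i<m - k0. \<Sum>j<n - k0. P (k0 + i) l * R i j * Q (k0 + j) l)
       = (\<Sum>i<m - k0. \<Sum>j<n - k0. P (k0 + i) l * h (k0 + i) (k0 + j) * Q (k0 + j) l)"
      unfolding sum.distrib[symmetric]
    proof (intro sum.cong refl)
      fix i
      show "(if i < n1 then \<Sum>j<n - k0. if j < n1 then P (k0 + i) l * A i j * Q (k0 + j) l else 0 else 0)
          + (\<Sum>j<n - k0. P (k0 + i) l * R i j * Q (k0 + j) l)
        = (\<Sum>j<n - k0. P (k0 + i) l * h (k0 + i) (k0 + j) * Q (k0 + j) l)"
      proof (cases "i < n1")
        case True
        then show ?thesis unfolding if_P[OF True] sum.distrib[symmetric]
          by (intro sum.cong refl) (auto simp: A_def R_def algebra_simps)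
      qed (simp add: R_def)
    qed
    show ?thesis unfolding e1 e2 ..
  qed
  have oneQ: "(\<Sum>l<k. (Q e l)\<^sup>2) = 1" if "e < k0" for e
    using one[OF that] eq[OF that] by simp
  have "leading_trace k m n P Q h = (\<Sum>e<k0. h e e) +
     ((\<Sum>l<k. \<Sum>i<n1. \<Sum>j<n1. P (k0 + i) l * A i j * Q (k0 + j) l)
      + (\<Sum>l<k. \<Sum>i<m - k0. \<Sum>j<n - k0. P (k0 + i) l * R i j * Q (k0 + j) l))"
  proof -
    have "leading_trace k m n P Q h = (\<Sum>e<k0. h e e) +
        (\<Sum>l<k. \<Sum>i<m - k0. \<Sum>j<n - k0. P (k0 + i) l * h (k0 + i) (k0 + j) * Q (k0 + j) l)"
      by (rule leading_trace_decouple[OF k mn P Q eq one])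
    then show ?thesis unfolding split sum.distrib .
  qed
  moreover have "(\<Sum>l<k. \<Sum>i<n1. \<Sum>j<n1. P (k0 + i) l * A i j * Q (k0 + j) l) \<le> (\<Sum>i<n1. A i i)"
    by (rule psd_mixed_trace_bound[OF P Q k(2) mn n1 symA psd])
  moreover have "(\<Sum>i<n1. A i i) = (\<Sum>i<n1. h (k0 + i) (k0 + i)) - \<tau> * real n1"
    by (simp add: A_def sum_subtractf)
  moreover have "(\<Sum>l<k. \<Sum>i<m - k0. \<Sum>j<n - k0. P (k0 + i) l * R i j * Q (k0 + j) l)
      \<le> (\<Sum>l<k. \<tau> * ((\<Sum>i<m - k0. (P (k0 + i) l)\<^sup>2) + (\<Sum>j<n - k0. (Q (k0 + j) l)\<^sup>2)) / 2)"
    unfolding R_def by (rule sum_mono) (use rest in auto)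
  moreover have "\<dots> = \<tau> * (real k - real k0)"
  proof -
    have "(\<Sum>l<k. \<tau> * ((\<Sum>i<m - k0. (P (k0 + i) l)\<^sup>2) + (\<Sum>j<n - k0. (Q (k0 + j) l)\<^sup>2)) / 2)
       = \<tau> * ((\<Sum>l<k. \<Sum>i<m - k0. (P (k0 + i) l)\<^sup>2) + (\<Sum>l<k. \<Sum>j<n - k0. (Q (k0 + j) l)\<^sup>2)) / 2"
      by (simp add: sum_distrib_left[symmetric] sum_divide_distrib[symmetric] sum.distrib)
    also have "\<dots> = \<tau> * (real k - real k0)"
    proof -
      have "(\<Sum>l<k. \<Sum>i<m - k0. (P (k0 + i) l)\<^sup>2) = real k - real k0"
        by (rule remaining_mass[OF P k one])
      moreover have "(\<Sum>l<k. \<Sum>j<n - k0. (Q (k0 + j) l)\<^sup>2) = real k - real k0"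
        using k mn by (intro remaining_mass[OF Q k(1) _ oneQ]) auto
      ultimately show ?thesis by simp
    qed
    finally show ?thesis .
  qed
  ultimately show ?thesis by (simp add: algebra_simps)
qed

text \<open>\<open>\<tau> I\<close> on the first \<open>n2\<close> indices next to a block that satisfies the bound satisfies the bound. The
alternative to \<open>0 \<le> \<tau>\<close> serves the symmetric case, where \<open>\<tau>\<close> may be negative but both vectors agree.\<close>

lemma block_diagonal_form_bound:
  fixes B :: "nat \<Rightarrow> nat \<Rightarrow> real"
  assumes d: "n2 \<le> M" "M \<le> M'"
    and diag: "\<And>i j. i < M \<Longrightarrow> j < M' \<Longrightarrow> i < n2 \<or> j < n2 \<Longrightarrow> B i j = (if i = j then \<tau> else 0)"
    and tau: "0 \<le> \<tau> \<or> (\<forall>i<n2. p i = q i)"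
    and low: "(\<Sum>i<M - n2. \<Sum>j<M' - n2. p (n2 + i) * B (n2 + i) (n2 + j) * q (n2 + j))
      \<le> \<tau> * ((\<Sum>i<M - n2. (p (n2 + i))\<^sup>2) + (\<Sum>j<M' - n2. (q (n2 + j))\<^sup>2)) / 2"
  shows "(\<Sum>i<M. \<Sum>j<M'. p i * B i j * q j) \<le> \<tau> * ((\<Sum>i<M. (p i)\<^sup>2) + (\<Sum>j<M'. (q j)\<^sup>2)) / 2"
proof -
  have d': "n2 \<le> M'" using d by simp
  have low_left: "B (n2 + i) j = 0" if "i < M - n2" "j < n2" for i j
    using diag[of "n2 + i" j] that d by simp
  have "(\<Sum>i<M. \<Sum>j<M'. p i * B i j * q j) =
     (\<Sum>i<n2. \<Sum>j<M'. p i * B i j * q j) + (\<Sum>i<M - n2. \<Sum>j<M'. p (n2 + i) * B (n2 + i) j * q j)"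
    by (rule sum_lessThan_split[OF d(1)])
  also have "(\<Sum>i<n2. \<Sum>j<M'. p i * B i j * q j) = (\<Sum>i<n2. \<tau> * (p i * q i))"
  proof (intro sum.cong refl)
    fix i assume i: "i \<in> {..<n2}"
    have "(\<Sum>j<M'. p i * B i j * q j) = (\<Sum>j<M'. if j = i then \<tau> * (p i * q i) else 0)"
      using diag[of i] i d by (intro sum.cong) auto
    then show "(\<Sum>j<M'. p i * B i j * q j) = \<tau> * (p i * q i)" using i d' by simp
  qed
  also have "(\<Sum>i<M - n2. \<Sum>j<M'. p (n2 + i) * B (n2 + i) j * q j)
     = (\<Sum>i<M - n2. \<Sum>j<M' - n2. p (n2 + i) * B (n2 + i) (n2 + j) * q (n2 + j))"
    unfolding sum_lessThan_split[OF d'] using low_left by (intro sum.cong refl) auto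
  finally have total: "(\<Sum>i<M. \<Sum>j<M'. p i * B i j * q j) = (\<Sum>i<n2. \<tau> * (p i * q i)) +
    (\<Sum>i<M - n2. \<Sum>j<M' - n2. p (n2 + i) * B (n2 + i) (n2 + j) * q (n2 + j))" .
  have "(\<Sum>i<n2. \<tau> * (p i * q i)) \<le> (\<Sum>i<n2. \<tau> * (((p i)\<^sup>2 + (q i)\<^sup>2) / 2))"
  proof (rule sum_mono)
    fix i assume i: "i \<in> {..<n2}"
    show "\<tau> * (p i * q i) \<le> \<tau> * (((p i)\<^sup>2 + (q i)\<^sup>2) / 2)"
      using tau
    proof
      assume "0 \<le> \<tau>"
      then show ?thesis by (intro mult_left_mono mult_le_half_squares)
    next
      assume "\<forall>i<n2. p i = q i"
      then show ?thesis using i by (simp add: power2_eq_square)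
    qed
  qed
  also have "\<dots> = \<tau> * ((\<Sum>i<n2. (p i)\<^sup>2) + (\<Sum>i<n2. (q i)\<^sup>2)) / 2"
    by (simp add: sum_distrib_left sum.distrib[symmetric] sum_divide_distrib)
  finally have upper: "(\<Sum>i<n2. \<tau> * (p i * q i)) \<le> \<tau> * ((\<Sum>i<n2. (p i)\<^sup>2) + (\<Sum>i<n2. (q i)\<^sup>2)) / 2" .
  have "(\<Sum>i<M. \<Sum>j<M'. p i * B i j * q j) \<le>
      \<tau> * ((\<Sum>i<n2. (p i)\<^sup>2) + (\<Sum>i<n2. (q i)\<^sup>2)) / 2 +
      \<tau> * ((\<Sum>i<M - n2. (p (n2 + i))\<^sup>2) + (\<Sum>j<M' - n2. (q (n2 + j))\<^sup>2)) / 2"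
    unfolding total using upper low by (rule add_mono)
  then show ?thesis
    unfolding sum_lessThan_split[OF d(1)] sum_lessThan_split[OF d']
      by (simp add: algebra_simps add_divide_distrib)
qed

text \<open>The block diagonal matrix with diagonal blocks \<open>I\<close>, \<open>R\<close>, \<open>I\<close>, where \<open>R\<close> occupies the \<open>N\<close> indices from \<open>k0\<close>
on.\<close>

definition embed :: "nat \<Rightarrow> nat \<Rightarrow> (nat \<Rightarrow> nat \<Rightarrow> real) \<Rightarrow> nat \<Rightarrow> nat \<Rightarrow> real" where
  "embed k0 N R a b =
     (if k0 \<le> a \<and> a < k0 + N \<and> k0 \<le> b \<and> b < k0 + N then R (a - k0) (b - k0) else if a = b then 1 else 0)"

lemma embed_outside_col: "b < k0 \<or> k0 + N \<le> b \<Longrightarrow> embed k0 N R a b = (if a = b then 1 else 0)"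
  and embed_outside_row: "a < k0 \<or> k0 + N \<le> a \<Longrightarrow> embed k0 N R a b = (if a = b then 1 else 0)"
  and embed_inside: "i < N \<Longrightarrow> j < N \<Longrightarrow> embed k0 N R (k0 + i) (k0 + j) = R i j"
  by (auto simp: embed_def)

lemma orth_embed:
  assumes R: "orth N R" and n: "k0 + N \<le> n"
  shows "orth n (embed k0 N R)"
proof (rule orthI_cols)
  fix i j assume ij: "i < n" "j < n"
  have out: "(\<Sum>l<n. embed k0 N R l i * embed k0 N R l j) = (if i = j then 1 else 0)"
    if "i < n" "j < n" "\<not> (k0 \<le> i \<and> i < k0 + N)" for i j
  proof -
    have "(\<Sum>l<n. embed k0 N R l i * embed k0 N R l j) = (\<Sum>l<n. if l = i then (if i = j then 1 else 0) else 0)"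
    proof (intro sum.cong refl)
      fix l
      have "embed k0 N R l i = (if l = i then 1 else 0)" using that(3) by (intro embed_outside_col) auto
      moreover have "embed k0 N R i j = (if i = j then 1 else 0)"
        using that(3) by (intro embed_outside_row) auto
      ultimately show "embed k0 N R l i * embed k0 N R l j = (if l = i then (if i = j then 1 else 0) else 0)"
        by simp
    qed
    then show ?thesis using that by simp
  qed
  show "(\<Sum>l<n. embed k0 N R l i * embed k0 N R l j) = (if i = j then 1 else 0)"
  proof (cases "(k0 \<le> i \<and> i < k0 + N) \<and> (k0 \<le> j \<and> j < k0 + N)")
    case False
    then consider "\<not> (k0 \<le> i \<and> i < k0 + N)" | "\<not> (k0 \<le> j \<and> j < k0 + N)" by blast
    then show ?thesis
    proof cases
      case 1
      then show ?thesis by (rule out[OF ij])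
    next
      case 2
      have "(\<Sum>l<n. embed k0 N R l i * embed k0 N R l j) = (\<Sum>l<n. embed k0 N R l j * embed k0 N R l i)"
        by (intro sum.cong refl mult.commute)
      also have "\<dots> = (if j = i then 1 else 0)" by (rule out[OF ij(2,1) 2])
      finally show ?thesis by (simp only: eq_commute[of j i])
    qed
  next
    case True
    define f where "f = (\<lambda>l. embed k0 N R l i * embed k0 N R l j)"
    have "(\<Sum>l<n. f l) = (\<Sum>l<k0. f l) + (\<Sum>l<n - k0. f (k0 + l))"
      using n by (intro sum_lessThan_split) simp
    also have "(\<Sum>l<n - k0. f (k0 + l)) = (\<Sum>l<N. f (k0 + l)) + (\<Sum>l<n - k0 - N. f (k0 + (N + l)))"
      using n by (intro sum_lessThan_split) simp
    also have "(\<Sum>l<k0. f l) = 0"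
      using True by (intro sum.neutral ballI) (simp add: f_def embed_outside_row)
    also have "(\<Sum>l<n - k0 - N. f (k0 + (N + l))) = 0"
      using True by (intro sum.neutral ballI) (simp add: f_def embed_outside_row)
    also have "(\<Sum>l<N. f (k0 + l)) = (\<Sum>l<N. R l (i - k0) * R l (j - k0))"
    proof (intro sum.cong refl)
      have N: "i - k0 < N" "j - k0 < N" and s: "k0 + (i - k0) = i" "k0 + (j - k0) = j" using True by auto
      fix l assume "l \<in> {..<N}"
      then show "f (k0 + l) = R l (i - k0) * R l (j - k0)"
        using embed_inside[OF _ N(1), of l k0 R] embed_inside[OF _ N(2), of l k0 R] by (simp add: f_def s)
    qed
    also have "\<dots> = (if i = j then 1 else 0)" using orth_cols[OF R, of "i - k0" "j - k0"] True by auto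
    finally show ?thesis by (simp add: f_def)
  qed
qed

text \<open>The test functionals that are used for critical directions: identity on the first \<open>k0\<close> indices,
arbitrary on the block of the tied singular values.\<close>

lemma leading_trace_embed:
  assumes k: "k0 \<le> k" "k \<le> k0 + N" and N: "N \<le> N'" "k0 + N \<le> m" "k0 + N' \<le> n" and mn: "m \<le> n"
    and P: "orth N P" and Q: "orth N' Q"
  shows "leading_trace k m n (embed k0 N P) (embed k0 N' Q) h =
    (\<Sum>e<k0. h e e) + leading_trace (k - k0) N N' P Q (\<lambda>i j. h (k0 + i) (k0 + j))"
proof -
  have km: "k \<le> m" using k N by simp
  have one: "(\<Sum>l<k. (embed k0 N P e l)\<^sup>2) = 1" if "e < k0" for e
  proof -
    have "(\<Sum>l<k. (embed k0 N P e l)\<^sup>2) = (\<Sum>l<k. if l = e then 1 else 0)"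
      using that by (intro sum.cong) (auto simp: embed_outside_row)
    then show ?thesis using that k by simp
  qed
  have d: "N \<le> m - k0" "N' \<le> n - k0" using N by auto
  define F where "F = (\<lambda>l. \<Sum>i<m - k0. \<Sum>j<n - k0.
      embed k0 N P (k0 + i) l * h (k0 + i) (k0 + j) * embed k0 N' Q (k0 + j) l)"
  have "leading_trace k m n (embed k0 N P) (embed k0 N' Q) h = (\<Sum>e<k0. h e e) + (\<Sum>l<k. F l)"
    unfolding F_def
    by (rule leading_trace_decouple[OF k(1) km mn orth_embed[OF P N(2)] orth_embed[OF Q N(3)] _ one])
      (simp_all add: embed_outside_row)
  also have "(\<Sum>l<k. F l) = (\<Sum>l<k0. F l) + (\<Sum>l<k - k0. F (k0 + l))"
    by (rule sum_lessThan_split[OF k(1)])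
  also have "(\<Sum>l<k0. F l) = 0" by (intro sum.neutral ballI) (simp add: F_def embed_outside_col)
  also have "(\<Sum>l<k - k0. F (k0 + l)) = leading_trace (k - k0) N N' P Q (\<lambda>i j. h (k0 + i) (k0 + j))"
    unfolding leading_trace_def
  proof (intro sum.cong refl)
    fix l assume "l \<in> {..<k - k0}"
    then have l: "l < N" "l < N'" using k N by auto
    have "F (k0 + l) = (\<Sum>i<m - k0. if i < N then
        (\<Sum>j<n - k0. if j < N' then P i l * h (k0 + i) (k0 + j) * Q j l else 0) else 0)"
      unfolding F_def
    proof (intro sum.cong refl)
      fix i
      have p: "embed k0 N P (k0 + i) (k0 + l) = (if i < N then P i l else 0)"
        using l embed_inside[of i N l k0 P] embed_outside_row[of "k0 + i" k0 N P "k0 + l"] by auto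
      have q: "embed k0 N' Q (k0 + j) (k0 + l) = (if j < N' then Q j l else 0)" for j
        using l embed_inside[of j N' l k0 Q] embed_outside_row[of "k0 + j" k0 N' Q "k0 + l"] by auto
      show "(\<Sum>j<n - k0. embed k0 N P (k0 + i) (k0 + l) * h (k0 + i) (k0 + j) * embed k0 N' Q (k0 + j) (k0 + l)) =
          (if i < N then (\<Sum>j<n - k0. if j < N' then P i l * h (k0 + i) (k0 + j) * Q j l else 0) else 0)"
        unfolding p q by (cases "i < N") (simp_all add: if_distrib cong: if_cong)
    qed
    then show "F (k0 + l) = (\<Sum>i<N. \<Sum>j<N'. P i l * h (k0 + i) (k0 + j) * Q j l)"
      unfolding sum_lessThan_if_less[OF d(1)] sum_lessThan_if_less[OF d(2)] .
  qed
  finally show ?thesis by simp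
qed

section \<open>Critical directions of diagonal pairs\<close>

text \<open>The shape of an \<open>N \<times> N'\<close> matrix with three diagonal blocks that end at \<open>n1\<close>, \<open>n2\<close> and \<open>N\<close>: the first is
symmetric and at least \<open>\<tau> I\<close>, the second is \<open>\<tau> I\<close>, and the third is arbitrary.\<close>

definition leading_block_form :: "nat \<Rightarrow> nat \<Rightarrow> nat \<Rightarrow> nat \<Rightarrow> real \<Rightarrow> (nat \<Rightarrow> nat \<Rightarrow> real) \<Rightarrow> bool" where
  "leading_block_form N N' n1 n2 \<tau> B \<longleftrightarrow>
     (\<forall>i<N. \<forall>j<N'. (i < n2 \<or> j < n2) \<longrightarrow> \<not> (i < n1 \<and> j < n1) \<longrightarrow> B i j = (if i = j then \<tau> else 0)) \<and>
     (\<forall>i<n1. \<forall>j<n1. B i j = B j i) \<and>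
     (\<forall>v. \<tau> * (\<Sum>i<n1. (v i)\<^sup>2) \<le> (\<Sum>i<n1. \<Sum>j<n1. v i * B i j * v j))"

lemma leading_block_formD:
  assumes "leading_block_form N N' n1 n2 \<tau> B"
  shows "\<And>i j. i < N \<Longrightarrow> j < N' \<Longrightarrow> i < n2 \<or> j < n2 \<Longrightarrow> \<not> (i < n1 \<and> j < n1) \<Longrightarrow> B i j = (if i = j then \<tau> else 0)"
    "\<And>i j. i < n1 \<Longrightarrow> j < n1 \<Longrightarrow> B i j = B j i"
    "\<And>v. \<tau> * (\<Sum>i<n1. (v i)\<^sup>2) \<le> (\<Sum>i<n1. \<Sum>j<n1. v i * B i j * v j)"
  using assms unfolding leading_block_form_def by blast+

text \<open>For \<open>\<tau> \<ge> 0\<close>, no singular value of the third block exceeds \<open>\<tau>\<close>.\<close>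

definition tail_bounded :: "nat \<Rightarrow> nat \<Rightarrow> nat \<Rightarrow> real \<Rightarrow> (nat \<Rightarrow> nat \<Rightarrow> real) \<Rightarrow> bool" where
  "tail_bounded N N' n2 \<tau> B \<longleftrightarrow> (\<forall>p q. (\<Sum>i<N - n2. \<Sum>j<N' - n2. p i * B (n2 + i) (n2 + j) * q j)
      \<le> \<tau> * ((\<Sum>i<N - n2. (p i)\<^sup>2) + (\<Sum>j<N' - n2. (q j)\<^sup>2)) / 2)"

lemma bilinear_form_sym_part: "bilinear_form N (\<lambda>i j. (a i j + a j i) / 2) v v = bilinear_form N a v v"
proof -
  have "bilinear_form N (\<lambda>i j. (a i j + a j i) / 2) v v
      = (bilinear_form N a v v + (\<Sum>i<N. \<Sum>j<N. v i * a j i * v j)) / 2"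
    unfolding bilinear_form_def sum.distrib[symmetric] sum_divide_distrib
    by (intro sum.cong refl) (simp add: field_simps)
  also have "(\<Sum>i<N. \<Sum>j<N. v i * a j i * v j) = bilinear_form N a v v"
    unfolding bilinear_form_def by (subst sum.swap) (simp add: mult_ac)
  finally show ?thesis by simp
qed

text \<open>The diagonal model: \<open>x\<close> and \<open>S\<close> are \<open>Xb\<close> and \<open>Sb\<close> in the bases of the singular vectors of \<open>X\<close>, with
diagonals \<open>\<xi>\<close> and \<open>s\<close>. The tied entries of \<open>\<xi>\<close> occupy the indices from \<open>k0\<close> to \<open>k1 - 1\<close>; among them
\<open>s = 1\<close> holds exactly before offset \<open>n1\<close> and \<open>s = 0\<close> exactly from offset \<open>n2\<close> on.\<close>

locale diagonal_pair =
  fixes k m n k0 k1 n1 n2 :: nat and \<xi> s :: "nat \<Rightarrow> real" and x S :: "nat \<Rightarrow> nat \<Rightarrow> real"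
  assumes k: "1 \<le> k" "k \<le> m" and mn: "m \<le> n"
    and x: "\<And>i j. i < m \<Longrightarrow> j < n \<Longrightarrow> x i j = (if i = j then \<xi> i else 0)"
    and S: "\<And>i j. i < m \<Longrightarrow> j < n \<Longrightarrow> S i j = (if i = j then s i else 0)"
    and \<xi>: "\<And>i. i < m \<Longrightarrow> 0 \<le> \<xi> i" "\<And>i j. i \<le> j \<Longrightarrow> j < m \<Longrightarrow> \<xi> j \<le> \<xi> i"
    and s: "\<And>i. i < m \<Longrightarrow> 0 \<le> s i" "\<And>i. i < m \<Longrightarrow> s i \<le> 1" "(\<Sum>i<m. s i) \<le> real k"
    and norming: "norming k m n S x"
    and k0: "k0 < k" and k1: "k \<le> k1" "k1 \<le> m"
    and above: "\<And>i. i < k0 \<Longrightarrow> \<xi> i > \<xi> (k - 1)"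
    and tied: "\<And>i. k0 \<le> i \<Longrightarrow> i < k1 \<Longrightarrow> \<xi> i = \<xi> (k - 1)"
    and below: "\<And>i. k1 \<le> i \<Longrightarrow> i < m \<Longrightarrow> \<xi> i < \<xi> (k - 1)"
    and n12: "n1 \<le> n2" "n2 \<le> k1 - k0"
    and s_one: "\<And>i. i < k1 - k0 \<Longrightarrow> s (k0 + i) = 1 \<longleftrightarrow> i < n1"
    and s_zero: "\<And>i. i < k1 - k0 \<Longrightarrow> s (k0 + i) = 0 \<longleftrightarrow> n2 \<le> i"
begin

text \<open>The critical cone in terms of functionals: \<open>S\<close> is optimal at \<open>h\<close> among the functionals active at \<open>x\<close>.\<close>

definition maximal :: "(nat \<Rightarrow> nat \<Rightarrow> real) \<Rightarrow> bool" where
  "maximal h \<longleftrightarrow> (\<forall>P Q. orth m P \<longrightarrow> orth n Q \<longrightarrow> leading_trace k m n P Q x = ky_fan k m n x \<longrightarrow>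
     leading_trace k m n P Q h \<le> frobenius m n S h)"

lemma ky_fan_x: "ky_fan k m n x = (\<Sum>l<k. \<xi> l)"
  using is_svd_diagonal[OF mn x \<xi>] by (rule ky_fan_svd[OF k(2) mn])

lemma frobenius_S: "frobenius m n S h = (\<Sum>i<m. s i * h i i)"
proof -
  have "frobenius m n S h = (\<Sum>i<m. S i i * h i i)"
    by (rule frobenius_diagonal[OF mn]) (simp add: S)
  then show ?thesis using S mn by simp
qed

text \<open>Equality in \<open>threshold_weights\<close> for \<open>\<Sum>i. \<xi> i * s i = \<Sum>l<k. \<xi> l\<close>.\<close>

lemma s_structure:
  shows s_alpha: "\<And>i. i < k0 \<Longrightarrow> s i = 1"
    and s_gamma: "\<And>i. k1 \<le> i \<Longrightarrow> i < m \<Longrightarrow> s i = 0"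
    and slack: "\<xi> (k - 1) * (real k - (\<Sum>i<m. s i)) = 0"
proof -
  have "frobenius m n S x = (\<Sum>l<k. \<xi> l)" using norming ky_fan_x by (simp add: norming_def)
  then have opt: "(\<Sum>l<k. \<xi> l) \<le> (\<Sum>i<m. \<xi> i * s i)"
    unfolding frobenius_S using x mn by (simp add: mult.commute)
  note T = threshold_weights[where y = \<xi> and c = s and d = s and r = k and N = m, OF k _ _ _ _ _ s(3)]
  show "s i = 1" if "i < k0" for i
    by (rule T(2)[OF _ _ _ _ _ opt]) (use \<xi> s above that k0 k in auto)
  show "s i = 0" if "k1 \<le> i" "i < m" for i
    by (rule T(3)[OF _ _ _ _ _ opt]) (use \<xi> s below that in auto)
  show "\<xi> (k - 1) * (real k - (\<Sum>i<m. s i)) = 0"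
    by (rule T(5)[OF _ _ _ _ _ opt]) (use \<xi> s in auto)
qed

lemma sum_s_split: "(\<Sum>i<m. s i * f i) = (\<Sum>i<k0. f i) + (\<Sum>i<k1 - k0. s (k0 + i) * f (k0 + i))"
proof -
  have k0m: "k0 \<le> m" and d: "k1 - k0 \<le> m - k0" using k0 k k1 by auto
  have "(\<Sum>i<m. s i * f i) = (\<Sum>i<k0. s i * f i) + (\<Sum>i<m - k0. s (k0 + i) * f (k0 + i))"
    by (rule sum_lessThan_split[OF k0m])
  also have "(\<Sum>i<k0. s i * f i) = (\<Sum>i<k0. f i)" using s_alpha by simp
  also have "(\<Sum>i<m - k0. s (k0 + i) * f (k0 + i))
      = (\<Sum>i<m - k0. if i < k1 - k0 then s (k0 + i) * f (k0 + i) else 0)"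
    using s_gamma by (intro sum.cong) auto
  also have "\<dots> = (\<Sum>i<k1 - k0. s (k0 + i) * f (k0 + i))" by (rule sum_lessThan_if_less[OF d])
  finally show ?thesis .
qed

lemma sum_s: "(\<Sum>i<k1 - k0. s (k0 + i)) = (\<Sum>i<m. s i) - real k0"
  using sum_s_split[of "\<lambda>_. 1"] by simp

text \<open>On the first \<open>n1\<close> indices \<open>s = 1\<close>, on the next ones \<open>B i i = \<tau>\<close>, and afterwards \<open>s = 0\<close>.\<close>

lemma weighted_diagonal:
  assumes B: "leading_block_form (k1 - k0) N' n1 n2 \<tau> B" and N': "k1 - k0 \<le> N'"
  shows "(\<Sum>i<k1 - k0. s (k0 + i) * B i i) = (\<Sum>i<n1. B i i) + \<tau> * ((\<Sum>i<m. s i) - real k0 - real n1)"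
proof -
  have d: "n1 \<le> k1 - k0" using n12 by simp
  have "(\<Sum>i<k1 - k0. s (k0 + i) * B i i)
      = (\<Sum>i<k1 - k0. (if i < n1 then B i i - \<tau> else 0) + \<tau> * s (k0 + i))"
  proof (intro sum.cong refl)
    fix i assume i: "i \<in> {..<k1 - k0}"
    consider "i < n1" | "n1 \<le> i" "i < n2" | "n2 \<le> i" by linarith
    then show "s (k0 + i) * B i i = (if i < n1 then B i i - \<tau> else 0) + \<tau> * s (k0 + i)"
    proof cases
      case 1
      then show ?thesis using s_one[of i] i by simp
    next
      case 2
      then show ?thesis using leading_block_formD(1)[OF B, of i i] i N' by simp
    next
      case 3
      then show ?thesis using s_zero[of i] i n12 by simp
    qed
  qed
  also have "\<dots> = (\<Sum>i<n1. B i i - \<tau>) + \<tau> * (\<Sum>i<k1 - k0. s (k0 + i))"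
    unfolding sum.distrib sum_lessThan_if_less[OF d] by (simp add: sum_distrib_left)
  finally show ?thesis unfolding sum_s by (simp add: sum_subtractf algebra_simps)
qed

text \<open>\<open>block_structure_of_maximizer\<close> for the block of the tied entries, with the support conditions
expressed by \<open>n1\<close> and \<open>n2\<close>.\<close>

lemma block_form_if_maximizer:
  assumes N': "k1 - k0 \<le> N'" and svd: "is_svd (k1 - k0) N' B \<mu> P Q"
    and opt: "(\<Sum>l<k - k0. \<mu> l) \<le> (\<Sum>i<k1 - k0. s (k0 + i) * B i i)"
  shows "\<exists>\<tau>\<ge>0. \<tau> * (real k - (\<Sum>i<m. s i)) = 0 \<and> leading_block_form (k1 - k0) N' n1 n2 \<tau> B \<and>
    tail_bounded (k1 - k0) N' n2 \<tau> B"
proof -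
  define N where "N = k1 - k0"
  define \<sigma> where "\<sigma> = (\<lambda>i. s (k0 + i))"
  define \<tau> where "\<tau> = \<mu> (k - k0 - 1)"
  have r: "1 \<le> k - k0" "k - k0 \<le> N" using k0 k1 by (auto simp: N_def)
  have sig: "0 \<le> \<sigma> i" "\<sigma> i \<le> 1" if "i < N" for i using s(1,2)[of "k0 + i"] that k1 by (auto simp: \<sigma>_def N_def)
  have ssum: "(\<Sum>i<N. \<sigma> i) \<le> real (k - k0)" using sum_s s(3) k0 by (simp add: \<sigma>_def N_def)
  have sum_eq: "real (k - k0) - (\<Sum>i<N. \<sigma> i) = real k - (\<Sum>i<m. s i)"
    using sum_s k0 by (simp add: \<sigma>_def N_def)
  have sig': "\<forall>i<N. 0 \<le> \<sigma> i \<and> \<sigma> i \<le> 1" using sig by simp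
  have opt': "(\<Sum>l<k - k0. \<mu> l) \<le> (\<Sum>i<N. \<sigma> i * B i i)" using opt by (simp add: N_def \<sigma>_def)
  note BS = block_structure_of_maximizer[OF N'[folded N_def] r svd[folded N_def] sig' ssum opt',
      folded \<tau>_def]
  have one: "\<sigma> i = 1 \<longleftrightarrow> i < n1" and pos: "0 < \<sigma> i \<longleftrightarrow> i < n2" if "i < N" for i
  proof -
    show "\<sigma> i = 1 \<longleftrightarrow> i < n1" using s_one[of i] that by (simp add: N_def \<sigma>_def)
    have "\<sigma> i = 0 \<longleftrightarrow> n2 \<le> i" using s_zero[of i] that by (simp add: N_def \<sigma>_def)
    then show "0 < \<sigma> i \<longleftrightarrow> i < n2" using sig(1)[OF that] by auto
  qed
  have N12: "n1 \<le> N" "n2 \<le> N" "n2 \<le> N'" using n12 N' by (auto simp: N_def)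
  have "leading_block_form N N' n1 n2 \<tau> B"
    unfolding leading_block_form_def
  proof (intro conjI allI impI)
    fix i j assume ij: "i < N" "j < N'" "i < n2 \<or> j < n2" "\<not> (i < n1 \<and> j < n1)"
    show "B i j = (if i = j then \<tau> else 0)"
    proof (cases "i < n2")
      case True
      have "\<not> (\<sigma> i = 1 \<and> j < N \<and> \<sigma> j = 1)" using one ij by auto
      then show ?thesis using BS(3)[OF ij(1,2)] pos[OF ij(1)] True by simp
    next
      case False
      then have j: "j < n2" "j < N" using ij N12 by auto
      have "\<not> (\<sigma> i = 1 \<and> \<sigma> j = 1)" using one ij j by auto
      then show ?thesis using BS(4)[OF ij(1) j(2)] pos[OF j(2)] j by simp
    qed
  next
    fix i j assume "i < n1" "j < n1"
    then show "B i j = B j i" using BS(5)[of i j] one N12 by simp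
  next
    fix v :: "nat \<Rightarrow> real"
    define w where "w = (\<lambda>i. if i < n1 then v i else 0)"
    have "(\<Sum>i<N. (w i)\<^sup>2) = (\<Sum>i<N. if i < n1 then (v i)\<^sup>2 else 0)"
      by (intro sum.cong) (auto simp: w_def)
    then have 1: "(\<Sum>i<N. (w i)\<^sup>2) = (\<Sum>i<n1. (v i)\<^sup>2)" unfolding sum_lessThan_if_less[OF N12(1)] .
    have "(\<Sum>i<N. \<Sum>j<N. w i * B i j * w j)
        = (\<Sum>i<N. if i < n1 then (\<Sum>j<N. if j < n1 then v i * B i j * v j else 0) else 0)"
    proof (intro sum.cong refl)
      fix i
      show "(\<Sum>j<N. w i * B i j * w j) = (if i < n1 then (\<Sum>j<N. if j < n1 then v i * B i j * v j else 0) else 0)"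
        by (cases "i < n1") (auto simp: w_def intro!: sum.cong)
    qed
    then have 2: "(\<Sum>i<N. \<Sum>j<N. w i * B i j * w j) = (\<Sum>i<n1. \<Sum>j<n1. v i * B i j * v j)"
      unfolding sum_lessThan_if_less[OF N12(1)] .
    have "\<tau> * (\<Sum>i<N. (w i)\<^sup>2) \<le> (\<Sum>i<N. \<Sum>j<N. w i * B i j * w j)"
      by (rule BS(6)) (use one in \<open>auto simp: w_def\<close>)
    then show "\<tau> * (\<Sum>i<n1. (v i)\<^sup>2) \<le> (\<Sum>i<n1. \<Sum>j<n1. v i * B i j * v j)" unfolding 1 2 .
  qed
  moreover have "tail_bounded N N' n2 \<tau> B"
    unfolding tail_bounded_def
  proof (intro allI)
    fix p q :: "nat \<Rightarrow> real"
    define p' where "p' = (\<lambda>i. if i < n2 then 0 else p (i - n2))"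
    define q' where "q' = (\<lambda>i. if i < n2 then 0 else q (i - n2))"
    have "(\<Sum>i<N. \<Sum>j<N'. p' i * B i j * q' j) \<le> \<tau> * ((\<Sum>i<N. (p' i)\<^sup>2) + (\<Sum>j<N'. (q' j)\<^sup>2)) / 2"
    proof (rule BS(7))
      show "p' i = 0" if "i < N" "\<sigma> i \<noteq> 0" for i
        using pos[OF that(1)] sig(1)[OF that(1)] that by (simp add: p'_def)
      show "q' i = 0" if "i < N" "\<sigma> i \<noteq> 0" for i
        using pos[OF that(1)] sig(1)[OF that(1)] that by (simp add: q'_def)
    qed
    then show "(\<Sum>i<N - n2. \<Sum>j<N' - n2. p i * B (n2 + i) (n2 + j) * q j)
      \<le> \<tau> * ((\<Sum>i<N - n2. (p i)\<^sup>2) + (\<Sum>j<N' - n2. (q j)\<^sup>2)) / 2"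
      unfolding sum_lessThan_split[OF N12(2)] sum_lessThan_split[OF N12(3)]
      by (simp add: p'_def q'_def)
  qed
  moreover have "0 \<le> \<tau>" by (rule BS(1))
  moreover have "\<tau> * (real k - (\<Sum>i<m. s i)) = 0" using BS(2) unfolding sum_eq .
  ultimately show ?thesis unfolding N_def by blast
qed

lemma active_decoupled:
  assumes "orth m P" "orth n Q" "leading_trace k m n P Q x = ky_fan k m n x"
  shows "\<And>e l. e < k0 \<Longrightarrow> l < k \<Longrightarrow> P e l = Q e l" and "\<And>e. e < k0 \<Longrightarrow> (\<Sum>l<k. (P e l)\<^sup>2) = 1"
proof -
  have e: "e < m" "\<xi> e > \<xi> (k - 1)" if "e < k0" for e using above[OF that] that k0 k by auto
  show "P e l = Q e l" if "e < k0" "l < k" for e l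
    by (rule active_rows(1)[OF k mn assms(1,2) x \<xi> assms(3) e(1)[OF that(1)] that(2) e(2)[OF that(1)]])
  show "(\<Sum>l<k. (P e l)\<^sup>2) = 1" if "e < k0" for e
    by (rule active_rows(2)[OF k mn assms(1,2) x \<xi> assms(3) e[OF that]])
qed

text \<open>The value of \<open>certificate_bound\<close> is \<open>\<langle>S, h\<rangle>\<close>, because \<open>\<tau> k = \<tau> * (\<Sum>i. s i)\<close>.\<close>

lemma bound_from_block_form:
  assumes P: "orth m P" and Q: "orth n Q" and act: "leading_trace k m n P Q x = ky_fan k m n x"
    and N': "k1 - k0 \<le> N'"
    and B: "leading_block_form (k1 - k0) N' n1 n2 \<tau> (\<lambda>i j. h (k0 + i) (k0 + j))"
    and slack: "\<tau> * (real k - (\<Sum>i<m. s i)) = 0"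
    and rest: "\<And>l. l < k \<Longrightarrow> (\<Sum>i<m - k0. \<Sum>j<n - k0. P (k0 + i) l *
        (if i < n1 \<and> j < n1 then (if i = j then \<tau> else 0) else h (k0 + i) (k0 + j)) * Q (k0 + j) l)
      \<le> \<tau> * ((\<Sum>i<m - k0. (P (k0 + i) l)\<^sup>2) + (\<Sum>j<n - k0. (Q (k0 + j) l)\<^sup>2)) / 2"
  shows "leading_trace k m n P Q h \<le> frobenius m n S h"
proof -
  have "leading_trace k m n P Q h
      \<le> (\<Sum>e<k0. h e e) + (\<Sum>i<n1. h (k0 + i) (k0 + i)) + \<tau> * (real k - real k0 - real n1)"
  proof (rule certificate_bound[OF less_imp_le[OF k0] k(2) mn P Q active_decoupled[OF P Q act]])
    show "k0 + n1 \<le> m" using n12 k1 k0 by simp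
    show "h (k0 + i) (k0 + j) = h (k0 + j) (k0 + i)" if "i < n1" "j < n1" for i j
      by (rule leading_block_formD(2)[OF B that])
    show "\<tau> * (\<Sum>i<n1. (v i)\<^sup>2) \<le> (\<Sum>i<n1. \<Sum>j<n1. v i * h (k0 + i) (k0 + j) * v j)" for v
      by (rule leading_block_formD(3)[OF B])
  qed (use rest in auto)
  also have "\<tau> * (real k - real k0 - real n1) = \<tau> * ((\<Sum>i<m. s i) - real k0 - real n1)"
    using slack by (simp add: algebra_simps)
  also have "(\<Sum>e<k0. h e e) + (\<Sum>i<n1. h (k0 + i) (k0 + i)) + \<tau> * ((\<Sum>i<m. s i) - real k0 - real n1)
     = frobenius m n S h"
    unfolding frobenius_S sum_s_split weighted_diagonal[OF B N'] by simp
  finally show ?thesis .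
qed

text \<open>If the tied entries are 0, the block may be tested with independent bases \<open>P\<close>, \<open>Q\<close> on both sides,
including the columns beyond \<open>m\<close>; the test functional comes from a singular value decomposition of
the block of \<open>h\<close>.\<close>

theorem maximal_iff_zero_case:
  assumes zero: "\<xi> (k - 1) = 0"
  shows "maximal h \<longleftrightarrow> (\<exists>\<tau>\<ge>0. \<tau> * (real k - (\<Sum>i<m. s i)) = 0 \<and>
    leading_block_form (m - k0) (n - k0) n1 n2 \<tau> (\<lambda>i j. h (k0 + i) (k0 + j)) \<and>
    tail_bounded (m - k0) (n - k0) n2 \<tau> (\<lambda>i j. h (k0 + i) (k0 + j)))"
proof -
  \<comment> \<open>No singular value lies below 0, so the tied ones are the last.\<close>
  have k1m: "k1 = m"
  proof (rule ccontr)
    assume "k1 \<noteq> m"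
    then have "k1 < m" using k1 by simp
    then show False using below[of k1] \<xi>(1)[of k1] zero by simp
  qed
  define B where "B = (\<lambda>i j. h (k0 + i) (k0 + j))"
  have NN: "m - k0 \<le> n - k0" using mn by simp
  show ?thesis
  proof
    assume max: "maximal h"
    obtain \<mu> P Q where svd: "is_svd (m - k0) (n - k0) B \<mu> P Q" by (rule svd_exists[OF NN])
    note SV = is_svdD[OF svd]
    have dims: "k0 \<le> k" "k \<le> k0 + (m - k0)" "k0 + (m - k0) \<le> m" "k0 + (n - k0) \<le> n" "k - k0 \<le> m - k0"
      using k0 k mn by auto
    note embed = leading_trace_embed[OF dims(1,2) NN dims(3,4) mn SV(1,2)]
    have xz: "x (k0 + i) (k0 + j) = 0" if "i < m - k0" "j < n - k0" for i j
      using x[of "k0 + i" "k0 + j"] tied[of "k0 + i"] zero that k1m by auto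
    have "leading_trace (k - k0) (m - k0) (n - k0) P Q (\<lambda>i j. x (k0 + i) (k0 + j)) = 0"
      unfolding leading_trace_def using xz by simp
    moreover have "(\<Sum>e<k0. x e e) = (\<Sum>l<k. \<xi> l)"
    proof -
      have "(\<Sum>l<k. \<xi> l) = (\<Sum>e<k0. \<xi> e) + (\<Sum>l<k - k0. \<xi> (k0 + l))"
        by (rule sum_lessThan_split[OF dims(1)])
      moreover have "(\<Sum>l<k - k0. \<xi> (k0 + l)) = 0"
        using tied zero k1 by (intro sum.neutral) auto
      moreover have "(\<Sum>e<k0. x e e) = (\<Sum>e<k0. \<xi> e)" using x k0 k mn by (intro sum.cong) auto
      ultimately show ?thesis by simp
    qed
    ultimately have act: "leading_trace k m n (embed k0 (m - k0) P) (embed k0 (n - k0) Q) x = ky_fan k m n x"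
      unfolding embed ky_fan_x by simp
    have "leading_trace k m n (embed k0 (m - k0) P) (embed k0 (n - k0) Q) h \<le> frobenius m n S h"
      using max orth_embed[OF SV(1) dims(3)] orth_embed[OF SV(2) dims(4)] act unfolding maximal_def by blast
    then have "(\<Sum>l<k - k0. \<mu> l) \<le> (\<Sum>i<m - k0. s (k0 + i) * B i i)"
      unfolding embed frobenius_S sum_s_split B_def[symmetric] leading_trace_singular_vectors[OF dims(5) NN svd] k1m
      by (simp add: B_def)
    then show "\<exists>\<tau>\<ge>0. \<tau> * (real k - (\<Sum>i<m. s i)) = 0 \<and>
      leading_block_form (m - k0) (n - k0) n1 n2 \<tau> (\<lambda>i j. h (k0 + i) (k0 + j)) \<and>
      tail_bounded (m - k0) (n - k0) n2 \<tau> (\<lambda>i j. h (k0 + i) (k0 + j))"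
      using block_form_if_maximizer[of "n - k0" B \<mu> P Q] svd NN unfolding k1m B_def by blast
  next
    assume "\<exists>\<tau>\<ge>0. \<tau> * (real k - (\<Sum>i<m. s i)) = 0 \<and>
      leading_block_form (m - k0) (n - k0) n1 n2 \<tau> (\<lambda>i j. h (k0 + i) (k0 + j)) \<and>
      tail_bounded (m - k0) (n - k0) n2 \<tau> (\<lambda>i j. h (k0 + i) (k0 + j))"
    then obtain \<tau> where tau: "0 \<le> \<tau>" "\<tau> * (real k - (\<Sum>i<m. s i)) = 0"
      and BC: "leading_block_form (m - k0) (n - k0) n1 n2 \<tau> (\<lambda>i j. h (k0 + i) (k0 + j))"
      and TB: "tail_bounded (m - k0) (n - k0) n2 \<tau> (\<lambda>i j. h (k0 + i) (k0 + j))" by blast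
    show "maximal h"
      unfolding maximal_def
    proof (intro allI impI)
      fix P Q assume P: "orth m P" and Q: "orth n Q" and act: "leading_trace k m n P Q x = ky_fan k m n x"
      show "leading_trace k m n P Q h \<le> frobenius m n S h"
      proof (rule bound_from_block_form[OF P Q act _ BC[folded k1m] tau(2)])
        show "k1 - k0 \<le> n - k0" using k1 mn by simp
        fix l
        show "(\<Sum>i<m - k0. \<Sum>j<n - k0. P (k0 + i) l *
            (if i < n1 \<and> j < n1 then (if i = j then \<tau> else 0) else h (k0 + i) (k0 + j)) * Q (k0 + j) l)
          \<le> \<tau> * ((\<Sum>i<m - k0. (P (k0 + i) l)\<^sup>2) + (\<Sum>j<n - k0. (Q (k0 + j) l)\<^sup>2)) / 2"
        proof (rule block_diagonal_form_bound[where ?n2.0 = n2])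
          show "n2 \<le> m - k0" using n12 k1m by simp
          show "m - k0 \<le> n - k0" by (rule NN)
          show "(if i < n1 \<and> j < n1 then (if i
              = j then \<tau> else 0) else h (k0 + i) (k0 + j)) = (if i = j then \<tau> else 0)"
            if "i < m - k0" "j < n - k0" "i < n2 \<or> j < n2" for i j
            using leading_block_formD(1)[OF BC that] by (cases "i < n1 \<and> j < n1") auto
          show "0 \<le> \<tau> \<or> (\<forall>i<n2. P (k0 + i) l = Q (k0 + i) l)" using tau by simp
          have nb: "\<not> (n2 + i < n1 \<and> n2 + j < n1)" for i j using n12 by simp
          show "(\<Sum>i<m - k0 - n2. \<Sum>j<n - k0 - n2. P (k0 + (n2 + i)) l *
              (if n2 + i < n1 \<and> n2 + j < n1 then (if n2 + i = n2 + j then \<tau> else 0)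
               else h (k0 + (n2 + i)) (k0 + (n2 + j))) * Q (k0 + (n2 + j)) l)
            \<le> \<tau> * ((\<Sum>i<m - k0 - n2. (P (k0 + (n2 + i)) l)\<^sup>2) + (\<Sum>j<n - k0 - n2. (Q (k0 + (n2 + j)) l)\<^sup>2)) / 2"
            unfolding if_not_P[OF nb]
            using TB[unfolded tail_bounded_def, rule_format,
              of "\<lambda>i. P (k0 + (n2 + i)) l" "\<lambda>j. Q (k0 + (n2 + j)) l"] .
        qed
      qed
    qed
  qed
qed

text \<open>If the tied entries are positive, active functionals have \<open>P = Q\<close> on the first \<open>k1\<close> rows and vanish
beyond, so only the symmetric part \<open>A\<close> of the block of \<open>h\<close> matters. An eigendecomposition of \<open>A\<close>, shifted by
a multiple of the identity that makes all eigenvalues nonnegative, is a singular value decomposition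
with equal bases, so \<open>block_form_if_maximizer\<close> applies; the total \<open>\<Sum> s = k\<close> makes the shift harmless. As
the shift is undone at the end, \<open>\<tau>\<close> may be negative here.\<close>

theorem maximal_iff_positive_case:
  fixes h :: "nat \<Rightarrow> nat \<Rightarrow> real"
  assumes pos: "\<xi> (k - 1) > 0"
  defines "A \<equiv> \<lambda>i j. (h (k0 + i) (k0 + j) + h (k0 + j) (k0 + i)) / 2"
  shows "maximal h \<longleftrightarrow> (\<exists>\<tau>. leading_block_form (k1 - k0) (k1 - k0) n1 n2 \<tau> A \<and>
    (\<forall>p. (\<Sum>i<k1 - k0 - n2. \<Sum>j<k1 - k0 - n2. p i * A (n2 + i) (n2 + j) * p j)
       \<le> \<tau> * (\<Sum>i<k1 - k0 - n2. (p i)\<^sup>2)))"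
proof -
  define N where "N = k1 - k0"
  have full: "(\<Sum>i<m. s i) = real k" using slack pos by simp
  have dims: "k0 \<le> k" "k \<le> k0 + N" "N \<le> N" "k0 + N \<le> m" "k0 + N \<le> n" "k - k0 \<le> N" "1 \<le> N" "k0 \<le> m" "k0 \<le> n"
    using k0 k1 k mn by (auto simp: N_def)
  have Asym: "A i j = A j i" for i j by (simp add: A_def add.commute)
  show ?thesis
  proof
    assume max: "maximal h"
    obtain Q \<nu> where Q: "orth N Q" and desc: "\<And>i j. i \<le> j \<Longrightarrow> j < N \<Longrightarrow> \<nu> j \<le> \<nu> i"
      and dec: "\<And>i j. i < N \<Longrightarrow> j < N \<Longrightarrow> A i j = (\<Sum>l<N. \<nu> l * Q i l * Q j l)"
      using spectral_decomposition[of N A] Asym by blast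
    \<comment> \<open>\<open>\<nu> (N - 1)\<close> is the smallest eigenvalue, so this shift makes all eigenvalues nonnegative.\<close>
    define c where "c = \<bar>\<nu> (N - 1)\<bar>"
    define B where "B = (\<lambda>i j. A i j + c * (if i = j then 1 else 0))"
    define \<mu> where "\<mu> = (\<lambda>l. \<nu> l + c)"
    have svd: "is_svd N N B \<mu> Q Q"
      unfolding is_svd_def
    proof (intro conjI allI impI Q)
      fix i j assume ij: "i < N" "j < N"
      have "(\<Sum>l<N. \<mu> l * Q i l * Q j l) = (\<Sum>l<N. \<nu> l * Q i l * Q j l) + c * (\<Sum>l<N. Q i l * Q j l)"
        by (simp add: \<mu>_def sum.distrib[symmetric] sum_distrib_left algebra_simps)
      then show "B i j = (\<Sum>l<N. \<mu> l * Q i l * Q j l)"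
        using dec[OF ij] orth_rows[OF Q ij] by (simp add: B_def)
    next
      fix l assume "l < N"
      then have "\<nu> (N - 1) \<le> \<nu> l" using desc[of l "N - 1"] by simp
      then show "0 \<le> \<mu> l" by (simp add: \<mu>_def c_def)
    next
      fix i j assume "i \<le> j" "j < N"
      then show "\<mu> j \<le> \<mu> i" using desc[of i j] by (simp add: \<mu>_def)
    qed
    have unit: "leading_trace (k - k0) N N Q Q (\<lambda>i j. if i = j then 1 else 0) = real k - real k0"
    proof -
      have "leading_trace (k - k0) N N Q Q (\<lambda>i j. if i = j then 1 else 0) = (\<Sum>l<k - k0. \<Sum>i<N. Q i l * Q i l)"
        unfolding leading_trace_def
      proof (intro sum.cong refl)
        fix l i assume "i \<in> {..<N}"
        have "(\<Sum>j<N. Q i l * (if i = j then 1 else 0) * Q j l) = (\<Sum>j<N. if j = i then Q i l * Q i l else 0)"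
          by (intro sum.cong) auto
        then show "(\<Sum>j<N. Q i l * (if i = j then 1 else 0) * Q j l) = Q i l * Q i l"
          using \<open>i \<in> {..<N}\<close> by simp
      qed
      also have "\<dots> = (\<Sum>l<k - k0. 1)" using orth_cols[OF Q] dims by (intro sum.cong) auto
      finally show ?thesis using k0 by simp
    qed
    note embed = leading_trace_embed[OF dims(1-5) mn Q Q]
    have "leading_trace (k - k0) N N Q Q (\<lambda>i j. x (k0 + i) (k0 + j))
        = leading_trace (k - k0) N N Q Q (\<lambda>i j. 0 + \<xi> (k - 1) * (if i = j then 1 else 0))"
      unfolding leading_trace_frobenius
    proof (rule frobenius_cong)
      fix i j assume "i < N" "j < N"
      then show "x (k0 + i) (k0 + j) = 0 + \<xi> (k - 1) * (if i = j then 1 else 0)"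
        using x[of "k0 + i" "k0 + j"] tied[of "k0 + i"] dims by (auto simp: N_def)
    qed simp
    also have "\<dots> = \<xi> (k - 1) * (real k - real k0)"
      unfolding leading_trace_add_right unit by (simp add: leading_trace_def)
    finally have xb: "leading_trace (k - k0) N N Q Q (\<lambda>i j. x (k0 + i) (k0 + j))
        = \<xi> (k - 1) * (real k - real k0)" .
    have tie: "(\<Sum>l<k - k0. \<xi> (k0 + l)) = \<xi> (k - 1) * (real k - real k0)"
    proof -
      have "(\<Sum>l<k - k0. \<xi> (k0 + l)) = (\<Sum>l<k - k0. \<xi> (k - 1))"
        by (intro sum.cong refl tied) (use k1 in auto)
      then show ?thesis using k0 by (simp add: mult.commute)
    qed
    have top: "(\<Sum>e<k0. x e e) = (\<Sum>e<k0. \<xi> e)" using x k0 k mn by (intro sum.cong) auto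
    have act: "leading_trace k m n (embed k0 N Q) (embed k0 N Q) x = ky_fan k m n x"
      unfolding embed ky_fan_x xb top sum_lessThan_split[OF dims(1), of \<xi>] tie ..
    have hb: "leading_trace (k - k0) N N Q Q (\<lambda>i j. h (k0 + i) (k0 + j)) = leading_trace (k - k0) N N Q Q A"
      unfolding leading_trace_def A_def
      using bilinear_form_sym_part[of N "\<lambda>i j. h (k0 + i) (k0 + j)", unfolded bilinear_form_def] by simp
    have "(\<Sum>l<k - k0. \<mu> l) = leading_trace (k - k0) N N Q Q A + c * (real k - real k0)"
      unfolding leading_trace_singular_vectors[OF dims(6,3) svd, symmetric] B_def leading_trace_add_right unit ..
    moreover have "leading_trace k m n (embed k0 N Q) (embed k0 N Q) h \<le> frobenius m n S h"
      using max orth_embed[OF Q dims(4)] orth_embed[OF Q dims(5)] act unfolding maximal_def by blast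
    then have "leading_trace (k - k0) N N Q Q A \<le> (\<Sum>i<N. s (k0 + i) * A i i)"
      unfolding embed frobenius_S sum_s_split hb by (simp add: A_def N_def)
    moreover have "(\<Sum>i<N. s (k0 + i) * B i i) = (\<Sum>i<N. s (k0 + i) * A i i) + c * (real k - real k0)"
    proof -
      have "(\<Sum>i<N. s (k0 + i) * B i i) = (\<Sum>i<N. s (k0 + i) * A i i) + c * (\<Sum>i<N. s (k0 + i))"
        by (simp add: B_def sum_distrib_left sum.distrib[symmetric] algebra_simps)
      then show ?thesis using sum_s full by (simp add: N_def)
    qed
    ultimately have "(\<Sum>l<k - k0. \<mu> l) \<le> (\<Sum>i<k1 - k0. s (k0 + i) * B i i)" by (simp add: N_def)
    from block_form_if_maximizer[OF order_refl svd[unfolded N_def] this]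
    obtain \<tau> where BC: "leading_block_form N N n1 n2 \<tau> B" and TB: "tail_bounded N N n2 \<tau> B"
      unfolding N_def by blast
    have "leading_block_form N N n1 n2 (\<tau> - c) A"
      unfolding leading_block_form_def
    proof (intro conjI allI impI)
      fix i j assume ij: "i < N" "j < N" "i < n2 \<or> j < n2" "\<not> (i < n1 \<and> j < n1)"
      show "A i j = (if i = j then \<tau> - c else 0)"
        using leading_block_formD(1)[OF BC ij] by (cases "i = j") (auto simp: B_def)
    next
      fix v :: "nat \<Rightarrow> real"
      have "(\<Sum>i<n1. \<Sum>j<n1. v i * B i j * v j) = (\<Sum>i<n1. \<Sum>j<n1. v i * A i j * v j) +
          (\<Sum>i<n1. \<Sum>j<n1. if j = i then c * (v i)\<^sup>2 else 0)"
        unfolding sum.distrib[symmetric] B_def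
        by (intro sum.cong refl) (auto simp: algebra_simps power2_eq_square)
      then show "(\<tau> - c) * (\<Sum>i<n1. (v i)\<^sup>2) \<le> (\<Sum>i<n1. \<Sum>j<n1. v i * A i j * v j)"
        using leading_block_formD(3)[OF BC, of v] by (simp add: sum_distrib_left[symmetric] algebra_simps)
    qed (rule Asym)
    moreover have "(\<Sum>i<N - n2. \<Sum>j<N - n2. p i * A (n2 + i) (n2 + j) * p j)
        \<le> (\<tau> - c) * (\<Sum>i<N - n2. (p i)\<^sup>2)" for p
    proof -
      have "(\<Sum>i<N - n2. \<Sum>j<N - n2. p i * B (n2 + i) (n2 + j) * p j) =
          (\<Sum>i<N - n2. \<Sum>j<N - n2. p i * A (n2 + i) (n2 + j) * p j) +
          (\<Sum>i<N - n2. \<Sum>j<N - n2. if j = i then c * (p i)\<^sup>2 else 0)"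
        unfolding sum.distrib[symmetric] B_def
        by (intro sum.cong refl) (auto simp: algebra_simps power2_eq_square)
      moreover have "(\<Sum>i<N - n2. \<Sum>j<N - n2. p i * B (n2 + i) (n2 + j) * p j) \<le> \<tau> * (\<Sum>i<N - n2. (p i)\<^sup>2)"
        using TB[unfolded tail_bounded_def, rule_format, of p p] by simp
      ultimately show ?thesis by (simp add: sum_distrib_left[symmetric] algebra_simps)
    qed
    ultimately show "\<exists>\<tau>. leading_block_form (k1 - k0) (k1 - k0) n1 n2 \<tau> A \<and>
      (\<forall>p. (\<Sum>i<k1 - k0 - n2. \<Sum>j<k1 - k0 - n2. p i * A (n2 + i) (n2 + j) * p j)
         \<le> \<tau> * (\<Sum>i<k1 - k0 - n2. (p i)\<^sup>2))"
      unfolding N_def by blast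
  next
    assume "\<exists>\<tau>. leading_block_form (k1 - k0) (k1 - k0) n1 n2 \<tau> A \<and>
      (\<forall>p. (\<Sum>i<k1 - k0 - n2. \<Sum>j<k1 - k0 - n2. p i * A (n2 + i) (n2 + j) * p j)
         \<le> \<tau> * (\<Sum>i<k1 - k0 - n2. (p i)\<^sup>2))"
    then obtain \<tau> where BC: "leading_block_form N N n1 n2 \<tau> A"
      and TB: "\<And>p. (\<Sum>i<N - n2. \<Sum>j<N - n2. p i * A (n2 + i) (n2 + j) * p j) \<le> \<tau> * (\<Sum>i<N - n2. (p i)\<^sup>2)"
      unfolding N_def by blast
    \<comment> \<open>Active functionals take the same value at \<open>h\<close> and at \<open>g\<close>, which has the block form.\<close>
    define g where "g = (\<lambda>i j. if i < k1 \<and> j < k1 then (h i j + h j i) / 2 else 0)"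
    have gA: "g (k0 + i) (k0 + j) = A i j" if "i < N" "j < N" for i j
      using that by (auto simp: g_def A_def N_def)
    have gBC: "leading_block_form N N n1 n2 \<tau> (\<lambda>i j. g (k0 + i) (k0 + j))"
    proof -
      have "n1 \<le> N" using n12 by (simp add: N_def)
      then show ?thesis using BC gA unfolding leading_block_form_def by simp
    qed
    show "maximal h"
      unfolding maximal_def
    proof (intro allI impI)
      fix P Q assume P: "orth m P" and Q: "orth n Q" and act: "leading_trace k m n P Q x = ky_fan k m n x"
      have eq: "P e l = Q e l" if "e < m" "l < k" for e l
        by (rule active_rows(4)[OF k mn P Q x \<xi> act that pos])
      have Pz: "P e l = 0" if "k1 \<le> e" "e < m" "l < k" for e l
        using active_rows(3)[OF k mn P Q x \<xi> act that(2,3) below[OF that(1,2)]] by simp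
      have Qz: "Q e l = 0" if "k1 \<le> e" "e < n" "l < k" for e l
      proof (cases "e < m")
        case True
        then show ?thesis using Pz eq that by metis
      next
        case False
        show ?thesis by (rule active_rows(5)[OF k mn P Q x \<xi> act _ that(2,3) pos]) (use False in simp_all)
      qed
      have k1n: "k1 \<le> n" using k1 mn by simp
      have restrict: "(\<Sum>i<m. \<Sum>j<n. P i l * f i j * Q j l) = bilinear_form k1 f (\<lambda>i. P i l) (\<lambda>i. P i l)"
        if l: "l < k" for f l
      proof -
        have "(\<Sum>i<m. \<Sum>j<n. P i l * f i j * Q j l)
          = (\<Sum>i<m. if i < k1 then (\<Sum>j<n. if j < k1 then P i l * f i j * P j l else 0) else 0)"
        proof (intro sum.cong refl)
          fix i assume i: "i \<in> {..<m}"
          show "(\<Sum>j<n. P i l * f i j * Q j l)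
              = (if i < k1 then (\<Sum>j<n. if j < k1 then P i l * f i j * P j l else 0) else 0)"
          proof (cases "i < k1")
            case True
            have "P i l * f i j * Q j l = (if j < k1 then P i l * f i j * P j l else 0)" if "j < n" for j
              using Qz[of j l] eq[of j l] that l k1 by (cases "j < k1") auto
            then show ?thesis using True by simp
          next
            case False
            then show ?thesis using Pz[of i l] i l by simp
          qed
        qed
        then show ?thesis
          unfolding sum_lessThan_if_less[OF k1(2)] sum_lessThan_if_less[OF k1n] bilinear_form_def .
      qed
      have "leading_trace k m n P Q h = (\<Sum>l<k. bilinear_form k1 h (\<lambda>i. P i l) (\<lambda>i. P i l))"
        unfolding leading_trace_def using restrict by simp
      also have "\<dots> = (\<Sum>l<k. bilinear_form k1 g (\<lambda>i. P i l) (\<lambda>i. P i l))"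
        unfolding bilinear_form_sym_part[of k1 h, symmetric] by (simp add: bilinear_form_def g_def)
      also have "\<dots> = leading_trace k m n P Q g"
        unfolding leading_trace_def using restrict by simp
      also have "\<dots> \<le> frobenius m n S g"
      proof (rule bound_from_block_form[OF P Q act order_refl gBC[unfolded N_def]])
        show "\<tau> * (real k - (\<Sum>i<m. s i)) = 0" using full by simp
        fix l assume l: "l < k"
        have d2: "n2 \<le> m - k0" "n1 \<le> N" "n2 \<le> N" "N \<le> m - k0" "N \<le> n - k0" using n12 k1 mn by (auto simp: N_def)
        have trunc: "(\<Sum>i<m - k0. f i (P (k0 + i) l)) = (\<Sum>i<N. f i (P (k0 + i) l))"
          if "\<And>i. f i 0 = 0" for f :: "nat \<Rightarrow> real \<Rightarrow> real"
        proof -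
          have "(\<Sum>i<m - k0. f i (P (k0 + i) l)) = (\<Sum>i<m - k0. if i < N then f i (P (k0 + i) l) else 0)"
            using Pz[of _ l] that l dims by (intro sum.cong) (auto simp: N_def)
          then show ?thesis unfolding sum_lessThan_if_less[OF d2(4)] .
        qed
        have truncQ: "(\<Sum>i<n - k0. f i (Q (k0 + i) l)) = (\<Sum>i<N. f i (P (k0 + i) l))"
          if "\<And>i. f i 0 = 0" for f :: "nat \<Rightarrow> real \<Rightarrow> real"
        proof -
          have "(\<Sum>i<n - k0. f i (Q (k0 + i) l)) = (\<Sum>i<n - k0. if i < N then f i (P (k0 + i) l) else 0)"
          proof (intro sum.cong refl)
            fix i assume "i \<in> {..<n - k0}"
            then show "f i (Q (k0 + i) l) = (if i < N then f i (P (k0 + i) l) else 0)"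
              using Qz[of "k0 + i" l] eq[of "k0 + i" l] that l dims by (auto simp: N_def)
          qed
          then show ?thesis unfolding sum_lessThan_if_less[OF d2(5)] .
        qed
        define p where "p = (\<lambda>i. P (k0 + i) l)"
        define R where "R = (\<lambda>i j. if i < n1 \<and> j < n1 then (if i = j then \<tau> else 0) else g (k0 + i) (k0 + j))"
        have "(\<Sum>i<N. \<Sum>j<N. p i * R i j * p j) \<le> \<tau> * ((\<Sum>i<N. (p i)\<^sup>2) + (\<Sum>j<N. (p j)\<^sup>2)) / 2"
        proof (rule block_diagonal_form_bound[OF d2(3) order_refl])
          show "R i j = (if i = j then \<tau> else 0)" if "i < N" "j < N" "i < n2 \<or> j < n2" for i j
            using leading_block_formD(1)[OF gBC that] by (cases "i < n1 \<and> j < n1") (auto simp: R_def)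
          have "R (n2 + i) (n2 + j) = A (n2 + i) (n2 + j)" if "i < N - n2" "j < N - n2" for i j
            using n12 gA[of "n2 + i" "n2 + j"] that by (simp add: R_def)
          then show "(\<Sum>i<N - n2. \<Sum>j<N - n2. p (n2 + i) * R (n2 + i) (n2 + j) * p (n2 + j))
             \<le> \<tau> * ((\<Sum>i<N - n2. (p (n2 + i))\<^sup>2) + (\<Sum>j<N - n2. (p (n2 + j))\<^sup>2)) / 2"
            using TB[of "\<lambda>i. p (n2 + i)"] by simp
        qed simp
        moreover have "(\<Sum>i<m - k0. \<Sum>j<n - k0. P (k0 + i) l * R i j * Q (k0 + j) l)
            = (\<Sum>i<N. \<Sum>j<N. p i * R i j * p j)"
          using trunc[of "\<lambda>i a. \<Sum>j<n - k0. a * R i j * Q (k0 + j) l"]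
            truncQ[of "\<lambda>j b. p _ * R _ j * b"] by (simp add: p_def)
        moreover have "(\<Sum>i<m - k0. (P (k0 + i) l)\<^sup>2) = (\<Sum>i<N. (p i)\<^sup>2)"
          using trunc[of "\<lambda>i a. a\<^sup>2"] by (simp add: p_def)
        moreover have "(\<Sum>i<n - k0. (Q (k0 + i) l)\<^sup>2) = (\<Sum>i<N. (p i)\<^sup>2)"
          using truncQ[of "\<lambda>i a. a\<^sup>2"] by (simp add: p_def)
        ultimately show "(\<Sum>i<m - k0. \<Sum>j<n - k0. P (k0 + i) l *
            (if i < n1 \<and> j < n1 then (if i = j then \<tau> else 0) else g (k0 + i) (k0 + j)) * Q (k0 + j) l)
          \<le> \<tau> * ((\<Sum>i<m - k0. (P (k0 + i) l)\<^sup>2) + (\<Sum>j<n - k0. (Q (k0 + j) l)\<^sup>2)) / 2"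
          unfolding R_def by simp
      qed
      also have "frobenius m n S g = frobenius m n S h"
        unfolding frobenius_S
      proof (intro sum.cong refl)
        fix i assume "i \<in> {..<m}"
        then show "s i * g i i = s i * h i i" using s_gamma[of i] by (cases "i < k1") (auto simp: g_def)
      qed
      finally show "leading_trace k m n P Q h \<le> frobenius m n S h" .
    qed
  qed
qed

end

section \<open>Block forms in matrix notation\<close>

lemma rayleigh_expand:
  assumes Q: "orth n Q"
    and dec: "\<And>i j. i < n \<Longrightarrow> j < n \<Longrightarrow> A i j = (\<Sum>l<n. \<nu> l * Q i l * Q j l)"
  shows "(\<Sum>i<n. \<Sum>j<n. v i * A i j * v j) = (\<Sum>l<n. \<nu> l * (\<Sum>i<n. Q i l * v i)\<^sup>2)"
    and "(\<Sum>i<n. (v i)\<^sup>2) = (\<Sum>l<n. (\<Sum>i<n. Q i l * v i)\<^sup>2)"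
    and "l < n \<Longrightarrow> (\<Sum>i<n. \<Sum>j<n. Q i l * A i j * Q j l) = \<nu> l"
    and "l < n \<Longrightarrow> (\<Sum>i<n. (Q i l)\<^sup>2) = 1"
proof -
  have e: "(\<Sum>i<n. \<Sum>j<n. v i * A i j * v j) = (\<Sum>l<n. \<nu> l * (\<Sum>i<n. Q i l * v i)\<^sup>2)" for v
  proof -
    have "(\<Sum>i<n. \<Sum>j<n. v i * A i j * v j) = (\<Sum>i<n. \<Sum>j<n. v i * (\<Sum>l<n. \<nu> l * Q i l * Q j l) * v j)"
      using dec by (intro sum.cong refl) simp
    also have "\<dots> = (\<Sum>l<n. \<nu> l * (\<Sum>i<n. Q i l * v i) * (\<Sum>i<n. Q i l * v i))"
      by (rule bilinear_svd_expand)
    finally show ?thesis by (simp add: power2_eq_square mult.assoc)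
  qed
  show "(\<Sum>i<n. \<Sum>j<n. v i * A i j * v j) = (\<Sum>l<n. \<nu> l * (\<Sum>i<n. Q i l * v i)\<^sup>2)" by (rule e)
  show "(\<Sum>i<n. (v i)\<^sup>2) = (\<Sum>l<n. (\<Sum>i<n. Q i l * v i)\<^sup>2)"
    using orth_parseval[OF Q, of v v] by (simp add: power2_eq_square)
  assume l: "l < n"
  have "(\<Sum>i<n. \<Sum>j<n. Q i l * A i j * Q j l) = (\<Sum>e<n. if e = l then \<nu> e else 0)"
    unfolding e[of "\<lambda>i. Q i l"] using orth_cols[OF Q _ l] by (intro sum.cong) auto
  then show "(\<Sum>i<n. \<Sum>j<n. Q i l * A i j * Q j l) = \<nu> l" using l by simp
  show "(\<Sum>i<n. (Q i l)\<^sup>2) = 1" using orth_cols[OF Q l l] by (simp add: power2_eq_square)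
qed

text \<open>Rayleigh quotients: in an eigenbasis the form is a weighted sum of squares, and the extreme values are
attained at eigenvectors.\<close>

lemma ordered_eigenvalue_bounds:
  assumes A: "A \<in> carrier_mat n n" and sym: "\<And>i j. i < n \<Longrightarrow> j < n \<Longrightarrow> A $$ (i, j) = A $$ (j, i)" and n: "0 < n"
  shows smallest_eigenvalue_ge_iff: "\<tau> \<le> ord_eigval n A \<longleftrightarrow>
      (\<forall>v. \<tau> * (\<Sum>i<n. (v i)\<^sup>2) \<le> (\<Sum>i<n. \<Sum>j<n. v i * A $$ (i, j) * v j))"
    and largest_eigenvalue_le_iff: "ord_eigval 1 A \<le> \<tau> \<longleftrightarrow>
      (\<forall>v. (\<Sum>i<n. \<Sum>j<n. v i * A $$ (i, j) * v j) \<le> \<tau> * (\<Sum>i<n. (v i)\<^sup>2))"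
proof -
  obtain Q \<nu> where Q: "orth n Q" and desc: "\<And>i j. i \<le> j \<Longrightarrow> j < n \<Longrightarrow> \<nu> j \<le> \<nu> i"
    and dec: "\<And>i j. i < n \<Longrightarrow> j < n \<Longrightarrow> A $$ (i, j) = (\<Sum>l<n. \<nu> l * Q i l * Q j l)"
    using spectral_decomposition[of n "\<lambda>i j. A $$ (i, j)"] sym by blast
  have ev: "ord_eigval (Suc l) A = \<nu> l" if "l < n" for l
    by (rule ord_eigval_eqI[OF A Q desc dec that])
  have last: "ord_eigval n A = \<nu> (n - 1)" using ev[of "n - 1"] n by simp
  have first: "ord_eigval 1 A = \<nu> 0" using ev[of 0] n by simp
  have R1: "(\<Sum>i<n. \<Sum>j<n. v i * A $$ (i, j) * v j) = (\<Sum>l<n. \<nu> l * (\<Sum>i<n. Q i l * v i)\<^sup>2)" for v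
    by (rule rayleigh_expand(1)[OF Q dec])
  have R2: "(\<Sum>i<n. (v i)\<^sup>2) = (\<Sum>l<n. (\<Sum>i<n. Q i l * v i)\<^sup>2)" for v
    by (rule rayleigh_expand(2)[OF Q dec])
  have R3: "(\<Sum>i<n. \<Sum>j<n. Q i l * A $$ (i, j) * Q j l) = \<nu> l" if "l < n" for l
    by (rule rayleigh_expand(3)[OF Q dec that])
  have R4: "(\<Sum>i<n. (Q i l)\<^sup>2) = 1" if "l < n" for l
    by (rule rayleigh_expand(4)[OF Q dec that])
  show "\<tau> \<le> ord_eigval n A \<longleftrightarrow>
      (\<forall>v. \<tau> * (\<Sum>i<n. (v i)\<^sup>2) \<le> (\<Sum>i<n. \<Sum>j<n. v i * A $$ (i, j) * v j))"
  proof
    assume le: "\<tau> \<le> ord_eigval n A"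
    show "\<forall>v. \<tau> * (\<Sum>i<n. (v i)\<^sup>2) \<le> (\<Sum>i<n. \<Sum>j<n. v i * A $$ (i, j) * v j)"
    proof
      fix v :: "nat \<Rightarrow> real"
      have "\<tau> \<le> \<nu> l" if "l < n" for l
      proof -
        have "\<nu> (n - 1) \<le> \<nu> l" by (rule desc) (use that in auto)
        then show ?thesis using le last by simp
      qed
      then show "\<tau> * (\<Sum>i<n. (v i)\<^sup>2) \<le> (\<Sum>i<n. \<Sum>j<n. v i * A $$ (i, j) * v j)"
        unfolding R1 R2[of v] sum_distrib_left by (intro sum_mono mult_right_mono) auto
    qed
  next
    assume all: "\<forall>v. \<tau> * (\<Sum>i<n. (v i)\<^sup>2) \<le> (\<Sum>i<n. \<Sum>j<n. v i * A $$ (i, j) * v j)"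
    show "\<tau> \<le> ord_eigval n A"
      using all[rule_format, of "\<lambda>i. Q i (n - 1)"] R3[of "n - 1"] R4[of "n - 1"] n last by simp
  qed
  show "ord_eigval 1 A \<le> \<tau> \<longleftrightarrow>
      (\<forall>v. (\<Sum>i<n. \<Sum>j<n. v i * A $$ (i, j) * v j) \<le> \<tau> * (\<Sum>i<n. (v i)\<^sup>2))"
  proof
    assume le: "ord_eigval 1 A \<le> \<tau>"
    show "\<forall>v. (\<Sum>i<n. \<Sum>j<n. v i * A $$ (i, j) * v j) \<le> \<tau> * (\<Sum>i<n. (v i)\<^sup>2)"
    proof
      fix v :: "nat \<Rightarrow> real"
      have "\<nu> l \<le> \<tau>" if "l < n" for l using desc[of 0 l] le first that by simp
      then show "(\<Sum>i<n. \<Sum>j<n. v i * A $$ (i, j) * v j) \<le> \<tau> * (\<Sum>i<n. (v i)\<^sup>2)"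
        unfolding R1 R2[of v] sum_distrib_left by (intro sum_mono mult_right_mono) auto
    qed
  next
    assume all: "\<forall>v. (\<Sum>i<n. \<Sum>j<n. v i * A $$ (i, j) * v j) \<le> \<tau> * (\<Sum>i<n. (v i)\<^sup>2)"
    show "ord_eigval 1 A \<le> \<tau>"
      using all[rule_format, of "\<lambda>i. Q i 0"] R3[of 0] R4[of 0] n first by simp
  qed
qed

text \<open>The form is stated with the arithmetic mean of the squared lengths instead of the product of the
lengths, as in \<open>tail_bounded\<close>; for \<open>\<tau> \<ge> 0\<close> both bounds are equivalent by scaling.\<close>

lemma largest_singular_value_le_iff:
  assumes B: "B \<in> carrier_mat m n" and mn: "m \<le> n" and m: "0 < m" and tau: "0 \<le> \<tau>"
  shows "sing_val 1 B \<le> \<tau> \<longleftrightarrow> (\<forall>p q. (\<Sum>i<m. \<Sum>j<n. p i * B $$ (i, j) * q j) \<le>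
    \<tau> * ((\<Sum>i<m. (p i)\<^sup>2) + (\<Sum>j<n. (q j)\<^sup>2)) / 2)"
proof -
  obtain y P Q where svd: "is_svd m n (entries B) y P Q" using svd_exists[OF mn] by blast
  note S = is_svdD[OF svd]
  have y0: "sing_val 1 B = y 0" using sing_val_eqI[OF B mn svd m] by simp
  have dec: "(\<Sum>i<m. \<Sum>j<n. p i * B $$ (i, j) * q j) =
      (\<Sum>i<m. \<Sum>j<n. p i * (\<Sum>l<m. y l * P i l * Q j l) * q j)" for p q
    using S(3) by (intro sum.cong refl) simp
  show ?thesis
  proof
    assume le: "sing_val 1 B \<le> \<tau>"
    have yt: "y l \<le> \<tau>" if "l < m" for l using S(5)[of 0 l] le y0 that by simp
    show "\<forall>p q. (\<Sum>i<m. \<Sum>j<n. p i * B $$ (i, j) * q j) \<le>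
      \<tau> * ((\<Sum>i<m. (p i)\<^sup>2) + (\<Sum>j<n. (q j)\<^sup>2)) / 2"
      unfolding dec by (intro allI bilinear_form_bound[OF S(1,2) mn S(4) yt tau])
  next
    assume all: "\<forall>p q. (\<Sum>i<m. \<Sum>j<n. p i * B $$ (i, j) * q j) \<le>
      \<tau> * ((\<Sum>i<m. (p i)\<^sup>2) + (\<Sum>j<n. (q j)\<^sup>2)) / 2"
    have "(\<Sum>i<m. \<Sum>j<n. P i 0 * B $$ (i, j) * Q j 0) =
        (\<Sum>l<m. y l * (\<Sum>i<m. P i l * P i 0) * (\<Sum>j<n. Q j l * Q j 0))"
      unfolding dec by (rule bilinear_svd_expand)
    also have "\<dots> = (\<Sum>l<m. if l = 0 then y 0 else 0)"
      using orth_cols[OF S(1)] orth_cols[OF S(2)] m mn by (intro sum.cong) auto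
    finally have "(\<Sum>i<m. \<Sum>j<n. P i 0 * B $$ (i, j) * Q j 0) = y 0" using m by simp
    moreover have "(\<Sum>i<m. (P i 0)\<^sup>2) = 1" "(\<Sum>j<n. (Q j 0)\<^sup>2) = 1"
      using orth_cols[OF S(1) m m] orth_cols[OF S(2), of 0 0] m mn by (auto simp: power2_eq_square)
    ultimately show "sing_val 1 B \<le> \<tau>"
      using all[rule_format, of "\<lambda>i. P i 0" "\<lambda>j. Q j 0"] y0 by simp
  qed
qed

lemma psd_mat_iff:
  assumes A: "A \<in> carrier_mat n n" and sym: "\<And>i j. i < n \<Longrightarrow> j < n \<Longrightarrow> A $$ (i, j) = A $$ (j, i)"
  shows "psd_mat A \<longleftrightarrow> (\<forall>v. 0 \<le> (\<Sum>i<n. \<Sum>j<n. v i * A $$ (i, j) * v j))"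
proof -
  have form: "scalar_prod v (A *\<^sub>v v) = (\<Sum>i<n. \<Sum>j<n. v $ i * A $$ (i, j) * v $ j)"
    if "v \<in> carrier_vec n" for v
    using that A by (simp add: scalar_prod_def atLeast0LessThan sum_distrib_left mult.assoc)
  have trans: "transpose_mat A = A" using A sym by (intro eq_matI) auto
  have "(\<forall>v\<in>carrier_vec n. 0 \<le> scalar_prod v (A *\<^sub>v v)) \<longleftrightarrow>
      (\<forall>v. 0 \<le> (\<Sum>i<n. \<Sum>j<n. v i * A $$ (i, j) * v j))"
  proof (intro iffI allI ballI)
    fix v :: "nat \<Rightarrow> real" assume all: "\<forall>v\<in>carrier_vec n. 0 \<le> scalar_prod v (A *\<^sub>v v)"
    have "0 \<le> scalar_prod (vec n v) (A *\<^sub>v vec n v)" using all by simp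
    then show "0 \<le> (\<Sum>i<n. \<Sum>j<n. v i * A $$ (i, j) * v j)" by (simp add: form)
  next
    fix v :: "real vec" assume all: "\<forall>v. 0 \<le> (\<Sum>i<n. \<Sum>j<n. v i * A $$ (i, j) * v j)" and v: "v \<in> carrier_vec n"
    show "0 \<le> scalar_prod v (A *\<^sub>v v)" unfolding form[OF v] using all by blast
  qed
  then show ?thesis using A trans by (auto simp: psd_mat_def)
qed

lemma col_sub_interval:
  assumes A: "A \<in> carrier_mat r c" and q: "q \<le> c"
  shows "col_sub A {p+1..q} \<in> carrier_mat r (q - p)"
    and "\<And>i j. i < r \<Longrightarrow> j < q - p \<Longrightarrow> col_sub A {p+1..q} $$ (i, j) = A $$ (i, p + j)"
proof -
  have J: "{j. Suc j \<in> {p+1..q}} = {p..<q}" by auto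
  have cr: "card {i. i < dim_row A \<and> i \<in> UNIV} = r" using A by simp
  have "{j. j < dim_col A \<and> j \<in> {p..<q}} = {p..<q}" using A q by auto
  then have cc: "card {j. j < dim_col A \<and> j \<in> {p..<q}} = q - p" by simp
  show "col_sub A {p+1..q} \<in> carrier_mat r (q - p)"
    unfolding col_sub_def J by (intro carrier_matI) (simp_all only: dim_submatrix cr cc)
  fix i j assume i: "i < r" and j: "j < q - p"
  have "{a \<in> {p..<q}. a < p + j} = {p..<p + j}" using j by auto
  then have "pick {p..<q} j = p + j"
    using pick_card_in_set[of "p + j" "{p..<q}"] j by simp
  then show "col_sub A {p+1..q} $$ (i, j) = A $$ (i, p + j)"
    unfolding col_sub_def J using i j by (subst submatrix_index) (simp_all only: cr cc pick_UNIV)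
qed

text \<open>\<open>U\<^sub>I\<^sup>T H V\<^sub>J\<close> for intervals \<open>I\<close>, \<open>J\<close> of indices is a contiguous block of \<open>U\<^sup>T H V\<close>.\<close>

lemma compressed_block:
  fixes p p' q q' :: nat
  assumes U: "U \<in> carrier_mat m m" and V: "V \<in> carrier_mat n n" and H: "H \<in> carrier_mat m n"
    and q: "q \<le> m" "q' \<le> n"
  defines "M \<equiv> transpose_mat (col_sub U {p+1..q}) * H * col_sub V {p'+1..q'}"
  shows "M \<in> carrier_mat (q - p) (q' - p')"
    and "\<And>i j. i < q - p \<Longrightarrow> j < q' - p' \<Longrightarrow> M $$ (i, j) =
      change_basis m n (entries U) (entries V) (entries H) (p + i) (p' + j)"
proof -
  note CU = col_sub_interval[where p = p, OF U q(1)]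
  note CV = col_sub_interval[where p = p', OF V q(2)]
  show "M \<in> carrier_mat (q - p) (q' - p')" unfolding M_def using CU(1) CV(1) H by simp
  fix i j assume i: "i < q - p" and j: "j < q' - p'"
  have "M = transpose_mat (col_sub U {p+1..q}) * (H * col_sub V {p'+1..q'})"
    unfolding M_def by (rule assoc_mult_mat[of _ "q - p" m _ n _ "q' - p'"]) (use CU(1) CV(1) H in auto)
  then have "M $$ (i, j) = (\<Sum>a<m. U $$ (a, p + i) * (H * col_sub V {p'+1..q'}) $$ (a, j))"
    using CU CV(1) H i j by (simp add: scalar_prod_def atLeast0LessThan)
  also have "\<dots> = (\<Sum>a<m. U $$ (a, p + i) * (\<Sum>b<n. H $$ (a, b) * V $$ (b, p' + j)))"
    using CV H j by (intro sum.cong refl) (simp add: scalar_prod_def atLeast0LessThan)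
  finally show "M $$ (i, j) =
      change_basis m n (entries U) (entries V) (entries H) (p + i) (p' + j)"
    by (simp add: change_basis_def)
qed

lemma append_cols_index:
  assumes A: "A \<in> carrier_mat r c" and B: "B \<in> carrier_mat r c'"
  shows "append_cols A B \<in> carrier_mat r (c + c')"
    and "\<And>i j. i < r \<Longrightarrow> j < c + c' \<Longrightarrow>
      append_cols A B $$ (i, j) = (if j < c then A $$ (i, j) else B $$ (i, j - c))"
  using A B by (auto simp: append_cols_def)

lemma diag_block_mat_3_index:
  assumes "A \<in> carrier_mat n1 n1" "B \<in> carrier_mat c c" "C \<in> carrier_mat r r'"
  shows "diag_block_mat [A, B, C] \<in> carrier_mat (n1 + c + r) (n1 + c + r')"
    and "\<And>i j. i < n1 + c + r \<Longrightarrow> j < n1 + c + r' \<Longrightarrow> diag_block_mat [A, B, C] $$ (i, j) =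
      (if i < n1 \<and> j < n1 then A $$ (i, j)
       else if i < n1 \<or> j < n1 then 0
       else if i < n1 + c \<and> j < n1 + c then B $$ (i - n1, j - n1)
       else if i < n1 + c \<or> j < n1 + c then 0
       else C $$ (i - n1 - c, j - n1 - c))"
  using assms by (auto simp: Let_def)

lemma eq_diag_block_mat_iff:
  fixes M A C :: "real mat"
  assumes M: "M \<in> carrier_mat N N'" and n: "n1 \<le> n2" "n2 \<le> N" "n2 \<le> N'"
    and A: "A \<in> carrier_mat n1 n1" and C: "C \<in> carrier_mat (N - n2) (N' - n2)"
  shows "M = diag_block_mat [A, \<tau> \<cdot>\<^sub>m 1\<^sub>m (n2 - n1), C] \<longleftrightarrow>
    (\<forall>i<n1. \<forall>j<n1. M $$ (i, j) = A $$ (i, j)) \<and>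
    (\<forall>i<N. \<forall>j<N'. (i < n2 \<or> j < n2) \<longrightarrow> \<not> (i < n1 \<and> j < n1) \<longrightarrow> M $$ (i, j) = (if i = j then \<tau> else 0)) \<and>
    (\<forall>i<N - n2. \<forall>j<N' - n2. M $$ (n2 + i, n2 + j) = C $$ (i, j))"
proof -
  define D where "D = diag_block_mat [A, \<tau> \<cdot>\<^sub>m 1\<^sub>m (n2 - n1), C]"
  have B: "\<tau> \<cdot>\<^sub>m 1\<^sub>m (n2 - n1) \<in> carrier_mat (n2 - n1) (n2 - n1)" by simp
  have dims: "n1 + (n2 - n1) = n2" "n2 + (N - n2) = N" "n2 + (N' - n2) = N'" using n by auto
  note DI = diag_block_mat_3_index[OF A B C, folded D_def, unfolded dims]
  have D1: "D $$ (i, j) = A $$ (i, j)" if "i < n1" "j < n1" for i j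
    using DI(2)[of i j] that n by simp
  have D2: "D $$ (i, j) = (if i = j then \<tau> else 0)"
    if ij: "i < N" "j < N'" "i < n2 \<or> j < n2" "\<not> (i < n1 \<and> j < n1)" for i j
  proof -
    consider "i < n1 \<or> j < n1" | "n1 \<le> i" "n1 \<le> j" "i < n2" "j < n2" | "n1 \<le> i" "n1 \<le> j" "\<not> (i < n2 \<and> j < n2)"
      by linarith
    then show ?thesis
    proof cases
      case 1
      then show ?thesis using DI(2)[OF ij(1,2)] ij(4) by auto
    next
      case 2
      then have "i - n1 < n2 - n1" "j - n1 < n2 - n1" "i - n1 = j - n1 \<longleftrightarrow> i = j" by auto
      then show ?thesis using DI(2)[OF ij(1,2)] 2 by simp
    next
      case 3
      then show ?thesis using DI(2)[OF ij(1,2)] ij(3) by auto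
    qed
  qed
  have D3: "D $$ (n2 + i, n2 + j) = C $$ (i, j)" if "i < N - n2" "j < N' - n2" for i j
    using DI(2)[of "n2 + i" "n2 + j"] that n by simp
  show ?thesis
    unfolding D_def[symmetric]
  proof
    assume "M = D"
    then show "(\<forall>i<n1. \<forall>j<n1. M $$ (i, j) = A $$ (i, j)) \<and>
      (\<forall>i<N. \<forall>j<N'. (i < n2 \<or> j < n2) \<longrightarrow> \<not> (i < n1 \<and> j < n1) \<longrightarrow> M $$ (i, j) = (if i = j then \<tau> else 0)) \<and>
      (\<forall>i<N - n2. \<forall>j<N' - n2. M $$ (n2 + i, n2 + j) = C $$ (i, j))"
      using D1 D2 D3 by blast
  next
    assume E: "(\<forall>i<n1. \<forall>j<n1. M $$ (i, j) = A $$ (i, j)) \<and>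
      (\<forall>i<N. \<forall>j<N'. (i < n2 \<or> j < n2) \<longrightarrow> \<not> (i < n1 \<and> j < n1) \<longrightarrow> M $$ (i, j) = (if i = j then \<tau> else 0)) \<and>
      (\<forall>i<N - n2. \<forall>j<N' - n2. M $$ (n2 + i, n2 + j) = C $$ (i, j))"
    show "M = D"
    proof (rule eq_matI)
      show "dim_row M = dim_row D" "dim_col M = dim_col D" using M DI(1) by auto
      fix i j assume "i < dim_row D" "j < dim_col D"
      then have ij: "i < N" "j < N'" using DI(1) by auto
      show "M $$ (i, j) = D $$ (i, j)"
      proof (cases "i < n2 \<or> j < n2")
        case True
        show ?thesis
        proof (cases "i < n1 \<and> j < n1")
          case T: True
          have "M $$ (i, j) = A $$ (i, j)" using E T by blast
          then show ?thesis using D1[of i j] T by simp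
        next
          case F: False
          have "M $$ (i, j) = (if i = j then \<tau> else 0)" using E ij True F by blast
          then show ?thesis using D2[OF ij True F] by simp
        qed
      next
        case False
        then have lt: "i - n2 < N - n2" "j - n2 < N' - n2" and eq: "n2 + (i - n2) = i" "n2 + (j - n2) = j"
          using ij by auto
        have "M $$ (n2 + (i - n2), n2 + (j - n2)) = C $$ (i - n2, j - n2)" using E lt by blast
        then show ?thesis using D3[OF lt] by (simp add: eq)
      qed
    qed
  qed
qed

lemma sym_part_index:
  assumes "M \<in> carrier_mat N N"
  shows "sym_part M \<in> carrier_mat N N"
    and "\<And>i j. i < N \<Longrightarrow> j < N \<Longrightarrow> sym_part M $$ (i, j) = (M $$ (i, j) + M $$ (j, i)) / 2"
  using assms by (auto simp: sym_part_def)

lemma positive_case_matrix_form: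
  fixes g :: "nat \<Rightarrow> nat \<Rightarrow> real"
  assumes n: "n1 \<le> n2" "n2 \<le> N"
    and M: "M \<in> carrier_mat N N" "\<And>i j. i < N \<Longrightarrow> j < N \<Longrightarrow> M $$ (i, j) = g i j"
    and M1: "M1 \<in> carrier_mat n1 n1" "\<And>i j. i < n1 \<Longrightarrow> j < n1 \<Longrightarrow> M1 $$ (i, j) = g i j"
    and M3: "M3 \<in> carrier_mat (N - n2) (N - n2)"
      "\<And>i j. i < N - n2 \<Longrightarrow> j < N - n2 \<Longrightarrow> M3 $$ (i, j) = g (n2 + i) (n2 + j)"
  defines "A \<equiv> \<lambda>i j. (g i j + g j i) / 2"
  shows "((0 < n1 \<longrightarrow> \<tau> \<le> ord_eigval n1 (sym_part M1)) \<and>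
      (n2 < N \<longrightarrow> ord_eigval 1 (sym_part M3) \<le> \<tau>) \<and>
      sym_part M = diag_block_mat [sym_part M1, \<tau> \<cdot>\<^sub>m 1\<^sub>m (n2 - n1), sym_part M3]) \<longleftrightarrow>
    (leading_block_form N N n1 n2 \<tau> A \<and>
      (\<forall>p. (\<Sum>i<N - n2. \<Sum>j<N - n2. p i * A (n2 + i) (n2 + j) * p j) \<le> \<tau> * (\<Sum>i<N - n2. (p i)\<^sup>2)))"
proof -
  note SM = sym_part_index[OF M(1)] and S1 = sym_part_index[OF M1(1)] and S3 = sym_part_index[OF M3(1)]
  have eM: "sym_part M $$ (i, j) = A i j" if "i < N" "j < N" for i j
    using SM(2)[OF that] M(2) that by (simp add: A_def)
  have e1: "sym_part M1 $$ (i, j) = A i j" if "i < n1" "j < n1" for i j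
    using S1(2)[OF that] M1(2) that by (simp add: A_def)
  have e3: "sym_part M3 $$ (i, j) = A (n2 + i) (n2 + j)" if "i < N - n2" "j < N - n2" for i j
    using S3(2)[OF that] M3(2) that by (simp add: A_def)
  have Asym: "A i j = A j i" for i j by (simp add: A_def add.commute)
  have E1: "(0 < n1 \<longrightarrow> \<tau> \<le> ord_eigval n1 (sym_part M1)) \<longleftrightarrow>
      (\<forall>v. \<tau> * (\<Sum>i<n1. (v i)\<^sup>2) \<le> (\<Sum>i<n1. \<Sum>j<n1. v i * A i j * v j))"
  proof (cases "0 < n1")
    case True
    have "\<tau> \<le> ord_eigval n1 (sym_part M1) \<longleftrightarrow>
        (\<forall>v. \<tau> * (\<Sum>i<n1. (v i)\<^sup>2) \<le> (\<Sum>i<n1. \<Sum>j<n1. v i * sym_part M1 $$ (i, j) * v j))"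
      by (rule smallest_eigenvalue_ge_iff[OF S1(1) _ True]) (simp add: e1 Asym)
    then show ?thesis using True e1 by simp
  qed simp
  have E3: "(n2 < N \<longrightarrow> ord_eigval 1 (sym_part M3) \<le> \<tau>) \<longleftrightarrow>
      (\<forall>p. (\<Sum>i<N - n2. \<Sum>j<N - n2. p i * A (n2 + i) (n2 + j) * p j) \<le> \<tau> * (\<Sum>i<N - n2. (p i)\<^sup>2))"
  proof (cases "n2 < N")
    case True
    have "ord_eigval 1 (sym_part M3) \<le> \<tau> \<longleftrightarrow>
        (\<forall>p. (\<Sum>i<N - n2. \<Sum>j<N - n2. p i * sym_part M3 $$ (i, j) * p j) \<le> \<tau> * (\<Sum>i<N - n2. (p i)\<^sup>2))"
      using True by (intro largest_eigenvalue_le_iff[OF S3(1)]) (simp_all add: e3 Asym)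
    then show ?thesis using True e3 by simp
  qed simp
  have ED: "sym_part M = diag_block_mat [sym_part M1, \<tau> \<cdot>\<^sub>m 1\<^sub>m (n2 - n1), sym_part M3] \<longleftrightarrow>
     (\<forall>i<N. \<forall>j<N. (i < n2 \<or> j < n2) \<longrightarrow> \<not> (i < n1 \<and> j < n1) \<longrightarrow> A i j = (if i = j then \<tau> else 0))"
    unfolding eq_diag_block_mat_iff[OF SM(1) n n(2) S1(1) S3(1)] using eM e1 e3 n by simp
  show ?thesis unfolding E1 E3 ED leading_block_form_def using Asym by blast
qed

text \<open>The equation \<open>M = diag_block_mat [sym_part M1, \<dots>]\<close> also says that \<open>M1\<close>, the leading block of \<open>M\<close>, is
symmetric. In the second statement \<open>tail_bounded\<close> with \<open>\<tau> = 0\<close> amounts to a vanishing third block.\<close>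

lemma zero_case_matrix_form:
  fixes g :: "nat \<Rightarrow> nat \<Rightarrow> real"
  assumes n: "n1 \<le> n2" "n2 \<le> N" and NN: "N \<le> N'"
    and M: "M \<in> carrier_mat N N'" "\<And>i j. i < N \<Longrightarrow> j < N' \<Longrightarrow> M $$ (i, j) = g i j"
    and M1: "M1 \<in> carrier_mat n1 n1" "\<And>i j. i < n1 \<Longrightarrow> j < n1 \<Longrightarrow> M1 $$ (i, j) = g i j"
    and M3: "M3 \<in> carrier_mat (N - n2) (N' - n2)"
      "\<And>i j. i < N - n2 \<Longrightarrow> j < N' - n2 \<Longrightarrow> M3 $$ (i, j) = g (n2 + i) (n2 + j)"
  shows "0 \<le> \<tau> \<Longrightarrow> ((0 < n1 \<longrightarrow> \<tau> \<le> ord_eigval n1 (sym_part M1)) \<and>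
      (n2 < N \<longrightarrow> sing_val 1 M3 \<le> \<tau>) \<and>
      M = diag_block_mat [sym_part M1, \<tau> \<cdot>\<^sub>m 1\<^sub>m (n2 - n1), M3]) \<longleftrightarrow>
    (leading_block_form N N' n1 n2 \<tau> g \<and> tail_bounded N N' n2 \<tau> g)"
    and "(psd_mat (sym_part M1) \<and>
      M = diag_block_mat [sym_part M1, 0\<^sub>m (n2 - n1) (n2 - n1), 0\<^sub>m (N - n2) (N' - n2)]) \<longleftrightarrow>
    (leading_block_form N N' n1 n2 0 g \<and> tail_bounded N N' n2 0 g)"
proof -
  note S1 = sym_part_index[OF M1(1)]
  have e1: "sym_part M1 $$ (i, j) = (g i j + g j i) / 2" if "i < n1" "j < n1" for i j
    using S1(2)[OF that] M1(2) that by simp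
  have q1: "(\<Sum>i<n1. \<Sum>j<n1. v i * sym_part M1 $$ (i, j) * v j) = (\<Sum>i<n1. \<Sum>j<n1. v i * g i j * v j)" for v
  proof -
    have "(\<Sum>i<n1. \<Sum>j<n1. v i * sym_part M1 $$ (i, j) * v j)
        = (\<Sum>i<n1. \<Sum>j<n1. v i * ((g i j + g j i) / 2) * v j)"
      using e1 by (intro sum.cong refl) simp
    also have "\<dots> = (\<Sum>i<n1. \<Sum>j<n1. v i * g i j * v j)"
      by (rule bilinear_form_sym_part[unfolded bilinear_form_def])
    finally show ?thesis .
  qed
  have sym_iff: "(\<forall>i<n1. \<forall>j<n1. M $$ (i, j) = sym_part M1 $$ (i, j)) \<longleftrightarrow> (\<forall>i<n1. \<forall>j<n1. g i j = g j i)"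
  proof -
    have "M $$ (i, j) = sym_part M1 $$ (i, j) \<longleftrightarrow> g i j = g j i" if "i < n1" "j < n1" for i j
      using e1[OF that] M(2)[of i j] that n NN by auto
    then show ?thesis by blast
  qed
  have s1: "sym_part M1 $$ (i, j) = sym_part M1 $$ (j, i)" if "i < n1" "j < n1" for i j
    unfolding e1[OF that] e1[OF that(2,1)] by (simp add: add.commute)
  have mid: "(\<forall>i<N. \<forall>j<N'. (i < n2 \<or> j < n2) \<longrightarrow> \<not> (i < n1 \<and> j < n1) \<longrightarrow> M $$ (i, j) = (if i = j then \<tau> else 0)) \<longleftrightarrow>
     (\<forall>i<N. \<forall>j<N'. (i < n2 \<or> j < n2) \<longrightarrow> \<not> (i < n1 \<and> j < n1) \<longrightarrow> g i j = (if i = j then \<tau> else 0))" for \<tau>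
    using M(2) by simp
  have n': "n2 \<le> N'" using n NN by simp
  have tailM: "M $$ (n2 + i, n2 + j) = g (n2 + i) (n2 + j)" if "i < N - n2" "j < N' - n2" for i j
    using M(2) that by simp
  show "((0 < n1 \<longrightarrow> \<tau> \<le> ord_eigval n1 (sym_part M1)) \<and>
      (n2 < N \<longrightarrow> sing_val 1 M3 \<le> \<tau>) \<and>
      M = diag_block_mat [sym_part M1, \<tau> \<cdot>\<^sub>m 1\<^sub>m (n2 - n1), M3]) \<longleftrightarrow>
    (leading_block_form N N' n1 n2 \<tau> g \<and> tail_bounded N N' n2 \<tau> g)" if tau: "0 \<le> \<tau>"
  proof -
    have E1: "(0 < n1 \<longrightarrow> \<tau> \<le> ord_eigval n1 (sym_part M1)) \<longleftrightarrow>
        (\<forall>v. \<tau> * (\<Sum>i<n1. (v i)\<^sup>2) \<le> (\<Sum>i<n1. \<Sum>j<n1. v i * g i j * v j))"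
    proof (cases "0 < n1")
      case True
      then show ?thesis using smallest_eigenvalue_ge_iff[OF S1(1) s1 True] unfolding q1 by simp
    qed simp
    have E3: "(n2 < N \<longrightarrow> sing_val 1 M3 \<le> \<tau>) \<longleftrightarrow> tail_bounded N N' n2 \<tau> g"
    proof (cases "n2 < N")
      case True
      have "sing_val 1 M3 \<le> \<tau> \<longleftrightarrow> (\<forall>p q. (\<Sum>i<N - n2. \<Sum>j<N' - n2. p i * M3 $$ (i, j) * q j) \<le>
          \<tau> * ((\<Sum>i<N - n2. (p i)\<^sup>2) + (\<Sum>j<N' - n2. (q j)\<^sup>2)) / 2)"
        using True NN tau by (intro largest_singular_value_le_iff[OF M3(1)]) auto
      then show ?thesis using True M3(2) unfolding tail_bounded_def by simp
    next
      case False
      have "0 \<le> \<tau> * (\<Sum>j<N' - n2. (q j)\<^sup>2) / 2" for q :: "nat \<Rightarrow> real"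
        using tau by (intro divide_nonneg_pos mult_nonneg_nonneg sum_nonneg) auto
      then show ?thesis using False by (simp add: tail_bounded_def)
    qed
    have ED: "M = diag_block_mat [sym_part M1, \<tau> \<cdot>\<^sub>m 1\<^sub>m (n2 - n1), M3] \<longleftrightarrow>
       (\<forall>i<n1. \<forall>j<n1. g i j = g j i) \<and>
       (\<forall>i<N. \<forall>j<N'. (i < n2 \<or> j < n2) \<longrightarrow> \<not> (i < n1 \<and> j < n1) \<longrightarrow> g i j = (if i = j then \<tau> else 0))"
      unfolding eq_diag_block_mat_iff[OF M(1) n n' S1(1) M3(1)] sym_iff mid using tailM M3(2) by simp
    show ?thesis unfolding E1 E3 ED leading_block_form_def by blast
  qed
  show "(psd_mat (sym_part M1) \<and>
      M = diag_block_mat [sym_part M1, 0\<^sub>m (n2 - n1) (n2 - n1), 0\<^sub>m (N - n2) (N' - n2)]) \<longleftrightarrow>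
    (leading_block_form N N' n1 n2 0 g \<and> tail_bounded N N' n2 0 g)"
  proof -
    have E1: "psd_mat (sym_part M1) \<longleftrightarrow>
        (\<forall>v. 0 * (\<Sum>i<n1. (v i)\<^sup>2) \<le> (\<Sum>i<n1. \<Sum>j<n1. v i * g i j * v j))"
      using psd_mat_iff[OF S1(1) s1] unfolding q1 by simp
    have E3: "(\<forall>i<N - n2. \<forall>j<N' - n2. M $$ (n2 + i, n2 + j) = 0\<^sub>m (N - n2) (N' - n2) $$ (i, j)) \<longleftrightarrow>
        tail_bounded N N' n2 0 g"
    proof
      assume z: "\<forall>i<N - n2. \<forall>j<N' - n2. M $$ (n2 + i, n2 + j) = 0\<^sub>m (N - n2) (N' - n2) $$ (i, j)"
      have "g (n2 + i) (n2 + j) = 0" if "i < N - n2" "j < N' - n2" for i j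
        using z[rule_format, OF that] tailM[OF that] that by simp
      then show "tail_bounded N N' n2 0 g" by (simp add: tail_bounded_def)
    next
      assume tb: "tail_bounded N N' n2 0 g"
      show "\<forall>i<N - n2. \<forall>j<N' - n2. M $$ (n2 + i, n2 + j) = 0\<^sub>m (N - n2) (N' - n2) $$ (i, j)"
      proof (intro allI impI)
        fix i j assume ij: "i < N - n2" "j < N' - n2"
        have "e * g (n2 + i) (n2 + j) \<le> 0" for e
        proof -
          have "(\<Sum>a<N - n2. \<Sum>b<N' - n2. (if a
              = i then 1 else 0) * g (n2 + a) (n2 + b) * (if b = j then e else 0))
             = (\<Sum>a<N - n2. if a = i then (\<Sum>b<N' - n2. if b = j then e * g (n2 + a) (n2 + b) else 0) else 0)"
            by (intro sum.cong refl) (auto simp: if_distrib mult.commute cong: if_cong)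
          also have "\<dots> = e * g (n2 + i) (n2 + j)"
            using ij by (simp only: sum.delta finite_lessThan lessThan_iff if_True)
          finally show ?thesis
            using tb[unfolded tail_bounded_def, rule_format,
              of "\<lambda>a. if a = i then 1 else 0" "\<lambda>b. if b = j then e else 0"] by simp
        qed
        from this[of 1] this[of "- 1"] have "g (n2 + i) (n2 + j) = 0" by simp
        then show "M $$ (n2 + i, n2 + j) = 0\<^sub>m (N - n2) (N' - n2) $$ (i, j)" using tailM[OF ij] ij by simp
      qed
    qed
    have zero: "0\<^sub>m (n2 - n1) (n2 - n1) = 0 \<cdot>\<^sub>m (1\<^sub>m (n2 - n1) :: real mat)" by (intro eq_matI) auto
    have ED: "M = diag_block_mat [sym_part M1, 0\<^sub>m (n2 - n1) (n2 - n1), 0\<^sub>m (N - n2) (N' - n2)] \<longleftrightarrow>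
       (\<forall>i<n1. \<forall>j<n1. g i j = g j i) \<and>
       (\<forall>i<N. \<forall>j<N'. (i < n2 \<or> j < n2) \<longrightarrow> \<not> (i < n1 \<and> j < n1) \<longrightarrow> g i j = (if i = j then 0 else 0)) \<and>
       tail_bounded N N' n2 0 g"
      unfolding zero
        eq_diag_block_mat_iff[OF M(1) n n' S1(1), of "0\<^sub>m (N - n2) (N' - n2)" 0, OF zero_carrier_mat]
        sym_iff mid E3 ..
    show ?thesis unfolding E1 ED leading_block_form_def by blast
  qed
qed

section \<open>Reduction to diagonal pairs and conclusion\<close>

lemma mat_of_entries: "Z \<in> carrier_mat m n \<Longrightarrow> mat m n (\<lambda>(i, j). Z $$ (i, j)) = Z"
  by (intro eq_matI) auto

lemma ky_fan_entries: "Z \<in> carrier_mat m n \<Longrightarrow> ky_fan k m n (entries Z) = ky_fan_norm k Z"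
  unfolding ky_fan_def by (simp only: mat_of_entries)

lemma mat_inner_frobenius:
  assumes "Y \<in> carrier_mat m n" "Z \<in> carrier_mat m n"
  shows "mat_inner Y Z = frobenius m n (entries Y) (entries Z)"
proof -
  have "mat_inner Y Z = (\<Sum>j<n. \<Sum>i<m. Y $$ (i, j) * Z $$ (i, j))"
    using assms by (simp add: mat_inner_def mat_trace_def scalar_prod_def atLeast0LessThan)
  also have "\<dots> = frobenius m n (entries Y) (entries Z)"
    unfolding frobenius_def by (rule sum.swap)
  finally show ?thesis .
qed

lemma norming_if_in_subdifferential:
  assumes "k \<le> m" "m \<le> n" and X: "X \<in> carrier_mat m n" and S: "S \<in> subdifferential m n (ky_fan_norm k) X"
  shows "norming k m n (entries S) (entries X)"
proof (rule norming_if_subgradient[OF assms(1,2)])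
  fix z :: "nat \<Rightarrow> nat \<Rightarrow> real"
  define Z where "Z = mat m n (\<lambda>(i, j). z i j)"
  have Z: "Z \<in> carrier_mat m n" by (simp add: Z_def)
  have S': "S \<in> carrier_mat m n" using S by (simp add: subdifferential_def)
  have "ky_fan_norm k X + mat_inner S (Z - X) \<le> ky_fan_norm k Z"
    using S Z by (simp add: subdifferential_def)
  moreover have "mat_inner S (Z - X) = frobenius m n (entries S) (\<lambda>i j. z i j - X $$ (i, j))"
    unfolding mat_inner_frobenius[OF S' minus_carrier_mat[OF X]]
      using X by (intro frobenius_cong) (auto simp: Z_def)
  moreover have "ky_fan_norm k Z = ky_fan k m n z" by (simp add: ky_fan_def Z_def)
  ultimately show "ky_fan k m n (entries X) + frobenius m n (entries S) (\<lambda>i j. z i j - X $$ (i, j))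
      \<le> ky_fan k m n z"
    by (simp add: ky_fan_entries[OF X])
qed

text \<open>A singular value decomposition of \<open>Z\<close> is transported to one of \<open>A\<^sup>T Z B\<close> with the same values, and the
values do not depend on the decomposition.\<close>

lemma sing_val_if_change_basis_diagonal:
  assumes Z: "Z \<in> carrier_mat m n" and mn: "m \<le> n" and A: "orth m A" and B: "orth n B"
    and diag: "\<And>i j. i < m \<Longrightarrow> j < n \<Longrightarrow> change_basis m n A B (entries Z) i j = (if i = j then \<eta> i else 0)"
    and \<eta>: "\<And>i. i < m \<Longrightarrow> 0 \<le> \<eta> i" "\<And>i j. i \<le> j \<Longrightarrow> j < m \<Longrightarrow> \<eta> j \<le> \<eta> i"
    and l: "l < m"
  shows "sing_val (Suc l) Z = \<eta> l"
proof -
  define R where "R = mat m n (\<lambda>(i, j). change_basis m n A B (entries Z) i j)"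
  have R: "R \<in> carrier_mat m n" by (simp add: R_def)
  have entries: "R $$ (i, j) = change_basis m n A B (entries Z) i j" if "i < m" "j < n" for i j
    using that by (simp add: R_def)
  obtain y P Q where svd: "is_svd m n (entries Z) y P Q" by (rule svd_exists[OF mn])
  have "is_svd m n (entries R) y (\<lambda>i l. \<Sum>a<m. A a i * P a l) (\<lambda>j l. \<Sum>b<n. B b j * Q b l)"
    using is_svd_change_basis[OF A B svd] by (subst is_svd_cong[OF entries])
  from sing_val_eqI[OF R mn this l] sing_val_eqI[OF Z mn svd l]
  have "sing_val (Suc l) Z = sing_val (Suc l) R" by simp
  also have "\<dots> = \<eta> l"
  proof (rule sing_val_eqI[OF R mn is_svd_diagonal[OF mn _ \<eta>] l])
    show "R $$ (i, j) = (if i = j then \<eta> i else 0)" if "i < m" "j < n" for i j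
      using entries[OF that] diag[OF that] by simp
  qed
  finally show ?thesis .
qed

lemma change_basis_add:
  "change_basis m n A B (\<lambda>i j. x i j + t * h i j) i j = change_basis m n A B x i j + t * change_basis m n A B h i j"
  by (simp add: change_basis_def sum.distrib sum_distrib_left algebra_simps)

lemma change_basis_cong:
  assumes "\<And>i j. i < m \<Longrightarrow> j < n \<Longrightarrow> z i j = z' i j"
  shows "change_basis m n A B z i j = change_basis m n A B z' i j"
  using assms by (simp add: change_basis_def)

text \<open>By orthogonal invariance the directional derivative may be computed in the new bases.\<close>

lemma ky_fan_dir_deriv:
  assumes k: "1 \<le> k" "k \<le> m" and mn: "m \<le> n" and A: "orth m A" and B: "orth n B"
    and X: "X \<in> carrier_mat m n" and H: "H \<in> carrier_mat m n"
  defines "x \<equiv> change_basis m n A B (entries X)" and "h \<equiv> change_basis m n A B (entries H)"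
  obtains P Q where "orth m P" "orth n Q" "leading_trace k m n P Q x = ky_fan k m n x"
    "dir_deriv (ky_fan_norm k) X H = leading_trace k m n P Q h"
    "\<And>s. norming k m n s x \<Longrightarrow> frobenius m n s h \<le> leading_trace k m n P Q h"
proof -
  obtain P Q where PQ: "orth m P" "orth n Q" "leading_trace k m n P Q x = ky_fan k m n x"
    and lim: "((\<lambda>t. (ky_fan k m n (\<lambda>i j. x i j + t * h i j) - ky_fan k m n x) / t) \<longlongrightarrow> leading_trace k m n P Q h) (at_right 0)"
    and up: "\<And>s. norming k m n s x \<Longrightarrow> frobenius m n s h \<le> leading_trace k m n P Q h"
    using ky_fan_directional_derivative[OF k mn, of x h] by blast
  have "ky_fan k m n (\<lambda>i j. x i j + t * h i j) = ky_fan_norm k (X + t \<cdot>\<^sub>m H)" for t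
  proof -
    have XH: "X + t \<cdot>\<^sub>m H \<in> carrier_mat m n" using X H by simp
    have "ky_fan k m n (\<lambda>i j. x i j + t * h i j)
        = ky_fan k m n (change_basis m n A B (\<lambda>i j. X $$ (i, j) + t * H $$ (i, j)))"
      unfolding x_def h_def by (intro ky_fan_cong) (simp add: change_basis_add)
    also have "\<dots> = ky_fan k m n (\<lambda>i j. X $$ (i, j) + t * H $$ (i, j))"
      by (rule ky_fan_change_basis[OF k(2) mn A B])
    also have "\<dots> = ky_fan k m n (\<lambda>i j. (X + t \<cdot>\<^sub>m H) $$ (i, j))"
      using X H by (intro ky_fan_cong) auto
    also have "\<dots> = ky_fan_norm k (X + t \<cdot>\<^sub>m H)" by (rule ky_fan_entries[OF XH])
    finally show ?thesis .
  qed
  moreover have "ky_fan k m n x = ky_fan_norm k X"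
    unfolding x_def ky_fan_change_basis[OF k(2) mn A B] by (rule ky_fan_entries[OF X])
  ultimately have "((\<lambda>t. (ky_fan_norm k (X + t \<cdot>\<^sub>m H) - ky_fan_norm k X) / t) \<longlongrightarrow> leading_trace k m n P Q h) (at_right 0)"
    using lim by simp
  then have "dir_deriv (ky_fan_norm k) X H = leading_trace k m n P Q h"
    unfolding dir_deriv_def by (intro tendsto_Lim) simp_all
  then show thesis using that[OF PQ] up by blast
qed

lemma change_basis_of_singular_block:
  assumes X: "X \<in> carrier_mat m n" and mn: "m
      \<le> n" and U: "U \<in> orthogonal_group m" and V: "V \<in> orthogonal_group n"
    and svd: "X = U * singular_block X * transpose_mat V"
  shows "\<And>i j. i < m \<Longrightarrow> j < n \<Longrightarrow>
      change_basis m n (entries U) (entries V) (entries X) i j = (if i = j then sing_val (Suc i) X else 0)"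
    and "\<And>i. i < m \<Longrightarrow> 0 \<le> sing_val (Suc i) X"
    and "\<And>i j. i \<le> j \<Longrightarrow> j < m \<Longrightarrow> sing_val (Suc j) X \<le> sing_val (Suc i) X"
proof -
  define \<sigma> where "\<sigma> = (\<lambda>l. sing_val (Suc l) X)"
  have cU: "U \<in> carrier_mat m m" and cV: "V \<in> carrier_mat n n"
    using U V by (auto simp: orthogonal_group_def)
  note oU = orthogonal_group_orth[OF U] and oV = orthogonal_group_orth[OF V]
  obtain y P Q where sv: "is_svd m n (entries X) y P Q" by (rule svd_exists[OF mn])
  have y: "\<sigma> l = y l" if "l < m" for l unfolding \<sigma>_def by (rule sing_val_eqI[OF X mn sv that])
  show s0: "0 \<le> sing_val (Suc i) X" if "i < m" for i
    using y[OF that] is_svdD(4)[OF sv that] by (simp add: \<sigma>_def)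
  show sd: "sing_val (Suc j) X \<le> sing_val (Suc i) X" if "i \<le> j" "j < m" for i j
    using y[of i] y[of j] is_svdD(5)[OF sv that] that by (simp add: \<sigma>_def)
  have SB: "singular_block X \<in> carrier_mat m n" using X by (simp add: singular_block_def)
  have "X $$ (i, j) = (\<Sum>l<m. \<sigma> l * U $$ (i, l) * V $$ (j, l))" if ij: "i < m" "j < n" for i j
  proof -
    have US: "(U * singular_block X) $$ (i, l) = (if l < m then U $$ (i, l) * \<sigma> l else 0)" if l: "l < n" for l
    proof -
      have "(U * singular_block X) $$ (i, l) = (\<Sum>a<m. U $$ (i, a) * singular_block X $$ (a, l))"
        using cU SB ij l by (simp add: scalar_prod_def atLeast0LessThan)
      also have "\<dots> = (\<Sum>a<m. if a = l then U $$ (i, l) * \<sigma> l else 0)"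
        using X l by (intro sum.cong) (auto simp: singular_block_def \<sigma>_def)
      finally show ?thesis by simp
    qed
    have "X $$ (i, j) = (U * singular_block X * transpose_mat V) $$ (i, j)" using svd by simp
    also have "\<dots> = (\<Sum>l<n. (U * singular_block X) $$ (i, l) * V $$ (j, l))"
    proof -
      have "(A * transpose_mat V) $$ (i, j) = (\<Sum>l<n. A $$ (i, l) * V $$ (j, l))"
        if "A \<in> carrier_mat m n" for A
        using that cV ij by (simp add: scalar_prod_def atLeast0LessThan)
      moreover have "U * singular_block X \<in> carrier_mat m n" using cU SB by simp
      ultimately show ?thesis by blast
    qed
    also have "\<dots> = (\<Sum>l<n. if l < m then \<sigma> l * U $$ (i, l) * V $$ (j, l) else 0)"
      using US by (intro sum.cong) auto
    finally show ?thesis unfolding sum_lessThan_if_less[OF mn] .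
  qed
  then have "is_svd m n (entries X) \<sigma> (entries U) (entries V)"
    unfolding is_svd_def using oU oV s0 sd by (simp add: \<sigma>_def)
  from is_svdD(3)[OF is_svd_change_basis[OF oU oV this]]
  have rt: "change_basis m n (entries U) (entries V) (entries X) i j =
      (\<Sum>l<m. \<sigma> l * (\<Sum>a<m. U $$ (a, i) * U $$ (a, l)) * (\<Sum>b<n. V $$ (b, j) * V $$ (b, l)))"
    if "i < m" "j < n" for i j using that .
  show "change_basis m n (entries U) (entries V) (entries X) i j = (if i = j then sing_val (Suc i) X else 0)"
    if ij: "i < m" "j < n" for i j
  proof -
    have "(\<Sum>l<m. \<sigma> l * (\<Sum>a<m. U $$ (a, i) * U $$ (a, l)) * (\<Sum>b<n. V $$ (b, j) * V $$ (b, l)))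
        = (\<Sum>l<m. if l = i then (if i = j then \<sigma> i else 0) else 0)"
      using orth_cols[OF oU ij(1)] orth_cols[OF oV ij(2)] mn by (intro sum.cong) auto
    then show ?thesis unfolding rt[OF ij] using ij by (simp add: \<sigma>_def)
  qed
qed

text \<open>Descending sequences turn the conditions \<open>s = 1\<close> and \<open>s \<noteq> 0\<close> into conditions on the index.\<close>

lemma initial_segment:
  fixes N :: nat
  assumes "\<And>i j. i \<le> j \<Longrightarrow> j < N \<Longrightarrow> P j \<Longrightarrow> P i"
  shows "\<exists>c\<le>N. \<forall>i<N. P i \<longleftrightarrow> i < c"
proof -
  define c where "c = (LEAST i. i = N \<or> \<not> P i)"
  have c: "c = N \<or> \<not> P c" unfolding c_def by (rule LeastI[of _ N]) simp
  have cN: "c \<le> N" unfolding c_def by (rule Least_le) simp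
  have "P i" if "i < c" for i using not_less_Least[OF that[unfolded c_def]] by simp
  moreover have "\<not> P i" if "c \<le> i" "i < N" for i using assms[OF that] c that by auto
  ultimately show ?thesis using cN by (meson not_le)
qed

lemma interval_filter:
  fixes k0 N :: nat
  assumes c: "c \<le> N" and R: "\<And>j. j < N \<Longrightarrow> R (Suc (k0 + j)) \<longleftrightarrow> a \<le> j \<and> j < c"
  shows "{i \<in> {k0+1..k0+N}. R i} = {k0+a+1..k0+c}"
proof (intro Set.set_eqI)
  fix i
  show "i \<in> {i \<in> {k0+1..k0+N}. R i} \<longleftrightarrow> i \<in> {k0+a+1..k0+c}"
  proof (cases "k0 < i \<and> i \<le> k0 + N")
    case True
    define j where "j = i - Suc k0"
    have "j < N" "i = Suc (k0 + j)" using True by (auto simp: j_def)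
    then show ?thesis using R[of j] by auto
  qed (use c in auto)
qed

theorem proposition5p1:
  fixes k m n k0 k1 :: nat
    and Xb Sb X U V H V2 :: "real mat"
    and \<beta> \<beta>1 \<beta>2 \<beta>3 b :: "nat set"
    and \<theta> :: "real mat \<Rightarrow> real"
    and UHV :: "nat set \<Rightarrow> nat set \<Rightarrow> real mat"
    and UHV2 :: "nat set \<Rightarrow> real mat"
  assumes dims: "1 \<le> k" "k \<le> m" "m \<le> n"
    and theta: "\<theta> = ky_fan_norm k"
    and Xb: "Xb \<in> carrier_mat m n"
    and Sb: "Sb \<in> carrier_mat m n"
    and subgrad: "Sb \<in> subdifferential m n \<theta> Xb"
    and X: "X = Xb + Sb"
    and U: "U \<in> orthogonal_group m"
    and V: "V \<in> orthogonal_group n"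
    and svd: "X = U * singular_block X * transpose_mat V"
    and k0: "k0 \<le> k - 1"
    and k1: "k \<le> k1" "k1 \<le> m"
    and above: "\<And>i. i \<in> {1..k0} \<Longrightarrow> sing_val i Xb > sing_val k Xb"
    and tied: "\<And>i. i \<in> {k0+1..k1} \<Longrightarrow> sing_val i Xb = sing_val k Xb"
    and below: "\<And>i. i \<in> {k1+1..m} \<Longrightarrow> sing_val i Xb < sing_val k Xb"
    and beta: "\<beta> = {k0+1..k1}"
    and beta1: "\<beta>1 = {i \<in> \<beta>. sing_val i Sb = 1}"
    and beta2: "\<beta>2 = {i \<in> \<beta>. 0 < sing_val i Sb \<and> sing_val i Sb < 1}"
    and beta3: "\<beta>3 = {i \<in> \<beta>. sing_val i Sb = 0}"
    and b: "b = {i \<in> {1..m}. sing_val i X = 0}"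
    and V2: "V2 = col_sub V {m+1..n}"
    and H: "H \<in> carrier_mat m n"
    and UHV: "\<And>I J. UHV I J = transpose_mat (col_sub U I) * H * col_sub V J"
    and UHV2: "\<And>I. UHV2 I = transpose_mat (col_sub U I) * H * V2"
  shows
    "(H \<in> critical_cone m n \<theta> Xb Sb \<longleftrightarrow> dir_deriv \<theta> Xb H = mat_inner Sb H)
     \<and>
     (H \<in> critical_cone m n \<theta> Xb Sb \<longleftrightarrow>
       (sing_val k Xb > 0 \<longrightarrow>
         (\<exists>\<tau>::real.
            (\<beta>1 \<noteq> {} \<longrightarrow> ord_eigval (card \<beta>1) (sym_part (UHV \<beta>1 \<beta>1)) \<ge> \<tau>) \<and>
            (\<beta>3 \<noteq> {} \<longrightarrow> \<tau> \<ge> ord_eigval 1 (sym_part (UHV \<beta>3 \<beta>3))) \<and>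
            sym_part (UHV \<beta> \<beta>) =
              diag_block_mat [sym_part (UHV \<beta>1 \<beta>1),
                              \<tau> \<cdot>\<^sub>m 1\<^sub>m (card \<beta>2),
                              sym_part (UHV \<beta>3 \<beta>3)]))
       \<and>
       (sing_val k Xb = 0 \<and> nuclear_norm Sb = real k \<longrightarrow>
         (\<exists>\<tau>::real. \<tau> \<ge> 0 \<and>
            (\<beta>1 \<noteq> {} \<longrightarrow> ord_eigval (card \<beta>1) (sym_part (UHV \<beta>1 \<beta>1)) \<ge> \<tau>) \<and>
            (b \<noteq> {} \<longrightarrow> \<tau> \<ge> sing_val 1 (append_cols (UHV b b) (UHV2 b))) \<and>
            append_cols (UHV \<beta> \<beta>) (UHV2 \<beta>) =
              diag_block_mat [sym_part (UHV \<beta>1 \<beta>1),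
                              \<tau> \<cdot>\<^sub>m 1\<^sub>m (card \<beta>2),
                              append_cols (UHV b b) (UHV2 b)]))
       \<and>
       (sing_val k Xb = 0 \<and> nuclear_norm Sb < real k \<longrightarrow>
          psd_mat (sym_part (UHV \<beta>1 \<beta>1)) \<and>
          append_cols (UHV \<beta> \<beta>) (UHV2 \<beta>) =
            diag_block_mat [sym_part (UHV \<beta>1 \<beta>1),
                            0\<^sub>m (card \<beta>2) (card \<beta>2),
                            0\<^sub>m (card \<beta>3) (card \<beta>3 + (n - m))]))"
proof -
  define u where "u = (entries U)"
  define v where "v = (entries V)"
  have ou: "orth m u" and ov: "orth n v"
    unfolding u_def v_def using orthogonal_group_orth U V by blast+
  have cU: "U \<in> carrier_mat m m" and cV: "V \<in> carrier_mat n n"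
    using U V by (auto simp: orthogonal_group_def)
  have cX: "X \<in> carrier_mat m n" using X Xb Sb by simp
  define x where "x = change_basis m n u v (entries Xb)"
  define S where "S = change_basis m n u v (entries Sb)"
  define h where "h = change_basis m n u v (entries H)"
  define \<xi> where "\<xi> = (\<lambda>i. x i i)"
  define s where "s = (\<lambda>i. S i i)"
  have nm: "norming k m n S x"
    unfolding x_def S_def
    using norming_change_basis[OF dims(2,3) norming_if_in_subdifferential[OF dims(2,3) Xb subgrad[unfolded theta]] ou ov] .
  note RX = change_basis_of_singular_block[OF cX dims(3) U V svd, folded u_def v_def]
  have total: "x i j + S i j = (if i = j then sing_val (Suc i) X else 0)" if "i < m" "j < n" for i j
  proof -
    have "x i j + S i j = change_basis m n u v (\<lambda>i j. Xb $$ (i, j) + 1 * Sb $$ (i, j)) i j"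
      unfolding change_basis_add x_def S_def by simp
    also have "\<dots> = change_basis m n u v (entries X) i j"
      using Xb Sb by (intro change_basis_cong) (auto simp: X)
    finally show ?thesis using RX(1)[OF that] by simp
  qed
  note SD = norming_pair_simultaneously_diagonal[where y = "\<lambda>i. sing_val (Suc i) X",
      OF dims(2,3) nm total RX(2,3)]
  have x_off: "x i j = 0" if "i < m" "j < n" "i \<noteq> j" for i j
    by (rule SD(1)) (use that in simp_all)
  have S_off: "S i j = 0" if "i < m" "j < n" "i \<noteq> j" for i j
    by (rule SD(2)) (use that in simp_all)
  have xd: "x i j = (if i = j then \<xi> i else 0)" and Sd: "S i j = (if i = j then s i else 0)"
    if "i < m" "j < n" for i j
    using x_off[OF that] S_off[OF that] by (auto simp: \<xi>_def s_def)
  have \<xi>0: "0 \<le> \<xi> i" if "i < m" for i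
    unfolding \<xi>_def by (rule SD(3)) (use that in simp_all)
  have s0: "0 \<le> s i" if "i < m" for i
    unfolding s_def by (rule SD(4)) (use that in simp_all)
  have \<xi>d: "\<xi> j \<le> \<xi> i" if "i \<le> j" "j < m" for i j
    unfolding \<xi>_def by (rule SD(5)) (use that in simp_all)
  have sd: "s j \<le> s i" if "i \<le> j" "j < m" for i j
    unfolding s_def by (rule SD(6)) (use that in simp_all)
  have s1: "s i \<le> 1" if "i < m" for i
    unfolding s_def
    by (rule norming_diagonal_bounds(1)[OF dims nm S_off sd[unfolded s_def]]) (use that in simp_all)
  have ssum: "(\<Sum>i<m. s i) \<le> real k"
    unfolding s_def
    by (rule norming_diagonal_bounds(2)[OF dims nm S_off sd[unfolded s_def]]) simp_all
  \<comment> \<open>Singular values are numbered from 1, diagonal entries from 0.\<close>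
  have svX: "sing_val (Suc i) Xb = \<xi> i" if "i < m" for i
    by (rule sing_val_if_change_basis_diagonal[OF Xb dims(3) ou ov xd[unfolded x_def] \<xi>0 \<xi>d that])
  have svS: "sing_val (Suc i) Sb = s i" if "i < m" for i
    by (rule sing_val_if_change_basis_diagonal[OF Sb dims(3) ou ov Sd[unfolded S_def] s0 sd that])
  have svk: "sing_val k Xb = \<xi> (k - 1)" using svX[of "k - 1"] dims by simp
  have k0k: "k0 < k" using k0 dims by simp
  define N where "N = k1 - k0"
  have Nk: "k0 + N = k1" "k0 < k1" "N \<le> m" using k0k k1 by (auto simp: N_def)
  obtain n1 where n1: "n1 \<le> N" "\<And>i. i < N \<Longrightarrow> s (k0 + i) = 1 \<longleftrightarrow> i < n1"
  proof -
    have "\<exists>c\<le>N. \<forall>i<N. s (k0 + i) = 1 \<longleftrightarrow> i < c"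
    proof (rule initial_segment)
      fix i j assume "i \<le> j" "j < N" "s (k0 + j) = 1"
      then show "s (k0 + i) = 1" using sd[of "k0 + i" "k0 + j"] s1[of "k0 + i"] k1 Nk by simp
    qed
    then show ?thesis using that by blast
  qed
  obtain n2 where n2: "n2 \<le> N" "\<And>i. i < N \<Longrightarrow> s (k0 + i) \<noteq> 0 \<longleftrightarrow> i < n2"
  proof -
    have "\<exists>c\<le>N. \<forall>i<N. s (k0 + i) \<noteq> 0 \<longleftrightarrow> i < c"
    proof (rule initial_segment)
      fix i j assume "i \<le> j" "j < N" "s (k0 + j) \<noteq> 0"
      then show "s (k0 + i) \<noteq> 0" using sd[of "k0 + i" "k0 + j"] s0[of "k0 + j"] k1 Nk by simp
    qed
    then show ?thesis using that by blast
  qed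
  have n12: "n1 \<le> n2"
  proof (rule ccontr)
    assume "\<not> n1 \<le> n2"
    then have "n2 < N" "n2 < n1" using n1 by auto
    then show False using n1(2)[of n2] n2(2)[of n2] by simp
  qed
  have n2z: "s (k0 + i) = 0 \<longleftrightarrow> n2 \<le> i" if "i < N" for i using n2(2)[OF that] by auto
  interpret D: diagonal_pair k m n k0 k1 n1 n2 \<xi> s x S
  proof
    show "\<xi> (k - 1) < \<xi> i" if "i < k0" for i
      using above[of "Suc i"] svX[of i] svk that k0k dims by simp
    show "\<xi> i = \<xi> (k - 1)" if "k0 \<le> i" "i < k1" for i
      using tied[of "Suc i"] svX[of i] svk that k1 by simp
    show "\<xi> i < \<xi> (k - 1)" if "k1 \<le> i" "i < m" for i
      using below[of "Suc i"] svX[of i] svk that by simp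
  qed (use dims xd Sd \<xi>0 \<xi>d s0 s1 ssum nm k0k k1 n12 n1 n2 n2z in \<open>simp_all add: N_def\<close>)
  obtain P Q where PQ: "orth m P" "orth n Q" "leading_trace k m n P Q x = ky_fan k m n x"
    and dd: "dir_deriv \<theta> Xb H = leading_trace k m n P Q h"
    and up: "\<And>s. norming k m n s x \<Longrightarrow> frobenius m n s h \<le> leading_trace k m n P Q h"
    unfolding x_def h_def theta by (rule ky_fan_dir_deriv[OF dims ou ov Xb H]) blast
  have inner: "mat_inner Sb H = frobenius m n S h"
    unfolding S_def h_def frobenius_change_basis[OF ou ov] by (rule mat_inner_frobenius[OF Sb H])
  have cone: "H \<in> critical_cone m n \<theta> Xb Sb \<longleftrightarrow> leading_trace k m n P Q h \<le> frobenius m n S h"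
    using H by (simp add: critical_cone_def dd inner)
  have first: "H \<in> critical_cone m n \<theta> Xb Sb \<longleftrightarrow> dir_deriv \<theta> Xb H = mat_inner Sb H"
    unfolding cone dd inner using up[OF nm] by auto
  have coneM: "H \<in> critical_cone m n \<theta> Xb Sb \<longleftrightarrow> D.maximal h"
    unfolding cone D.maximal_def
  proof
    assume le: "leading_trace k m n P Q h \<le> frobenius m n S h"
    show "\<forall>P Q. orth m P \<longrightarrow> orth n Q \<longrightarrow> leading_trace k m n P Q x = ky_fan k m n x \<longrightarrow> leading_trace k m n P Q h \<le> frobenius m n S h"
    proof (intro allI impI)
      fix P' Q' assume "orth m P'" "orth n Q'" "leading_trace k m n P' Q' x = ky_fan k m n x"
      from up[OF norming_leading_trace[OF dims this]] le show "leading_trace k m n P' Q' h \<le> frobenius m n S h"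
        by (simp add: leading_trace_frobenius)
    qed
  qed (use PQ in blast)
  have sets: "\<beta> = {k0+1..k1}" "\<beta>1 = {k0+1..k0+n1}" "\<beta>2 = {k0+n1+1..k0+n2}" "\<beta>3 = {k0+n2+1..k1}"
  proof -
    have bN: "\<beta> = {k0+1..k0+N}" using Nk by (simp add: beta)
    have sv: "sing_val (Suc (k0 + j)) Sb = s (k0 + j)" if "j < N" for j using svS[of "k0 + j"] that Nk k1 by simp
    show "\<beta> = {k0+1..k1}" by (rule beta)
    have "\<beta>1 = {k0+0+1..k0+n1}"
      unfolding beta1 bN by (rule interval_filter[OF n1(1)]) (simp add: sv n1(2))
    then show "\<beta>1 = {k0+1..k0+n1}" by simp
    show "\<beta>2 = {k0+n1+1..k0+n2}"
      unfolding beta2 bN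
    proof (rule interval_filter[OF n2(1)])
      fix j assume j: "j < N"
      have "0 \<le> s (k0 + j)" "s (k0 + j) \<le> 1" using s0[of "k0 + j"] s1[of "k0 + j"] j Nk k1 by auto
      then show "0 < sing_val (Suc (k0 + j)) Sb \<and> sing_val (Suc (k0 + j)) Sb < 1 \<longleftrightarrow> n1 \<le> j \<and> j < n2"
        unfolding sv[OF j] using n1(2)[OF j] n2(2)[OF j] by force
    qed
    have "\<beta>3 = {k0+n2+1..k0+N}"
      unfolding beta3 bN by (rule interval_filter[OF order_refl]) (simp add: sv n2z)
    then show "\<beta>3 = {k0+n2+1..k1}" using Nk by simp
  qed
  have cards: "card \<beta>1 = n1" "card \<beta>2 = n2 - n1" "card \<beta>3 = N - n2"
    unfolding sets using Nk n2(1) by auto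
  have nonempty: "\<beta>1 \<noteq> {} \<longleftrightarrow> 0 < n1" "\<beta>3 \<noteq> {} \<longleftrightarrow> n2 < N"
    unfolding sets using Nk n2(1) by auto
  define g where "g = (\<lambda>i j. h (k0 + i) (k0 + j))"
  have block: "UHV {p+1..q} {p'+1..q'} \<in> carrier_mat (q - p) (q' - p')"
    if "q \<le> m" "q' \<le> n" for p p' q q'
    unfolding UHV by (rule compressed_block(1)[OF cU cV H that])
  have block_entry: "UHV {p+1..q} {p'+1..q'} $$ (i, j) = h (p + i) (p' + j)"
    if "q \<le> m" "q' \<le> n" "i < q - p" "j < q' - p'" for p p' q q' i j
    unfolding UHV h_def u_def v_def by (rule compressed_block(2)[OF cU cV H that])
  have k1n: "k1 \<le> n" using k1 dims by simp
  have M: "UHV \<beta> \<beta> \<in> carrier_mat N N" "\<And>i j. i < N \<Longrightarrow> j < N \<Longrightarrow> UHV \<beta> \<beta> $$ (i, j) = g i j"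
    unfolding sets g_def N_def using block[OF k1(2) k1n] block_entry[OF k1(2) k1n] by blast+
  have M1: "UHV \<beta>1 \<beta>1 \<in> carrier_mat n1 n1" "\<And>i j. i < n1 \<Longrightarrow> j < n1 \<Longrightarrow> UHV \<beta>1 \<beta>1 $$ (i, j) = g i j"
  proof -
    have le: "k0 + n1 \<le> m" "k0 + n1 \<le> n" using n1(1) Nk k1 k1n by auto
    show "UHV \<beta>1 \<beta>1 \<in> carrier_mat n1 n1" "\<And>i j. i < n1 \<Longrightarrow> j < n1 \<Longrightarrow> UHV \<beta>1 \<beta>1 $$ (i, j) = g i j"
      unfolding sets g_def using block[OF le, of k0 k0] block_entry[where p = k0 and p' = k0, OF le] by simp_all
  qed
  have rest: "k1 - (k0 + n2) = N - n2" by (simp add: N_def)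
  have M3: "UHV \<beta>3 \<beta>3 \<in> carrier_mat (N - n2) (N - n2)"
    "\<And>i j. i < N - n2 \<Longrightarrow> j < N - n2 \<Longrightarrow> UHV \<beta>3 \<beta>3 $$ (i, j) = g (n2 + i) (n2 + j)"
    unfolding sets g_def
    using block[OF k1(2) k1n, of "k0 + n2" "k0 + n2"] block_entry[where p = "k0 + n2" and p' = "k0 + n2", OF k1(2) k1n]
    by (simp_all add: rest add.assoc)
  show ?thesis
  proof (cases "sing_val k Xb > 0")
    case True
    define A where "A = (\<lambda>i j. (g i j + g j i) / 2)"
    have form: "((0 < n1 \<longrightarrow> \<tau> \<le> ord_eigval n1 (sym_part (UHV \<beta>1 \<beta>1))) \<and>
        (n2 < N \<longrightarrow> ord_eigval 1 (sym_part (UHV \<beta>3 \<beta>3)) \<le> \<tau>) \<and>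
        sym_part (UHV \<beta> \<beta>) = diag_block_mat [sym_part (UHV \<beta>1 \<beta>1), \<tau> \<cdot>\<^sub>m 1\<^sub>m (n2 - n1), sym_part (UHV \<beta>3 \<beta>3)])
      \<longleftrightarrow> (leading_block_form N N n1 n2 \<tau> A \<and>
        (\<forall>p. (\<Sum>i<N - n2. \<Sum>j<N - n2. p i * A (n2 + i) (n2 + j) * p j) \<le> \<tau> * (\<Sum>i<N - n2. (p i)\<^sup>2)))" for \<tau>
      unfolding A_def by (rule positive_case_matrix_form[OF n12 n2(1) M M1 M3])
    have "0 < \<xi> (k - 1)" using True svk by simp
    then have "D.maximal h \<longleftrightarrow> (\<exists>\<tau>. leading_block_form N N n1 n2 \<tau> A \<and>
        (\<forall>p. (\<Sum>i<N - n2. \<Sum>j<N - n2. p i * A (n2 + i) (n2 + j) * p j) \<le> \<tau> * (\<Sum>i<N - n2. (p i)\<^sup>2)))"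
      unfolding A_def g_def N_def by (rule D.maximal_iff_positive_case)
    note max = this[folded form]
    have "sing_val k Xb \<noteq> 0" using True by simp
    then show ?thesis
      by (intro conjI[OF first], unfold coneM cards nonempty) (use True max in blast)
  next
    case False
    then have zero: "\<xi> (k - 1) = 0" using svk \<xi>0[of "k - 1"] dims by simp
    have k1m: "k1 = m"
    proof (rule ccontr)
      assume "k1 \<noteq> m"
      then have "k1 < m" using k1 by simp
      then show False using D.below[of k1] \<xi>0[of k1] zero by simp
    qed
    have Nm: "N = m - k0" using k1m by (simp add: N_def)
    define N' where "N' = n - k0"
    have NN: "N \<le> N'" using dims by (simp add: N'_def Nm)
    have nuc: "nuclear_norm Sb = (\<Sum>i<m. s i)"
    proof -
      have "nuclear_norm Sb = (\<Sum>i<m. sing_val (Suc i) Sb)"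
        unfolding nuclear_norm_def using Sb
        by (intro sum.reindex_bij_witness[of _ Suc "\<lambda>i. i - 1"]) auto
      then show ?thesis using svS by simp
    qed
    have b3: "b = \<beta>3"
    proof (intro Set.set_eqI)
      fix i
      show "i \<in> b \<longleftrightarrow> i \<in> \<beta>3"
      proof (cases "1 \<le> i \<and> i \<le> m")
        case True
        define e where "e = i - 1"
        have e: "e < m" "i = Suc e" using True by (auto simp: e_def)
        have "sing_val i X = \<xi> e + s e" using total[of e e] e dims by (simp add: \<xi>_def s_def)
        then have "i \<in> b \<longleftrightarrow> \<xi> e = 0 \<and> s e = 0"
          using True \<xi>0[OF e(1)] s0[OF e(1)] by (auto simp: b add_nonneg_eq_0_iff)
        moreover have "\<xi> e = 0 \<longleftrightarrow> k0 \<le> e"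
          using D.above[of e] D.tied[of e] zero e k1m by (cases "k0 \<le> e") auto
        moreover have "s e = 0 \<longleftrightarrow> n2 \<le> e - k0" if "k0 \<le> e"
          using n2z[of "e - k0"] that e by (simp add: Nm)
        ultimately show ?thesis unfolding sets using e k1m by auto
      next
        case False
        then show ?thesis unfolding sets b using k1m by auto
      qed
    qed
    have V2n: "UHV2 I = UHV I {m+1..n}" for I by (simp only: UHV2 UHV V2)
    define R where "R = append_cols (UHV \<beta> \<beta>) (UHV2 \<beta>)"
    define C where "C = append_cols (UHV b b) (UHV2 b)"
    have dd1: "k1 - k0 + (n - m) = N'" "N - n2 + (n - m) = N' - n2"
      using dims k1m Nk n2(1) by (auto simp: N'_def Nm)
    have R: "R \<in> carrier_mat N N'" "\<And>i j. i < N \<Longrightarrow> j < N' \<Longrightarrow> R $$ (i, j) = g i j"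
    proof -
      have M2: "UHV2 \<beta> \<in> carrier_mat N (n - m)" 
        unfolding V2n sets N_def by (rule block[OF k1(2) order_refl])
      have e2: "UHV2 \<beta> $$ (i, j) = h (k0 + i) (m + j)" if "i < N" "j < n - m" for i j
        unfolding V2n sets by (rule block_entry[OF k1(2) order_refl]) (use that in \<open>auto simp: N_def\<close>)
      note AI = append_cols_index[OF M(1) M2]
      have w: "N + (n - m) = N'" using dd1(1) by (simp add: N_def)
      show "R \<in> carrier_mat N N'" using AI(1) by (simp add: R_def w)
      fix i j assume ij: "i < N" "j < N'"
      show "R $$ (i, j) = g i j"
      proof (cases "j < N")
        case True
        then show ?thesis using AI(2)[of i j] ij M(2)[of i j] by (simp add: R_def w)
      next
        case False
        have "m + (j - N) = k0 + j" using False Nk k1m by simp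
        then show ?thesis using AI(2)[of i j] ij e2[of i "j - N"] False w by (simp add: R_def g_def)
      qed
    qed
    have C: "C \<in> carrier_mat (N - n2) (N' - n2)"
      "\<And>i j. i < N - n2 \<Longrightarrow> j < N' - n2 \<Longrightarrow> C $$ (i, j) = g (n2 + i) (n2 + j)"
    proof -
      have M2: "UHV2 b \<in> carrier_mat (N - n2) (n - m)" 
        unfolding V2n b3 sets rest[symmetric] by (rule block[OF k1(2) order_refl])
      have e2: "UHV2 b $$ (i, j) = h (k0 + n2 + i) (m + j)" if "i < N - n2" "j < n - m" for i j
        unfolding V2n b3 sets by (rule block_entry[OF k1(2) order_refl]) (use that rest in auto)
      note AI = append_cols_index[OF M3(1)[folded b3] M2]
      show "C \<in> carrier_mat (N - n2) (N' - n2)" using AI(1) by (simp add: C_def dd1)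
      fix i j assume ij: "i < N - n2" "j < N' - n2"
      show "C $$ (i, j) = g (n2 + i) (n2 + j)"
      proof (cases "j < N - n2")
        case True
        then show ?thesis using AI(2)[of i j] ij M3(2)[of i j] by (simp add: C_def dd1 b3)
      next
        case False
        define j' where "j' = j - (N - n2)"
        have j': "m + j' = k0 + (n2 + j)" "j' < n - m"
          using False ij Nk k1m n2(1) dd1(2) by (auto simp: j'_def)
        have "j < N - n2 + (n - m)" using ij by (simp only: dd1)
        then have "C $$ (i, j) = UHV2 b $$ (i, j')"
          unfolding C_def j'_def using AI(2)[OF ij(1)] False by (simp only: if_False)
        also have "\<dots> = h (k0 + n2 + i) (m + j')" by (rule e2[OF ij(1) j'(2)])
        finally show ?thesis unfolding j'(1) g_def by (simp only: add.assoc)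
      qed
    qed
    have maxi: "D.maximal h \<longleftrightarrow> (\<exists>\<tau>\<ge>0. \<tau> * (real k - nuclear_norm Sb) = 0 \<and>
        leading_block_form N N' n1 n2 \<tau> g \<and> tail_bounded N N' n2 \<tau> g)"
      unfolding D.maximal_iff_zero_case[OF zero] nuc g_def N'_def Nm ..
    have Z1: "((0 < n1 \<longrightarrow> \<tau> \<le> ord_eigval n1 (sym_part (UHV \<beta>1 \<beta>1))) \<and> (n2 < N \<longrightarrow> sing_val 1 C \<le> \<tau>) \<and>
        R = diag_block_mat [sym_part (UHV \<beta>1 \<beta>1), \<tau> \<cdot>\<^sub>m 1\<^sub>m (n2 - n1), C])
      \<longleftrightarrow> (leading_block_form N N' n1 n2 \<tau> g \<and> tail_bounded N N' n2 \<tau> g)" if "0 \<le> \<tau>" for \<tau>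
      by (rule zero_case_matrix_form(1)[OF n12 n2(1) NN R M1 C that])
    have Z2: "(psd_mat (sym_part (UHV \<beta>1 \<beta>1)) \<and>
        R = diag_block_mat [sym_part (UHV \<beta>1 \<beta>1), 0\<^sub>m (n2 - n1) (n2 - n1), 0\<^sub>m (N - n2) (N' - n2)])
      \<longleftrightarrow> (leading_block_form N N' n1 n2 0 g \<and> tail_bounded N N' n2 0 g)"
      by (rule zero_case_matrix_form(2)[OF n12 n2(1) NN R M1 C])
    have bne: "b \<noteq> {} \<longleftrightarrow> n2 < N" unfolding b3 by (rule nonempty(2))
    have sk: "sing_val k Xb = 0" using svk zero by simp
    show ?thesis
    proof (cases "nuclear_norm Sb = real k")
      case full: True
      have "D.maximal h \<longleftrightarrow> (\<exists>\<tau>\<ge>0. (0 < n1 \<longrightarrow> \<tau> \<le> ord_eigval n1 (sym_part (UHV \<beta>1 \<beta>1))) \<and>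
          (n2 < N \<longrightarrow> sing_val 1 C \<le> \<tau>) \<and> R = diag_block_mat [sym_part (UHV \<beta>1 \<beta>1), \<tau> \<cdot>\<^sub>m 1\<^sub>m (n2 - n1), C])"
        unfolding maxi using Z1 full by (metis diff_self mult_zero_right)
      then show ?thesis
        by (intro conjI[OF first], unfold coneM cards nonempty bne R_def[symmetric] C_def[symmetric])
          (use sk full in \<open>simp only: less_irrefl simp_thms\<close>)
    next
      case notfull: False
      then have lt: "nuclear_norm Sb < real k" using ssum nuc by simp
      have "D.maximal h \<longleftrightarrow> leading_block_form N N' n1 n2 0 g \<and> tail_bounded N N' n2 0 g"
        unfolding maxi using lt by force
      then have "D.maximal h \<longleftrightarrow> psd_mat (sym_part (UHV \<beta>1 \<beta>1)) \<and>
          R = diag_block_mat [sym_part (UHV \<beta>1 \<beta>1), 0\<^sub>m (n2 - n1) (n2 - n1), 0\<^sub>m (N - n2) (N' - n2)]"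
        unfolding Z2 .
      then show ?thesis
        by (intro conjI[OF first], unfold coneM cards nonempty bne R_def[symmetric] C_def[symmetric] dd1(2))
          (use sk lt notfull in \<open>simp only: less_irrefl simp_thms\<close>)
    qed
  qed
qed

end
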